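(* Let $n\ge 2$, let $f\in C_c^\infty(M(n))$, and let $u$ be the solution, $u(\cdot,t)=e^{it\Delta_G}f$, of the initial value problem $$\frac{\partial u}{\partial t}(g,t)=i\Delta_G u(g,t)\quad (g\in M(n),\ t\in\mathbb{R}),\qquad u(g,0)=f(g)\quad(g\in M(n)).$$ Let $\theta$ be a non-negative locally integrable function on $[0,\infty)$, and suppose that for some non-zero $t_0\in\mathbb{R}$ and some constant $C>0$, $$|u((x,k),t_0)|\le C e^{-\theta(\|x\|)}\quad\text{for all } (x,k)\in M(n).$$ If $\int_0^\infty\frac{\theta(r)}{1+r^2}\,dr=\infty$, then $u=0$ on $M(n)\times\mathbb{R}$.
   Context: $G=M(n)=\mathbb{R}^n\rtimes SO(n)$ is the Euclidean motion group, with law $(x_1,k_1)(x_2,k_2)=(x_1+k_1\cdot x_2,k_1k_2)$ and Haar measure $dx\,dk$ ($dx$ Lebesgue measure, $dk$ normalized Haar measure on $SO(n)$). $C_c^\infty(M(n))$ denotes the complex-valued compactly supported smooth functions. The Laplacian on $G$ is $\Delta_G=\Delta_{\mathbb{R}^n}+\Delta_{SO(n)}$, where $\Delta_{\mathbb{R}^n}$ is the standard Laplacian acting in the variable $x$ and $\Delta_{SO(n)}=T_1^2+\cdots+T_N^2$ acts in the variable $k$, with $T_1,\dots,T_N$ an orthonormal basis of $\mathfrak{so}(n)$ with respect to a fixed $\mathrm{Ad}(SO(n))$-invariant inner product, acting as left invariant vector fields: $(Tf)(x,k)=\frac{d}{dt}\big|_{t=0}f(x,k\exp tT)$. It is self-adjoint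 on $L^2(M(n))$, and $e^{it\Delta_G}$ is the unitary operator defined by the spectral theorem. Explicitly, for $\pi\in\widehat{SO(n)}$ (the equivalence classes of irreducible unitary representations) of degree $d_\pi$ with matrix coefficients $\phi^\pi_{ij}(k)=\langle\pi(k)e_j,e_i\rangle$, let $\lambda_\pi\ge 0$ be such that $\Delta_{SO(n)}\phi^\pi_{ij}=-\lambda_\pi\phi^\pi_{ij}$, and let $f^\pi_{ij}(x)=\int_{SO(n)}f(x,k)\overline{\phi^\pi_{ij}(k)}\,dk$. Then, in $L^2(M(n))$, $$e^{it\Delta_G}f(x,k)=\sum_{\pi\in\widehat{SO(n)}}d_\pi\sum_{i,j=1}^{d_\pi}\left((2\pi)^{-n}\int_{\mathbb{R}^n}e^{-it(\|\xi\|^2+\lambda_\pi)}\,\widehat{f^\pi_{ij}}(\xi)\,e^{i\xi\cdot x}\,d\xi\right)\phi^\pi_{ij}(k),$$ where $\hat h(\xi)=\int_{\mathbb{R}^n}h(x)e^{-ix\cdot\xi}dx$. For $f\in C_c^\infty(M(n))$, $u(\cdot,t)=e^{it\Delta_G}f$ is understood as its smooth representative. *)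

theory Defs
  imports
    "Jordan_Normal_Form.Schur_Decomposition"
    "Jordan_Normal_Form.VS_Connect"
    "HOL-Analysis.Analysis"
    "HOL-Probability.Probability_Measure"
begin

section \<open>The Euclidean motion group\<close>

text \<open>
  The dimension \<open>n\<close> is \<open>CARD('n)\<close>. The group \<open>SO(n)\<close>, its Lie algebra and the motion group are
  carrier sets, so functions on them are only ever evaluated on these carriers. The group law
  \<open>(x, k) (y, l) = (x + k y, k l)\<close> enters only through its Haar measure, the product measure
  \<open>motion_haar\<close>, and through the left invariant vector fields \<open>left_inv_deriv\<close>.
\<close>

type_synonym 'n sqmat = "real^'n^'n"
type_synonym 'n motion = "(real^'n) \<times> (real^'n^'n)"

definition SO :: "('n::finite) sqmat set" where
  "SO = {k. orthogonal_matrix k \<and> Determinants.det k = 1}"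

definition so_alg :: "('n::finite) sqmat set" where
  "so_alg = {X. Finite_Cartesian_Product.transpose X = - X}"

definition motion_group :: "('n::finite) motion set" where
  "motion_group = UNIV \<times> SO"

text \<open>The matrix exponential; \<open>exp\<close> is not available for the type \<open>real^'n^'n\<close>.\<close>

definition mat_exp :: "('n::finite) sqmat \<Rightarrow> 'n sqmat" where
  "mat_exp A = (\<Sum>m. (1 / fact m) *\<^sub>R (((**) A ^^ m) (Finite_Cartesian_Product.mat 1)))"

text \<open>On a compact group a left invariant probability measure is automatically bi-invariant.\<close>

definition normalized_haar :: "('n::finite) sqmat measure \<Rightarrow> bool" where
  "normalized_haar \<mu> \<longleftrightarrow>
     prob_space \<mu> \<and> sets \<mu> = sets (restrict_space borel SO) \<and>
     (\<forall>a\<in>SO. distr \<mu> \<mu> (\<lambda>k. a ** k) = \<mu>)"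

definition motion_haar :: "('n::finite) sqmat measure \<Rightarrow> 'n motion measure" where
  "motion_haar \<mu> = lborel \<Otimes>\<^sub>M \<mu>"

section \<open>Smooth functions\<close>

text \<open>\<open>Ck_on m U f\<close> means that \<open>f\<close> is of class \<open>C^m\<close> on \<open>U\<close>; it is meant for open subsets \<open>U\<close> of a
  finite-dimensional space.\<close>

primrec Ck_on :: "nat \<Rightarrow> 'a::euclidean_space set \<Rightarrow> ('a \<Rightarrow> complex) \<Rightarrow> bool" where
  "Ck_on 0 U f \<longleftrightarrow> continuous_on U f"
| "Ck_on (Suc m) U f \<longleftrightarrow>
     f differentiable_on U \<and> (\<forall>v. Ck_on m U (\<lambda>x. frechet_derivative f (at x) v))"

text \<open>Smoothness on the closed submanifold \<open>motion_group\<close> of the ambient Euclidean space is the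
  existence of a smooth extension to an open neighbourhood.\<close>

definition smooth_motion :: "(('n::finite) motion \<Rightarrow> complex) \<Rightarrow> bool" where
  "smooth_motion f \<longleftrightarrow>
     (\<exists>U F. open U \<and> motion_group \<subseteq> U \<and> (\<forall>m. Ck_on m U F) \<and> (\<forall>g\<in>motion_group. F g = f g))"

definition test_function :: "(('n::finite) motion \<Rightarrow> complex) \<Rightarrow> bool" where
  "test_function f \<longleftrightarrow> smooth_motion f \<and>
     (\<exists>K. compact K \<and> K \<subseteq> motion_group \<and> (\<forall>g\<in>motion_group - K. f g = 0))"

section \<open>Laplacians\<close>

definition ad_invariant_inner :: "(('n::finite) sqmat \<Rightarrow> 'n sqmat \<Rightarrow> real) \<Rightarrow> bool" where
  "ad_invariant_inner B \<longleftrightarrow>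
     (\<forall>X\<in>so_alg. \<forall>Y\<in>so_alg. \<forall>Z\<in>so_alg. B (X + Y) Z = B X Z + B Y Z) \<and>
     (\<forall>c. \<forall>X\<in>so_alg. \<forall>Y\<in>so_alg. B (c *\<^sub>R X) Y = c * B X Y) \<and>
     (\<forall>X\<in>so_alg. \<forall>Y\<in>so_alg. B X Y = B Y X) \<and>
     (\<forall>X\<in>so_alg. X \<noteq> 0 \<longrightarrow> B X X > 0) \<and>
     (\<forall>k\<in>SO. \<forall>X\<in>so_alg. \<forall>Y\<in>so_alg.
        B (k ** X ** matrix_inv k) (k ** Y ** matrix_inv k) = B X Y)"

definition so_orthonormal_basis ::
  "(('n::finite) sqmat \<Rightarrow> 'n sqmat \<Rightarrow> real) \<Rightarrow> 'n sqmat set \<Rightarrow> bool" where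
  "so_orthonormal_basis B E \<longleftrightarrow>
     finite E \<and> (\<forall>X\<in>E. \<forall>Y\<in>E. B X Y = (if X = Y then 1 else 0)) \<and> real_vector.span E = so_alg"

definition left_inv_deriv :: "('n::finite) sqmat \<Rightarrow> ('n sqmat \<Rightarrow> complex) \<Rightarrow> 'n sqmat \<Rightarrow> complex" where
  "left_inv_deriv X h k = vector_derivative (\<lambda>s. h (k ** mat_exp (s *\<^sub>R X))) (at 0)"

definition laplacian_SO :: "('n::finite) sqmat set \<Rightarrow> ('n sqmat \<Rightarrow> complex) \<Rightarrow> 'n sqmat \<Rightarrow> complex" where
  "laplacian_SO E h k = (\<Sum>X\<in>E. left_inv_deriv X (left_inv_deriv X h) k)"

definition dir_deriv :: "'a::euclidean_space \<Rightarrow> ('a \<Rightarrow> complex) \<Rightarrow> 'a \<Rightarrow> complex" where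
  "dir_deriv b h x = vector_derivative (\<lambda>s. h (x + s *\<^sub>R b)) (at 0)"

definition laplacian_Rn :: "('a::euclidean_space \<Rightarrow> complex) \<Rightarrow> 'a \<Rightarrow> complex" where
  "laplacian_Rn h x = (\<Sum>b\<in>Basis. dir_deriv b (dir_deriv b h) x)"

definition laplacian_motion ::
  "('n::finite) sqmat set \<Rightarrow> ('n motion \<Rightarrow> complex) \<Rightarrow> 'n motion \<Rightarrow> complex" where
  "laplacian_motion E f g =
     laplacian_Rn (\<lambda>y. f (y, snd g)) (fst g) + laplacian_SO E (\<lambda>l. f (fst g, l)) (snd g)"

section \<open>The unitary dual of the rotation group\<close>

type_synonym 'n rep = "'n sqmat \<Rightarrow> complex Matrix.mat"

definition degree_rep :: "('n::finite) rep \<Rightarrow> nat" where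
  "degree_rep \<pi> = dim_row (\<pi> (Finite_Cartesian_Product.mat 1))"

definition unitary_rep :: "('n::finite) rep \<Rightarrow> bool" where
  "unitary_rep \<pi> \<longleftrightarrow>
     (\<forall>k\<in>SO. \<pi> k \<in> carrier_mat (degree_rep \<pi>) (degree_rep \<pi>) \<and>
             mat_adjoint (\<pi> k) * \<pi> k = 1\<^sub>m (degree_rep \<pi>)) \<and>
     (\<forall>k\<in>SO. \<forall>l\<in>SO. \<pi> (k ** l) = \<pi> k * \<pi> l) \<and>
     (\<forall>i<degree_rep \<pi>. \<forall>j<degree_rep \<pi>. continuous_on SO (\<lambda>k. \<pi> k $$ (i, j)))"

definition irreducible_rep :: "('n::finite) rep \<Rightarrow> bool" where
  "irreducible_rep \<pi> \<longleftrightarrow>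
     unitary_rep \<pi> \<and> degree_rep \<pi> > 0 \<and>
     (\<forall>W. VectorSpace.subspace class_ring W (module_vec TYPE(complex) (degree_rep \<pi>)) \<and>
          (\<forall>k\<in>SO. \<forall>w\<in>W. \<pi> k *\<^sub>v w \<in> W) \<longrightarrow>
          W = {0\<^sub>v (degree_rep \<pi>)} \<or> W = carrier_vec (degree_rep \<pi>))"

definition equivalent_rep :: "('n::finite) rep \<Rightarrow> 'n rep \<Rightarrow> bool" where
  "equivalent_rep \<pi> \<sigma> \<longleftrightarrow>
     degree_rep \<pi> = degree_rep \<sigma> \<and>
     (\<exists>A\<in>carrier_mat (degree_rep \<pi>) (degree_rep \<pi>).
        invertible_mat A \<and> (\<forall>k\<in>SO. A * \<pi> k = \<sigma> k * A))"

text \<open>The unitary dual, given by a system of representatives of the equivalence classes of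
  irreducible unitary representations.\<close>

definition unitary_dual :: "('n::finite) rep set \<Rightarrow> bool" where
  "unitary_dual P \<longleftrightarrow>
     (\<forall>\<pi>\<in>P. irreducible_rep \<pi>) \<and>
     (\<forall>\<sigma>. irreducible_rep \<sigma> \<longrightarrow> (\<exists>!\<pi>. \<pi> \<in> P \<and> equivalent_rep \<sigma> \<pi>))"

text \<open>By Schur's lemma the Laplacian acts on the coefficients of an irreducible representation by a
  scalar (\<open>\<pi> k $$ (i, j)\<close> is the matrix coefficient \<open>\<langle>\<pi>(k) e\<^sub>j, e\<^sub>i\<rangle>\<close>), so the description below determines a unique real number for \<open>\<pi> \<in> P\<close>, \<open>unitary_dual P\<close>.\<close>

definition eigenvalue_rep :: "('n::finite) sqmat set \<Rightarrow> 'n rep \<Rightarrow> real" where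
  "eigenvalue_rep E \<pi> = (THE c. c \<ge> 0 \<and>
     (\<forall>i<degree_rep \<pi>. \<forall>j<degree_rep \<pi>. \<forall>k\<in>SO.
        laplacian_SO E (\<lambda>l. \<pi> l $$ (i, j)) k = - of_real c * \<pi> k $$ (i, j)))"

section \<open>The Schroedinger evolution\<close>

definition fourier :: "('a::euclidean_space \<Rightarrow> complex) \<Rightarrow> 'a \<Rightarrow> complex" where
  "fourier h \<xi> = (LINT x|lborel. h x * exp (- \<i> * of_real (inner x \<xi>)))"

definition coeff_fun ::
  "('n::finite) sqmat measure \<Rightarrow> 'n rep \<Rightarrow> nat \<Rightarrow> nat \<Rightarrow> ('n motion \<Rightarrow> complex) \<Rightarrow> real^'n \<Rightarrow> complex" where
  "coeff_fun \<mu> \<pi> i j f x = (LINT k|\<mu>. f (x, k) * cnj (\<pi> k $$ (i, j)))"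

definition schroedinger_term ::
  "('n::finite) sqmat measure \<Rightarrow> 'n sqmat set \<Rightarrow> ('n motion \<Rightarrow> complex) \<Rightarrow> real \<Rightarrow> 'n rep \<Rightarrow>
   'n motion \<Rightarrow> complex" where
  "schroedinger_term \<mu> E f t \<pi> g =
     of_nat (degree_rep \<pi>) * (\<Sum>i<degree_rep \<pi>. \<Sum>j<degree_rep \<pi>.
       (of_real (1 / (2 * pi) ^ CARD('n)) *
        (LINT \<xi>|lborel. exp (- \<i> * of_real (t * ((norm \<xi>)\<^sup>2 + eigenvalue_rep E \<pi>))) *
            fourier (coeff_fun \<mu> \<pi> i j f) \<xi> * exp (\<i> * of_real (inner \<xi> (fst g))))) *
       \<pi> (snd g) $$ (i, j))"

text \<open>\<open>evolves_to \<mu> E P f t v\<close> says that \<open>v\<close> represents \<open>e\<^bsup>it\<Delta>\<^esup>f\<close> in \<open>L\<^sup>2\<close>: the series over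
  the unitary dual converges to \<open>v\<close> unconditionally in \<open>L\<^sup>2\<close> of the motion group.\<close>

definition evolves_to ::
  "('n::finite) sqmat measure \<Rightarrow> 'n sqmat set \<Rightarrow> 'n rep set \<Rightarrow> ('n motion \<Rightarrow> complex) \<Rightarrow> real \<Rightarrow>
   ('n motion \<Rightarrow> complex) \<Rightarrow> bool" where
  "evolves_to \<mu> E P f t v \<longleftrightarrow>
     ((\<lambda>F. \<integral>\<^sup>+g. ennreal ((cmod (v g - (\<Sum>\<pi>\<in>F. schroedinger_term \<mu> E f t \<pi> g)))\<^sup>2)
            \<partial>motion_haar \<mu>) \<longlongrightarrow> 0) (finite_subsets_at_top P)"

text \<open>The smooth representative of \<open>e\<^bsup>it\<Delta>\<^esup>f\<close> automatically satisfies the initial value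
  problem; it is stated as part of the notion of solution nevertheless.\<close>

definition schroedinger_solution ::
  "('n::finite) sqmat measure \<Rightarrow> 'n sqmat set \<Rightarrow> 'n rep set \<Rightarrow> ('n motion \<Rightarrow> complex) \<Rightarrow>
   ('n motion \<Rightarrow> real \<Rightarrow> complex) \<Rightarrow> bool" where
  "schroedinger_solution \<mu> E P f u \<longleftrightarrow>
     (\<forall>t. smooth_motion (\<lambda>g. u g t) \<and> evolves_to \<mu> E P f t (\<lambda>g. u g t)) \<and>
     (\<forall>g\<in>motion_group. \<forall>t.
        (u g has_vector_derivative \<i> * laplacian_motion E (\<lambda>h. u h t) g) (at t)) \<and>
     (\<forall>g\<in>motion_group. u g 0 = f g)"

end

theory Submission
  imports
    Defs
    "HOL-Complex_Analysis.Conformal_Mappings"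
    "HOL-Probability.Characteristic_Functions"
begin

text \<open>
  The idea is to reduce the problem on the motion group to a statement about one compactly supported
  function on \<open>\<real>\<^sup>n\<close> and its Fourier transform along lines.

  Fix an irreducible representation \<open>\<pi>\<close> and one of its matrix entries \<open>(k, l)\<close>. Pairing the \<open>\<pi>\<close>-term of
  the series for \<open>e\<^bsup>it\<Delta>\<^esup>f\<close> with this entry over \<open>SO(n)\<close> gives, up to a scalar of constant modulus, the free
  Schroedinger evolution on \<open>\<real>\<^sup>n\<close> of a compactly supported function \<open>h\<close> that is the same for all times
  (\<open>coeff_schroedinger_term_free_evolution\<close>). Matrix entries of inequivalent representations are
  orthogonal, so convergence of the series in \<open>L\<^sup>2\<close> identifies this pairing with the pairing of
  \<open>u(\<cdot>, t)\<close> itself (\<open>evolves_to_coeff\<close>). At time \<open>t\<^sub>0\<close> it therefore inherits the bound by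
  \<open>C e\<^bsup>-\<theta>(|x|)\<^esup>\<close>.

  The kernel of the free evolution is a quadratic phase (\<open>free_evolution_kernel\<close>). Hence the modulus of
  the evolved \<open>h\<close> at \<open>x\<close> is, up to a constant, the modulus at \<open>x / 2t\<^sub>0\<close> of the Fourier transform of \<open>h\<close>
  times a unimodular function, which is again compactly supported. On every line through the origin such
  a Fourier transform is an entire function of exponential type, bounded on the real axis. An entire
  function of this kind whose logarithm has a divergent Poisson integral vanishes on the positive
  imaginary axis (\<open>log_integral_divergent_imp_zero\<close>). So all values of the Laplace transform are zero, and by
  the density of exponential sums \<open>h = 0\<close> (\<open>free_evolution_decay_imp_zero\<close>).

  Since \<open>h\<close> does not depend on time, every pairing of the \<open>\<pi>\<close>-term with an entry of \<open>\<pi>\<close> is zero at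
  every time. As the \<open>\<pi>\<close>-term is a combination of these entries, it has norm zero
  (\<open>schroedinger_term_AE_zero\<close>). All terms of the series vanish, so \<open>u(\<cdot>, t)\<close> is zero almost everywhere,
  and being continuous it is zero (\<open>evolves_to_zero\<close>).
\<close>

section \<open>Divergent logarithmic integrals\<close>

lemma integral_period_shift:
  fixes Q :: "real \<Rightarrow> real"
  assumes cont: "continuous_on UNIV Q" and per: "\<And>v. Q (v + p) = Q v"
    and "c \<le> a" "a \<le> c + p"
  shows "integral {a..a + p} Q = integral {c..c + p} Q"
proof -
  have int: "Q integrable_on {x..y}" for x y
    by (intro integrable_continuous_real continuous_on_subset[OF cont]) auto
  have "integral {c..c + p} Q = integral {c..a} Q + integral {a..c + p} Q"
    by (rule Henstock_Kurzweil_Integration.integral_combine[symmetric]) (use assms int in auto)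
  moreover have "integral {a..a + p} Q = integral {a..c + p} Q + integral {c + p..a + p} Q"
    by (rule Henstock_Kurzweil_Integration.integral_combine[symmetric]) (use assms int in auto)
  moreover have "integral {c + p..a + p} Q = integral {c..a} Q"
    using integral_shift_real_ivl[of "c + p" p "a + p" Q] by (simp add: per)
  ultimately show ?thesis by simp
qed

lemma integral_split_equidistant:
  fixes Q :: "real \<Rightarrow> real"
  assumes cont: "continuous_on UNIV Q" and "0 \<le> h"
  shows "integral {a..a + real N * h} Q = (\<Sum>j<N. integral {a + real j * h..a + real j * h + h} Q)"
proof (induction N)
  case (Suc N)
  have int: "Q integrable_on {x..y}" for x y
    by (intro integrable_continuous_real continuous_on_subset[OF cont]) auto
  have "integral {a..a + real (Suc N) * h} Q =
      integral {a..a + real N * h} Q + integral {a + real N * h..a + real (Suc N) * h} Q"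
    by (rule Henstock_Kurzweil_Integration.integral_combine[symmetric])
       (use int \<open>0 \<le> h\<close> in \<open>auto simp: algebra_simps\<close>)
  then show ?case using Suc by (simp add: algebra_simps)
qed auto

text \<open>
  By uniform continuity one step size serves all starting points; this uniformity is what the maximum
  principle asks for below.
\<close>

lemma equidistant_sum_le_integral:
  fixes Q :: "real \<Rightarrow> real"
  assumes cont: "continuous_on UNIV Q" and per: "\<And>v. Q (v + pi) = Q v" and "0 < \<delta>"
  obtains N :: nat where "N > 0"
    "\<And>a. a \<in> {-pi/2..pi/2} \<Longrightarrow>
       (\<Sum>j<N. Q (a + real j * (pi / N))) \<le> N * (integral {-pi/2..pi/2} Q / pi + \<delta>)"
proof -
  have "uniformly_continuous_on {-pi/2..3*pi/2} Q"
    by (rule compact_uniformly_continuous[OF continuous_on_subset[OF cont]]) auto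
  from uniformly_continuous_onE[OF this \<open>0 < \<delta>\<close>] obtain \<eta> where "\<eta> > 0" and
    \<eta>: "\<And>x y. \<lbrakk>x \<in> {-pi/2..3*pi/2}; y \<in> {-pi/2..3*pi/2}; dist y x < \<eta>\<rbrakk> \<Longrightarrow> dist (Q y) (Q x) < \<delta>"
    by metis
  obtain N0 where N0: "pi / \<eta> < real N0" using reals_Archimedean2 by blast
  define N where "N = Suc N0"
  have "N > 0" by (simp add: N_def)
  define h where "h = pi / N"
  have h: "0 < h" "h < \<eta>" "real N * h = pi"
    using N0 \<open>\<eta> > 0\<close> by (auto simp: h_def N_def field_simps add_strict_increasing2)
  have int: "Q integrable_on {x..y}" for x y
    by (intro integrable_continuous_real continuous_on_subset[OF cont]) auto
  have "(\<Sum>j<N. Q (a + real j * h)) \<le> N * (integral {-pi/2..pi/2} Q / pi + \<delta>)"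
    if a: "a \<in> {-pi/2..pi/2}" for a
  proof -
    have "h * (Q (a + real j * h) - \<delta>) \<le> integral {a + real j * h..a + real j * h + h} Q"
      if "j < N" for j
    proof -
      let ?c = "a + real j * h"
      have "0 \<le> real j * h" using h by simp
      have "real j * h + h \<le> real N * h"
        using that h(1) by (metis Suc_leI distrib_right mult_1 mult_le_cancel_right_pos of_nat_Suc of_nat_le_iff add.commute)
      then have "-pi/2 \<le> ?c" "?c + h \<le> 3*pi/2"
        using a h \<open>0 \<le> real j * h\<close> unfolding atLeastAtMost_iff by linarith+
      then have sub: "{?c..?c + h} \<subseteq> {-pi/2..3*pi/2}" by auto
      have "integral {?c..?c + h} (\<lambda>x. Q ?c - \<delta>) \<le> integral {?c..?c + h} Q"
      proof (rule integral_le)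
        fix x assume x: "x \<in> {?c..?c + h}"
        then have "dist (Q x) (Q ?c) < \<delta>"
          by (intro \<eta>) (use sub h in \<open>auto simp: dist_real_def\<close>)
        then show "Q ?c - \<delta> \<le> Q x" by (auto simp: dist_real_def)
      qed (use int in auto)
      then show ?thesis using h by simp
    qed
    then have "(\<Sum>j<N. h * (Q (a + real j * h) - \<delta>)) \<le> integral {a..a + real N * h} Q"
      by (subst integral_split_equidistant[OF cont]) (use h in \<open>auto intro!: sum_mono\<close>)
    also have "\<dots> = integral {-pi/2..pi/2} Q"
      using integral_period_shift[OF cont, of pi "-pi/2" a] a per h by simp
    finally have "h * ((\<Sum>j<N. Q (a + real j * h)) - N * \<delta>) \<le> integral {-pi/2..pi/2} Q"
      by (simp add: sum_subtractf flip: sum_distrib_left)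
    then show ?thesis using h \<open>N > 0\<close> by (auto simp: h_def field_simps)
  qed
  with that[OF \<open>N > 0\<close>] show ?thesis by (simp add: h_def)
qed

text \<open>
  This is Jensen's inequality \<open>log |H 0| \<le> mean of log |H|\<close> with a continuous majorant \<open>Q\<close> in place
  of \<open>log |H|\<close>. No zeros have to be factored out: the product of the rotations of \<open>H\<close> by the \<open>N\<close>-th
  roots of unity is holomorphic with value \<open>(H 0)\<^sup>N\<close> at the centre, and on the circle its modulus is
  at most the exponential of an equidistant sum of \<open>Q\<close>. The circle is parametrised by the double
  angle because the Cayley transform turns \<open>cis (2 * v)\<close> into \<open>tan v\<close>.
\<close>

lemma norm_center_le_exp_mean:
  fixes H :: "complex \<Rightarrow> complex" and Q :: "real \<Rightarrow> real" and r R :: real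
  assumes H: "H holomorphic_on ball 0 R" and r: "0 < r" "r < R"
    and cont: "continuous_on UNIV Q" and per: "\<And>v. Q (v + pi) = Q v"
    and le: "\<And>v. norm (H (r * cis (2 * v))) \<le> exp (Q v)"
  shows "norm (H 0) \<le> exp (integral {-pi/2..pi/2} Q / pi)"
proof -
  let ?I = "integral {-pi/2..pi/2} Q / pi"
  have bound: "norm (H 0) \<le> exp (?I + \<delta>)" if "\<delta> > 0" for \<delta>
  proof -
    obtain N :: nat where N: "N > 0" "\<And>a. a \<in> {-pi/2..pi/2} \<Longrightarrow>
       (\<Sum>j<N. Q (a + real j * (pi / N))) \<le> N * (?I + \<delta>)"
      using equidistant_sum_le_integral[OF cont per \<open>\<delta> > 0\<close>] by blast
    define P where "P w = (\<Prod>j<N. H (w * cis (2 * (real j * (pi / N)))))" for w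
    have mem: "w * cis x \<in> ball 0 R" if "w \<in> ball 0 R" for w x
      using that by (simp add: norm_mult)
    have "(H \<circ> (\<lambda>w. w * cis x)) holomorphic_on ball 0 R" for x
      by (rule holomorphic_on_compose_gen[OF _ H]) (use mem in \<open>auto intro!: holomorphic_intros\<close>)
    then have holP: "P holomorphic_on ball 0 R"
      unfolding P_def by (intro holomorphic_intros) (auto simp: o_def)
    have "norm (P 0) \<le> exp (N * (?I + \<delta>))"
    proof (rule maximum_modulus_frontier[of P "cball 0 r"])
      show "P holomorphic_on interior (cball 0 r)"
        by (rule holomorphic_on_subset[OF holP]) (use r in auto)
      show "continuous_on (closure (cball 0 r)) P"
        by (rule continuous_on_subset[OF holomorphic_on_imp_continuous_on[OF holP]]) (use r in auto)
      fix z :: complex assume "z \<in> frontier (cball 0 r)"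
      then have z: "norm z = r" by (simp add: frontier_cball)
      define a where "a = Arg z / 2"
      have a: "a \<in> {-pi/2..pi/2}" using Arg_bounded[of z] by (auto simp: a_def)
      have za: "z = r * cis (2 * a)"
        using rcis_cmod_Arg[of z] z by (simp add: rcis_def a_def)
      have "norm (P z) = (\<Prod>j<N. norm (H (r * cis (2 * (a + real j * (pi / N))))))"
        unfolding P_def prod_norm[symmetric] za by (simp add: mult.assoc cis_mult algebra_simps)
      also have "\<dots> \<le> (\<Prod>j<N. exp (Q (a + real j * (pi / N))))"
        by (intro prod_mono conjI le) auto
      also have "\<dots> = exp (\<Sum>j<N. Q (a + real j * (pi / N)))" by (simp add: exp_sum)
      also have "\<dots> \<le> exp (N * (?I + \<delta>))" using N(2)[OF a] by simp
      finally show "norm (P z) \<le> exp (N * (?I + \<delta>))" .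
    qed (use r in auto)
    then have "norm (H 0) ^ N \<le> exp (?I + \<delta>) ^ N"
      by (simp add: P_def prod_constant norm_power exp_of_nat_mult)
    then show ?thesis using N(1) by (simp add: power_mono_iff)
  qed
  have "((\<lambda>\<delta>. exp (?I + \<delta>)) \<longlongrightarrow> exp (?I + 0)) (at_right 0)" by (intro tendsto_intros)
  moreover have "eventually (\<lambda>\<delta>. norm (H 0) \<le> exp (?I + \<delta>)) (at_right 0)"
    using bound by (auto simp: eventually_at_filter)
  ultimately show ?thesis
    using tendsto_lowerbound[of "\<lambda>\<delta>. exp (?I + \<delta>)" "exp (?I + 0)" "at_right 0" "norm (H 0)"] by simp
qed


text \<open>
  The Cayley transform \<open>Z\<close> carries the unit disc to the upper half plane with centre \<open>\<i>b\<close>, so that the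
  mean inequality on circles of radius \<open>x < 1\<close> becomes, as \<open>x \<rightarrow> 1\<close>, an inequality for the Poisson
  integral on the real line. Cutting \<open>|G|\<close> off from below at \<open>\<epsilon>\<close> keeps the integrand continuous and
  non-negative, which permits the restriction to the finite interval and the passage to the limit.
\<close>

lemma poisson_integral_log_le:
  fixes G :: "complex \<Rightarrow> complex" and b \<epsilon> T :: real
  assumes hol: "G holomorphic_on UNIV" and le1: "\<And>z. Im z \<ge> 0 \<Longrightarrow> norm (G z) \<le> 1"
    and b: "b > 0" and nz: "G (\<i> * b) \<noteq> 0" and \<epsilon>: "0 < \<epsilon>" "\<epsilon> \<le> 1" and T: "0 \<le> T"
  shows "integral {-T..T} (\<lambda>s. - ln (max (norm (G s)) \<epsilon>) * (b / (b\<^sup>2 + s\<^sup>2)))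
           \<le> - pi * ln (norm (G (\<i> * b)))"
proof -
  define Z where "Z w = \<i> * b * (1 - w) / (1 + w)" for w :: complex
  define q where "q x v = - ln (max (norm (G (Z (of_real x * cis (2 * v))))) \<epsilon>)" for x v :: real
  define a where "a = arctan (T / b)"
  have a: "0 \<le> a" "a < pi/2" using T b arctan_ubound by (auto simp: a_def)
  have imZ: "Im (Z w) \<ge> 0" if "norm w \<le> 1" for w
  proof -
    have "(Re w)\<^sup>2 + (Im w)\<^sup>2 \<le> 1" using that by (simp add: cmod_def)
    then have "0 \<le> b * (1 - ((Re w)\<^sup>2 + (Im w)\<^sup>2))" using b by simp
    moreover have "Im (Z w) = b * (1 - ((Re w)\<^sup>2 + (Im w)\<^sup>2)) / ((1 + Re w)\<^sup>2 + (Im w)\<^sup>2)"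
      by (simp add: Z_def Im_divide power2_eq_square algebra_simps)
    ultimately show ?thesis by simp
  qed
  have ne: "1 + w \<noteq> 0" if "norm w < 1" for w :: complex
    using that by (metis add_eq_0_iff2 norm_minus_cancel norm_one less_irrefl)
  have q_nonneg: "0 \<le> q x v" if "0 \<le> x" "x \<le> 1" for x v
  proof -
    have "norm (of_real x * cis (2 * v)) \<le> 1" using that by (simp add: norm_mult)
    then have "max (norm (G (Z (of_real x * cis (2 * v))))) \<epsilon> \<le> 1"
      using le1[OF imZ] \<epsilon> by auto
    then show ?thesis using \<epsilon> by (simp add: q_def ln_le_zero_iff less_max_iff_disj)
  qed
  have contG: "continuous_on UNIV G" by (rule holomorphic_on_imp_continuous_on[OF hol])
  have cont_q: "continuous_on S (\<lambda>(x, v). q x v)"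
    if "\<And>x v. (x, v) \<in> S \<Longrightarrow> 1 + of_real x * cis (2 * v) \<noteq> 0" for S
    unfolding q_def Z_def case_prod_beta
    by (intro continuous_intros continuous_on_compose2[OF contG]) (use that \<epsilon> in \<open>auto simp: less_max_iff_disj max_def split: if_splits\<close>)
  have le: "integral {-a..a} (q x) \<le> - pi * ln (norm (G (\<i> * b)))" if x: "0 < x" "x < 1" for x
  proof -
    have ne': "1 + of_real x * cis (2 * v) \<noteq> 0" for v
      by (rule ne) (use x in \<open>simp add: norm_mult\<close>)
    have cont: "continuous_on S (q x)" for S
    proof -
      have "continuous_on UNIV (\<lambda>v. (\<lambda>(x, v). q x v) (x, v))"
        by (rule continuous_on_compose2[OF cont_q[of "{x} \<times> UNIV"]])
           (use ne' in \<open>auto intro!: continuous_intros\<close>)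
      then show ?thesis by (auto intro: continuous_on_subset)
    qed
    have "norm ((G \<circ> Z) 0) \<le> exp (integral {-pi/2..pi/2} (\<lambda>v. - q x v) / pi)"
    proof (rule norm_center_le_exp_mean[where R = 1 and r = x])
      show "(G \<circ> Z) holomorphic_on ball 0 1"
        by (rule holomorphic_on_compose[OF _ holomorphic_on_subset[OF hol]])
           (use ne in \<open>auto simp: Z_def[abs_def] intro!: holomorphic_intros\<close>)
      show "continuous_on UNIV (\<lambda>v. - q x v)" by (intro continuous_intros cont)
      show "- q x (v + pi) = - q x v" for v
        by (simp add: q_def distrib_left flip: cis_mult)
      show "norm ((G \<circ> Z) (of_real x * cis (2 * v))) \<le> exp (- q x v)" for v
        using \<epsilon> by (simp add: q_def less_max_iff_disj)
    qed (use x in auto)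
    then have "norm (G (\<i> * b)) \<le> exp (- integral {-pi/2..pi/2} (q x) / pi)" by (simp add: Z_def)
    then have "ln (norm (G (\<i> * b))) \<le> - integral {-pi/2..pi/2} (q x) / pi"
      using nz by (metis ln_exp ln_mono exp_gt_zero zero_less_norm_iff)
    then have "integral {-pi/2..pi/2} (q x) \<le> - pi * ln (norm (G (\<i> * b)))"
      by (simp add: field_simps)
    moreover have "integral {-a..a} (q x) \<le> integral {-pi/2..pi/2} (q x)"
      by (rule integral_subset_le)
         (use a x q_nonneg cont in \<open>auto intro!: integrable_continuous_real\<close>)
    ultimately show ?thesis by simp
  qed
  have tanZ: "Z (cis (2 * v)) = of_real (b * tan v)" and ne1: "1 + cis (2 * v) \<noteq> 0" if "\<bar>v\<bar> < pi/2" for v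
  proof -
    have c: "cos v > 0" using that by (intro cos_gt_zero_pi) auto
    have "Re (1 + cis (2 * v)) > 0" using c by (simp add: cos_double_cos)
    then show ne: "1 + cis (2 * v) \<noteq> 0" by (metis less_irrefl zero_complex.sel(1))
    have "(cos v)\<^sup>2 + (sin v)\<^sup>2 = 1" by simp
    then have s2: "cos v * (cos v * 2) + sin v * (sin v * 2) = 2" unfolding power2_eq_square by linarith
    have "\<i> * b * (1 - cis (2 * v)) = of_real (b * tan v) * (1 + cis (2 * v))"
      unfolding complex_eq_iff using c
      by (simp add: tan_def sin_double cos_double_cos) (simp add: power2_eq_square field_simps s2)
    then show "Z (cis (2 * v)) = of_real (b * tan v)"
      using ne unfolding Z_def by (metis nonzero_mult_div_cancel_right)
  qed
  have ne2: "1 + of_real x * cis (2 * v) \<noteq> 0" if "x \<in> {1/2..1}" "v \<in> {-a..a}" for x v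
  proof (cases "x = 1")
    case True
    moreover have "\<bar>v\<bar> < pi/2" using that a unfolding atLeastAtMost_iff by linarith
    ultimately show ?thesis using ne1 by simp
  next
    case False then show ?thesis using that by (intro ne) (auto simp: norm_mult)
  qed
  have cont1: "continuous_on ({1/2..1} \<times> {-a..a}) (\<lambda>(x, v). q x v)"
    by (rule cont_q) (use ne2 in auto)
  then have "continuous_on {1/2..1} (\<lambda>x. integral {-a..a} (q x))"
    using integral_continuous_on_param[of "{1/2..1::real}" "-a" a q] by simp
  then have le': "integral {-a..a} (q 1) \<le> - pi * ln (norm (G (\<i> * b)))"
    using continuous_le_on_closure[of "{1/2..<1::real}" "\<lambda>x. integral {-a..a} (q x)" 1 "- pi * ln (norm (G (\<i> * b)))"] le
    by simp
  have cq1: "continuous_on {-a..a} (q 1)"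
  proof -
    have "continuous_on {-a..a} (\<lambda>v. (\<lambda>(x, v). q x v) (1, v))"
      by (rule continuous_on_compose2[OF cont1]) (auto intro!: continuous_intros)
    then show ?thesis by simp
  qed
  have "((\<lambda>s. (b / (b\<^sup>2 + s\<^sup>2)) *\<^sub>R q 1 (arctan (s / b))) has_integral
          integral {arctan (-T / b)..arctan (T / b)} (q 1)) {-T..T}"
  proof (rule has_integral_substitution[where c = "-a" and d = a])
    show "(\<lambda>s. arctan (s / b)) ` {-T..T} \<subseteq> {-a..a}"
    proof clarify
      fix s assume s: "s \<in> {-T..T}"
      have "arctan (- (T / b)) \<le> arctan (s / b)" "arctan (s / b) \<le> arctan (T / b)"
        using s b unfolding arctan_le_iff by (auto simp: field_simps)
      then show "arctan (s / b) \<in> {-a..a}" by (simp add: a_def arctan_minus)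
    qed
    show "((\<lambda>s. arctan (s / b)) has_field_derivative b / (b\<^sup>2 + s\<^sup>2)) (at s within {-T..T})" for s
      using b by (auto intro!: derivative_eq_intros simp: field_simps power2_eq_square)
  qed (use T b cq1 in \<open>auto simp: arctan_le_iff divide_right_mono\<close>)
  then have "((\<lambda>s. (b / (b\<^sup>2 + s\<^sup>2)) *\<^sub>R q 1 (arctan (s / b))) has_integral integral {-a..a} (q 1)) {-T..T}"
    by (simp add: a_def arctan_minus)
  moreover have "(b / (b\<^sup>2 + s\<^sup>2)) *\<^sub>R q 1 (arctan (s / b)) = - ln (max (norm (G s)) \<epsilon>) * (b / (b\<^sup>2 + s\<^sup>2))" for s
  proof -
    have "\<bar>arctan (s / b)\<bar> < pi/2" using arctan_bounded[of "s / b"] by linarith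
    from tanZ[OF this] b show ?thesis by (simp add: q_def tan_arctan)
  qed
  ultimately show ?thesis using le' by (simp add: has_integral_iff)
qed

text \<open>
  If \<open>G (\<i>b) \<noteq> 0\<close>, the preceding bound does not depend on the cut-off and on the interval. By monotone
  convergence it bounds the integral of \<open>\<theta>\<close> against the Poisson kernel of \<open>\<i>b\<close>, which is comparable to
  \<open>1 / (1 + r\<^sup>2)\<close>.
\<close>

lemma log_integral_divergent_imp_zero:
  fixes G :: "complex \<Rightarrow> complex" and A b :: real and \<theta> :: "real \<Rightarrow> real"
  assumes hol: "G holomorphic_on UNIV" and bounded: "\<And>z. Im z \<ge> 0 \<Longrightarrow> norm (G z) \<le> A"
    and decay: "\<And>s. norm (G (of_real s)) \<le> A * exp (- \<theta> \<bar>s\<bar>)"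
    and \<theta>_nonneg: "\<And>r. r \<ge> 0 \<Longrightarrow> \<theta> r \<ge> 0"
    and \<theta>_int: "\<And>R. R \<ge> 0 \<Longrightarrow> \<theta> absolutely_integrable_on {0..R}"
    and diverge: "(\<integral>\<^sup>+r\<in>{0..}. ennreal (\<theta> r / (1 + r\<^sup>2)) \<partial>lebesgue) = \<infinity>"
    and b: "b > 0"
  shows "G (\<i> * b) = 0"
proof (rule ccontr)
  assume nz: "G (\<i> * b) \<noteq> 0"
  have A: "A > 0" using bounded[of "\<i> * b"] b nz by (auto simp: less_le_trans[of 0 "norm (G (\<i> * b))" A])
  \<comment> \<open>Dividing by \<open>A\<close> makes the logarithm non-positive on the real axis, with \<open>- \<theta>\<close> as an upper bound.\<close>
  define G1 where "G1 z = G z / A" for z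
  define K where "K = - pi * ln (norm (G1 (\<i> * b)))"
  define p where "p s = b / (b\<^sup>2 + s\<^sup>2)" for s :: real
  have p: "p s > 0" for s using b by (simp add: p_def sum_power2_gt_zero_iff)
  have hol1: "G1 holomorphic_on UNIV" unfolding G1_def using A by (intro holomorphic_intros hol) auto
  have le1: "norm (G1 z) \<le> 1" if "Im z \<ge> 0" for z
    using bounded[OF that] A by (simp add: G1_def norm_divide)
  have decay1: "norm (G1 (of_real s)) \<le> exp (- \<theta> \<bar>s\<bar>)" for s
    using decay[of s] A by (simp add: G1_def norm_divide field_simps)
  have nz1: "G1 (\<i> * b) \<noteq> 0" using nz A by (simp add: G1_def)
  have K: "K \<ge> 0"
    using le1[of "\<i> * b"] b nz1 by (auto simp: K_def ln_le_zero_iff mult_nonneg_nonpos)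
  define F where "F m s = ennreal (indicator {0..real m} s * min (\<theta> s) (real m) * p s)" for m s
  have F_le: "(\<integral>\<^sup>+s. F m s \<partial>lebesgue) \<le> ennreal K" for m
  proof -
    \<comment> \<open>The cut-off at \<open>exp (- m)\<close> corresponds to truncating \<open>\<theta>\<close> at height \<open>m\<close>.\<close>
    define \<epsilon> where "\<epsilon> = exp (- real m)"
    have \<epsilon>: "0 < \<epsilon>" "\<epsilon> \<le> 1" by (auto simp: \<epsilon>_def)
    define q where "q s = - ln (max (norm (G1 (of_real s))) \<epsilon>)" for s :: real
    have q_ge: "min (\<theta> s) (real m) \<le> q s" if "s \<ge> 0" for s
    proof -
      have "max (norm (G1 (of_real s))) \<epsilon> \<le> exp (- min (\<theta> s) (real m))"
        using decay1[of s] that by (auto simp: \<epsilon>_def intro: order_trans)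
      then have "ln (max (norm (G1 (of_real s))) \<epsilon>) \<le> - min (\<theta> s) (real m)"
        using \<epsilon> by (metis exp_gt_zero less_max_iff_disj ln_exp ln_mono)
      then show ?thesis by (simp add: q_def)
    qed
    have q_nonneg: "0 \<le> q s" for s
      using le1[of "of_real s"] \<epsilon> by (auto simp: q_def ln_le_zero_iff less_max_iff_disj)
    have cont: "continuous_on {-real m..real m} (\<lambda>s. q s * p s)"
      unfolding q_def p_def using b \<epsilon>
      by (intro continuous_intros continuous_on_compose2[OF holomorphic_on_imp_continuous_on[OF hol1]])
         (auto simp: less_max_iff_disj max_def sum_power2_eq_zero_iff split: if_splits)
    have "(\<integral>\<^sup>+s. F m s \<partial>lebesgue) \<le> (\<integral>\<^sup>+s. indicator {-real m..real m} s * ennreal (q s * p s) \<partial>lebesgue)"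
    proof (rule nn_integral_mono)
      fix s
      show "F m s \<le> indicator {-real m..real m} s * ennreal (q s * p s)"
        using q_ge[of s] p[of s]
        by (auto simp: F_def indicator_def intro!: ennreal_leI mult_right_mono)
    qed
    also have "\<dots> = (\<integral>\<^sup>+s. indicator {-real m..real m} s * ennreal (q s * p s) \<partial>lborel)"
      by (rule nn_integral_completion)
    also have "\<dots> = ennreal (integral {-real m..real m} (\<lambda>s. q s * p s))"
    proof -
      have "((\<lambda>s. q s * p s) has_integral integral {-real m..real m} (\<lambda>s. q s * p s)) {-real m..real m}"
        by (intro integrable_integral integrable_continuous_real cont)
      then have "(\<integral>\<^sup>+s. ennreal (indicator {-real m..real m} s * (q s * p s)) \<partial>lborel)
          = ennreal (integral {-real m..real m} (\<lambda>s. q s * p s))"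
        by (rule nn_integral_has_integral_lebesgue[rotated]) (use q_nonneg p in \<open>simp add: less_imp_le\<close>)
      moreover have "indicator {-real m..real m} s * ennreal (q s * p s)
          = ennreal (indicator {-real m..real m} s * (q s * p s))" for s
        by (simp add: indicator_def)
      ultimately show ?thesis by simp
    qed
    also have "\<dots> \<le> ennreal K"
      using poisson_integral_log_le[OF hol1 le1 b nz1 \<epsilon>, of "real m"]
      by (intro ennreal_leI) (simp add: K_def q_def p_def)
    finally show ?thesis .
  qed
  have meas: "F m \<in> borel_measurable lebesgue" for m
  proof -
    have "set_integrable lebesgue {0..real m} \<theta>" by (rule \<theta>_int) simp
    then have [measurable]: "(\<lambda>s. indicator {0..real m} s *\<^sub>R \<theta> s) \<in> borel_measurable lebesgue"
      unfolding set_integrable_def by (rule borel_measurable_integrable)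
    have [measurable]: "p \<in> borel_measurable lebesgue"
      using b by (intro measurable_completion) (simp add: p_def[abs_def])
    have "F m = (\<lambda>s. ennreal (min (indicator {0..real m} s *\<^sub>R \<theta> s) (real m) * p s))"
      by (auto simp: F_def indicator_def fun_eq_iff)
    also have "\<dots> \<in> borel_measurable lebesgue" by measurable
    finally show ?thesis .
  qed
  have incF: "incseq F"
  proof (intro incseq_SucI le_funI)
    fix m s
    show "F m s \<le> F (Suc m) s"
      using p[of s] \<theta>_nonneg[of s]
      by (auto simp: F_def indicator_def intro!: ennreal_leI mult_right_mono)
  qed
  \<comment> \<open>With this constant \<open>1 / (1 + r\<^sup>2)\<close> is at most \<open>c\<close> times the Poisson kernel \<open>p r\<close>.\<close>
  define c where "c = max b (1 / b)"
  have c: "c > 0" using b by (simp add: c_def)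
  have "(\<integral>\<^sup>+r\<in>{0..}. ennreal (\<theta> r / (1 + r\<^sup>2)) \<partial>lebesgue) \<le> (\<integral>\<^sup>+r. ennreal c * (SUP m. F m r) \<partial>lebesgue)"
  proof (rule nn_integral_mono)
    fix r :: real
    show "ennreal (\<theta> r / (1 + r\<^sup>2)) * indicator {0..} r \<le> ennreal c * (SUP m. F m r)"
    proof (cases "r \<ge> 0")
      case True
      obtain m :: nat where m: "max r (\<theta> r) < real m" using reals_Archimedean2 by blast
      have cb: "1 \<le> c * b" "b\<^sup>2 \<le> c * b"
        using b by (auto simp: c_def max_def field_simps power2_eq_square split: if_splits)
      have "b\<^sup>2 + r\<^sup>2 \<le> c * b + c * b * r\<^sup>2"
        using cb mult_right_mono[OF cb(1), of "r\<^sup>2"] by auto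
      then have "1 / (1 + r\<^sup>2) \<le> c * p r"
        using b by (simp add: p_def field_simps add_pos_nonneg)
      then have "\<theta> r * (1 / (1 + r\<^sup>2)) \<le> \<theta> r * (c * p r)"
        by (rule mult_left_mono) (use \<theta>_nonneg True in auto)
      then have "ennreal (\<theta> r / (1 + r\<^sup>2)) \<le> ennreal c * ennreal (\<theta> r * p r)"
        using c by (subst ennreal_mult'[symmetric]) (auto intro!: ennreal_leI simp: mult_ac)
      also have "ennreal (\<theta> r * p r) = F m r" using m True by (simp add: F_def min_def)
      also have "ennreal c * F m r \<le> ennreal c * (SUP m. F m r)" by (intro mult_left_mono SUP_upper) auto
      finally show ?thesis using True by simp
    qed simp
  qed
  also have "\<dots> = ennreal c * (\<integral>\<^sup>+r. (SUP m. F m r) \<partial>lebesgue)"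
    by (rule nn_integral_cmult) (use meas in measurable)
  also have "(\<integral>\<^sup>+r. (SUP m. F m r) \<partial>lebesgue) = (SUP m. \<integral>\<^sup>+r. F m r \<partial>lebesgue)"
    by (rule nn_integral_monotone_convergence_SUP[OF incF meas])
  also have "\<dots> \<le> ennreal K" by (intro SUP_least F_le)
  finally have "(\<integral>\<^sup>+r\<in>{0..}. ennreal (\<theta> r / (1 + r\<^sup>2)) \<partial>lebesgue) \<le> ennreal c * ennreal K"
    by (simp add: mult_left_mono)
  then show False using diverge by (simp add: top_unique ennreal_mult_eq_top_iff flip: ennreal_mult')
qed

section \<open>Fourier transforms of compactly supported functions\<close>

definition compactly_supported :: "('a::euclidean_space \<Rightarrow> complex) \<Rightarrow> bool" where
  "compactly_supported h \<longleftrightarrow> continuous_on UNIV h \<and> (\<exists>r. \<forall>y. norm y > r \<longrightarrow> h y = 0)"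

lemma compactly_supported_cbox:
  fixes h :: "'a::euclidean_space \<Rightarrow> complex"
  assumes "compactly_supported h"
  obtains c d :: 'a where "box c d \<noteq> {}" "\<And>y. y \<notin> cbox c d \<Longrightarrow> h y = 0"
proof -
  obtain r where r: "\<And>y. norm y > r \<Longrightarrow> h y = 0"
    using assms by (auto simp: compactly_supported_def)
  define R where "R = max r 1"
  have R: "R > 0" "r \<le> R" by (auto simp: R_def)
  define c d :: 'a where "c = - (R *\<^sub>R One)" and "d = R *\<^sub>R One"
  have ci: "c \<bullet> i = - R" "d \<bullet> i = R" if "i \<in> Basis" for i
    using that by (auto simp: c_def d_def)
  have "h y = 0" if "y \<notin> cbox c d" for y
  proof -
    from that obtain i where i: "i \<in> Basis" "\<not> (- R \<le> y \<bullet> i \<and> y \<bullet> i \<le> R)"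
      using ci by (auto simp: mem_box)
    then have "R < \<bar>y \<bullet> i\<bar>" by auto
    also have "\<dots> \<le> norm y" using i by (simp add: Basis_le_norm)
    finally show ?thesis using r R by auto
  qed
  moreover have "box c d \<noteq> {}" using ci R by (auto simp: box_ne_empty)
  ultimately show ?thesis using that by blast
qed

lemma compactly_supported_mult:
  assumes "compactly_supported h" "continuous_on UNIV g"
  shows "compactly_supported (\<lambda>y. h y * g y)"
  using assms by (fastforce simp: compactly_supported_def intro!: continuous_intros)

lemma integrable_compactly_supported:
  assumes "compactly_supported h"
  shows "integrable lborel h"
proof -
  obtain c d where cd: "\<And>y. y \<notin> cbox c d \<Longrightarrow> h y = 0" using compactly_supported_cbox[OF assms] by metis
  have "integrable lborel (\<lambda>y. indicator (cbox c d) y *\<^sub>R h y)"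
    using assms by (intro borel_integrable_compact) (auto simp: compactly_supported_def intro: continuous_on_subset)
  also have "(\<lambda>y. indicator (cbox c d) y *\<^sub>R h y) = h"
    using cd by (auto simp: fun_eq_iff indicator_def)
  finally show ?thesis .
qed

lemma lborel_integral_eq_integral_cbox:
  fixes h :: "'a::euclidean_space \<Rightarrow> complex"
  assumes "continuous_on UNIV h" "\<And>y. y \<notin> cbox c d \<Longrightarrow> h y = 0"
  shows "(LINT y|lborel. h y) = integral (cbox c d) h"
proof -
  have "set_integrable lborel (cbox c d) h"
    unfolding set_integrable_def
    using assms(1) by (intro borel_integrable_compact) (auto intro: continuous_on_subset)
  then have "(LINT y : cbox c d | lborel. h y) = integral (cbox c d) h"
    by (rule set_borel_integral_eq_integral)
  also have "(LINT y : cbox c d | lborel. h y) = (LINT y|lborel. h y)"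
    unfolding set_lebesgue_integral_def
    by (rule Bochner_Integration.integral_cong) (use assms(2) in \<open>auto simp: indicator_def\<close>)
  finally show ?thesis .
qed

text \<open>
  On the real axis this is the Fourier transform of \<open>h\<close> along the line spanned by \<open>w\<close>, on the
  imaginary axis its Laplace transform.
\<close>

lemma holomorphic_fourier_laplace:
  fixes h :: "'a::euclidean_space \<Rightarrow> complex"
  assumes "compactly_supported h"
  shows "(\<lambda>z. LINT y|lborel. h y * exp (- \<i> * z * of_real (y \<bullet> w))) holomorphic_on UNIV"
proof -
  obtain c d where cd: "\<And>y. y \<notin> cbox c d \<Longrightarrow> h y = 0" using compactly_supported_cbox[OF assms] by metis
  have cont: "continuous_on S h" for S
    using assms by (auto simp: compactly_supported_def intro: continuous_on_subset)
  have "(\<lambda>z. integral (cbox c d) (\<lambda>y. h y * exp (- \<i> * z * of_real (y \<bullet> w)))) holomorphic_on UNIV"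
  proof (rule leibniz_rule_holomorphic)
    show "((\<lambda>z. h y * exp (- \<i> * z * of_real (y \<bullet> w))) has_field_derivative
       h y * (exp (- \<i> * z * of_real (y \<bullet> w)) * (- \<i> * of_real (y \<bullet> w)))) (at z within UNIV)" for z y
      by (auto intro!: derivative_eq_intros)
    show "(\<lambda>y. h y * exp (- \<i> * z * of_real (y \<bullet> w))) integrable_on cbox c d" for z
      by (intro integrable_continuous continuous_intros cont)
    show "continuous_on (UNIV \<times> cbox c d)
       (\<lambda>(z, y). h y * (exp (- \<i> * z * of_real (y \<bullet> w)) * (- \<i> * of_real (y \<bullet> w))))"
      unfolding case_prod_beta
      by (intro continuous_intros continuous_on_compose2[OF cont[of UNIV]]) auto
  qed auto
  moreover have "integral (cbox c d) (\<lambda>y. h y * exp (- \<i> * z * of_real (y \<bullet> w))) =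
      (LINT y|lborel. h y * exp (- \<i> * z * of_real (y \<bullet> w)))" for z
    by (rule lborel_integral_eq_integral_cbox[symmetric]) (use cd in \<open>auto intro!: continuous_intros cont\<close>)
  ultimately show ?thesis by simp
qed

lemma exp_imaginary_argument:
  "exp (- \<i> * (\<i> * of_real b) * of_real x) = of_real (exp (b * x))"
proof -
  have "- \<i> * (\<i> * of_real b) * of_real x = complex_of_real (b * x)"
    by (simp add: mult.assoc[symmetric])
  then show ?thesis by (simp only: exp_of_real)
qed

text \<open>
  Multiplication by \<open>e\<^bsup>iRz\<^esup>\<close>, with \<open>R\<close> a bound for \<open>y \<bullet> w\<close> on the support of \<open>h\<close>, compensates
  the exponential growth in the upper half plane and preserves moduli on the real axis. The divergent
  logarithmic integral then gives the zero on the positive imaginary axis.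
\<close>

lemma fourier_decay_imp_laplace_zero:
  fixes h :: "'a::euclidean_space \<Rightarrow> complex" and A b :: real and \<theta> :: "real \<Rightarrow> real"
  assumes h: "compactly_supported h"
    and decay: "\<And>s::real. norm (LINT y|lborel. h y * exp (- \<i> * of_real s * of_real (y \<bullet> w))) \<le> A * exp (- \<theta> \<bar>s\<bar>)"
    and \<theta>: "\<And>r. r \<ge> 0 \<Longrightarrow> \<theta> r \<ge> 0" "\<And>R. R \<ge> 0 \<Longrightarrow> \<theta> absolutely_integrable_on {0..R}"
      "(\<integral>\<^sup>+r\<in>{0..}. ennreal (\<theta> r / (1 + r\<^sup>2)) \<partial>lebesgue) = \<infinity>"
    and b: "b > 0"
  shows "(LINT y|lborel. h y * of_real (exp (b * (y \<bullet> w)))) = 0"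
proof -
  define E where "E z = (LINT y|lborel. h y * exp (- \<i> * z * of_real (y \<bullet> w)))" for z
  obtain c d where cd: "\<And>y. y \<notin> cbox c d \<Longrightarrow> h y = 0" using compactly_supported_cbox[OF h] by metis
  have "compact ((\<lambda>y. y \<bullet> w) ` cbox c d)" by (intro compact_continuous_image continuous_intros) auto
  then obtain R where R: "\<And>y. y \<in> cbox c d \<Longrightarrow> \<bar>y \<bullet> w\<bar> \<le> R"
    by (metis bounded_iff compact_imp_bounded image_eqI real_norm_def)
  define M where "M = (LINT y|lborel. norm (h y))"
  have M: "0 \<le> M" by (simp add: M_def)
  define G where "G z = exp (\<i> * of_real R * z) * E z" for z
  have int: "integrable lborel (\<lambda>y. h y * exp (- \<i> * z * of_real (y \<bullet> w)))" for z
    by (intro integrable_compactly_supported compactly_supported_mult h continuous_intros)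
  have "G (\<i> * b) = 0"
  proof (rule log_integral_divergent_imp_zero[of G "max A M" \<theta>])
    show "G holomorphic_on UNIV"
      unfolding G_def E_def by (intro holomorphic_intros holomorphic_fourier_laplace h)
    show "norm (G z) \<le> max A M" if z: "Im z \<ge> 0" for z
    proof -
      have "norm (h y * exp (- \<i> * z * of_real (y \<bullet> w))) \<le> exp (R * Im z) * norm (h y)" for y
      proof (cases "y \<in> cbox c d")
        case True
        have "Im z * (y \<bullet> w) \<le> R * Im z"
          using mult_right_mono[OF order_trans[OF abs_ge_self R[OF True]] z] by (simp add: mult.commute)
        then show ?thesis by (simp add: norm_mult mult.commute mult_left_mono)
      qed (use cd in simp)
      then have "norm (E z) \<le> (LINT y|lborel. exp (R * Im z) * norm (h y))"
        unfolding E_def using integrable_compactly_supported[OF h]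
        by (intro Bochner_Integration.integral_norm_bound_integral int) auto
      then have "norm (E z) \<le> exp (R * Im z) * M" by (simp add: M_def)
      then have "exp (- (R * Im z)) * norm (E z) \<le> exp (- (R * Im z)) * (exp (R * Im z) * M)"
        by (rule mult_left_mono) simp
      then have "norm (G z) \<le> M"
        by (simp add: G_def norm_mult flip: mult.assoc exp_add)
      then show ?thesis by simp
    qed
    show "norm (G (of_real s)) \<le> max A M * exp (- \<theta> \<bar>s\<bar>)" for s
    proof -
      have "norm (G (of_real s)) = norm (E (of_real s))" by (simp add: G_def norm_mult)
      also have "\<dots> \<le> A * exp (- \<theta> \<bar>s\<bar>)" unfolding E_def by (rule decay)
      also have "\<dots> \<le> max A M * exp (- \<theta> \<bar>s\<bar>)" by (intro mult_right_mono) auto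
      finally show ?thesis .
    qed
  qed (use \<theta> b in auto)
  then have "E (\<i> * b) = 0" by (simp add: G_def)
  then show ?thesis by (simp only: E_def exp_imaginary_argument)
qed

inductive_set exponential_sums :: "('a::real_inner \<Rightarrow> real) set" where
  exponential: "(\<lambda>y. c * exp (y \<bullet> w)) \<in> exponential_sums"
| add: "\<lbrakk>f \<in> exponential_sums; g \<in> exponential_sums\<rbrakk> \<Longrightarrow> (\<lambda>y. f y + g y) \<in> exponential_sums"

lemma exponential_sums_mult:
  assumes "f \<in> exponential_sums" "g \<in> exponential_sums"
  shows "(\<lambda>y. f y * g y) \<in> exponential_sums"
  using assms(1)
proof induction
  case (exponential c w)
  show ?case using assms(2)
  proof induction
    case (exponential c' w')
    have "(\<lambda>y. c * exp (y \<bullet> w) * (c' * exp (y \<bullet> w'))) = (\<lambda>y. (c * c') * exp (y \<bullet> (w + w')))"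
      by (simp add: inner_add_right exp_add mult_ac)
    then show ?case using exponential_sums.exponential[of "c * c'" "w + w'"] by simp
  next
    case (add f g)
    then show ?case using exponential_sums.add by (simp add: distrib_left)
  qed
next
  case (add f g)
  then show ?case using exponential_sums.add by (simp add: distrib_right)
qed

lemma exponential_sums_continuous: "f \<in> exponential_sums \<Longrightarrow> continuous_on S f"
  by (induction rule: exponential_sums.induct) (auto intro!: continuous_intros)

text \<open>
  Exponentials are closed under products and separate points, so the Stone--Weierstrass theorem applies.
\<close>

lemma exponential_sums_dense:
  fixes \<phi> :: "'a::euclidean_space \<Rightarrow> real"
  assumes "compact S" "continuous_on S \<phi>" "e > 0"
  obtains f where "f \<in> exponential_sums" "\<And>y. y \<in> S \<Longrightarrow> \<bar>\<phi> y - f y\<bar> < e"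
proof -
  interpret function_ring_on exponential_sums S
  proof
    show "(\<lambda>_. c) \<in> exponential_sums" for c
      using exponential_sums.exponential[of c 0] by simp
    show "\<exists>f\<in>exponential_sums. f x \<noteq> f y" if "x \<noteq> y" for x y :: 'a
    proof
      have "(x - y) \<bullet> (x - y) > 0" using that by simp
      then show "1 * exp (x \<bullet> (x - y)) \<noteq> 1 * exp (y \<bullet> (x - y))" by (simp add: inner_diff_left)
    qed (rule exponential_sums.exponential)
  qed (use assms exponential_sums_mult exponential_sums_continuous exponential_sums.add in auto)
  show ?thesis using Stone_Weierstrass_basic[OF assms(2,3)] that by blast
qed

text \<open>
  The zero Laplace transform says that \<open>h\<close> integrates to zero against exponential sums, by density against
  all continuous functions, and in particular against its own complex conjugate.
\<close>

lemma laplace_zero_imp_zero: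
  fixes h :: "'a::euclidean_space \<Rightarrow> complex"
  assumes h: "compactly_supported h"
    and zero: "\<And>w. (LINT y|lborel. h y * of_real (exp (y \<bullet> w))) = 0"
  shows "h y = 0"
proof -
  obtain c d where ne: "box c d \<noteq> {}" and cd: "\<And>y. y \<notin> cbox c d \<Longrightarrow> h y = 0"
    using compactly_supported_cbox[OF h] by metis
  have cont: "continuous_on S h" for S
    using h by (auto simp: compactly_supported_def intro: continuous_on_subset)
  have int: "integrable lborel (\<lambda>y. h y * of_real (g y))" if "continuous_on UNIV g" for g
    by (intro integrable_compactly_supported compactly_supported_mult h continuous_intros that)
  have zero': "(LINT y|lborel. h y * of_real (g y)) = 0" if "g \<in> exponential_sums" for g
    using that
  proof induction
    case (exponential c w)
    have "(LINT y|lborel. h y * of_real (c * exp (y \<bullet> w))) = (LINT y|lborel. of_real c * (h y * of_real (exp (y \<bullet> w))))"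
      by (simp add: mult_ac)
    also have "\<dots> = 0" by (subst integral_mult_right_zero) (simp add: zero)
    finally show ?case .
  next
    case (add f g)
    then show ?case
      using int[OF exponential_sums_continuous] by (simp add: distrib_left)
  qed
  have zero'': "(LINT y|lborel. h y * of_real (\<phi> y)) = 0" if \<phi>: "continuous_on UNIV \<phi>" for \<phi>
  proof -
    define M where "M = (LINT y|lborel. norm (h y))"
    have "norm (LINT y|lborel. h y * of_real (\<phi> y)) \<le> e * M" if "e > 0" for e
    proof -
      obtain g where g: "g \<in> exponential_sums" "\<And>y. y \<in> cbox c d \<Longrightarrow> \<bar>\<phi> y - g y\<bar> < e"
        using exponential_sums_dense[OF compact_cbox continuous_on_subset[OF \<phi>] \<open>e > 0\<close>] by blast
      note cg = exponential_sums_continuous[OF g(1)]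
      have "(LINT y|lborel. h y * of_real (\<phi> y)) = (LINT y|lborel. h y * of_real (\<phi> y - g y))"
        using zero'[OF g(1)] int[OF \<phi>] int[OF cg] by (simp add: right_diff_distrib)
      also have "norm \<dots> \<le> (LINT y|lborel. e * norm (h y))"
      proof (rule Bochner_Integration.integral_norm_bound_integral)
        show "integrable lborel (\<lambda>y. h y * of_real (\<phi> y - g y))"
          by (intro int continuous_intros \<phi> cg)
        show "integrable lborel (\<lambda>y. e * norm (h y))" using integrable_compactly_supported[OF h] by auto
        show "norm (h y * of_real (\<phi> y - g y)) \<le> e * norm (h y)" for y
        proof (cases "y \<in> cbox c d")
          case True
          have "norm (h y) * \<bar>\<phi> y - g y\<bar> \<le> norm (h y) * e"
            using g(2)[OF True] by (intro mult_left_mono) auto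
          then show ?thesis by (simp add: norm_mult mult.commute flip: of_real_diff)
        qed (use cd in simp)
      qed
      finally show ?thesis by (simp add: M_def)
    qed
    note bound = this
    have "((\<lambda>e. e * M) \<longlongrightarrow> 0 * M) (at_right 0)" by (intro tendsto_intros)
    moreover have "eventually (\<lambda>e. norm (LINT y|lborel. h y * of_real (\<phi> y)) \<le> e * M) (at_right 0)"
      using bound by (auto simp: eventually_at_filter)
    ultimately have "norm (LINT y|lborel. h y * of_real (\<phi> y)) \<le> 0 * M"
      by (rule tendsto_lowerbound) simp
    then show ?thesis by simp
  qed
  have contn: "continuous_on S (\<lambda>y. (norm (h y))\<^sup>2)" for S by (intro continuous_intros cont)
  have "(LINT y|lborel. complex_of_real ((norm (h y))\<^sup>2)) =
      (LINT y|lborel. h y * of_real (Re (h y)) - \<i> * (h y * of_real (Im (h y))))"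
    by (rule Bochner_Integration.integral_cong) (auto simp: complex_eq_iff cmod_power2, auto simp: power2_eq_square)
  also have "\<dots> = 0"
    using zero''[of "\<lambda>y. Re (h y)"] zero''[of "\<lambda>y. Im (h y)"] int[of "\<lambda>y. Re (h y)"] int[of "\<lambda>y. Im (h y)"]
    by (simp add: continuous_intros cont)
  also have "(LINT y|lborel. complex_of_real ((norm (h y))\<^sup>2)) = integral (cbox c d) (\<lambda>y. complex_of_real ((norm (h y))\<^sup>2))"
    by (rule lborel_integral_eq_integral_cbox) (use cd in \<open>auto intro!: continuous_intros cont\<close>)
  finally have zero_int: "((\<lambda>y. complex_of_real ((norm (h y))\<^sup>2)) has_integral 0) (cbox c d)"
    by (metis (no_types) integrable_integral integrable_continuous continuous_on_of_real contn)
  have "((\<lambda>y. (norm (h y))\<^sup>2) has_integral 0) (cbox c d)"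
    using has_integral_linear[OF zero_int bounded_linear_Re] by (simp add: o_def del: of_real_power)
  then show ?thesis
    using has_integral_0_cbox_imp_0[OF contn _ _ ne, of y] cd[of y] by (cases "y \<in> cbox c d") auto
qed

text \<open>
  Every \<open>w \<noteq> 0\<close> is a positive multiple of a vector of length \<open>\<rho>\<close>, the scale on which the decay along its
  line is exactly \<open>e\<^bsup>-\<theta>(|s|)\<^esup>\<close>. The value of the Laplace transform at the origin follows by
  continuity.
\<close>

lemma fourier_decay_imp_zero:
  fixes h :: "'a::euclidean_space \<Rightarrow> complex" and A \<rho> :: real and \<theta> :: "real \<Rightarrow> real"
  assumes h: "compactly_supported h" and \<rho>: "\<rho> > 0"
    and decay: "\<And>\<xi>. norm (LINT y|lborel. h y * exp (- \<i> * of_real (y \<bullet> \<xi>))) \<le> A * exp (- \<theta> (norm \<xi> / \<rho>))"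
    and \<theta>: "\<And>r. r \<ge> 0 \<Longrightarrow> \<theta> r \<ge> 0" "\<And>R. R \<ge> 0 \<Longrightarrow> \<theta> absolutely_integrable_on {0..R}"
      "(\<integral>\<^sup>+r\<in>{0..}. ennreal (\<theta> r / (1 + r\<^sup>2)) \<partial>lebesgue) = \<infinity>"
  shows "h y = 0"
proof (rule laplace_zero_imp_zero[OF h])
  have nonzero: "(LINT y|lborel. h y * of_real (exp (y \<bullet> w))) = 0" if w: "w \<noteq> 0" for w
  proof -
    define v where "v = (\<rho> / norm w) *\<^sub>R w"
    have nv: "norm v = \<rho>" using w \<rho> by (simp add: v_def)
    have "(LINT y|lborel. h y * of_real (exp ((norm w / \<rho>) * (y \<bullet> v)))) = 0"
    proof (rule fourier_decay_imp_laplace_zero[OF h _ \<theta>])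
      show "norm (LINT y|lborel. h y * exp (- \<i> * of_real s * of_real (y \<bullet> v))) \<le> A * exp (- \<theta> \<bar>s\<bar>)" for s
        using decay[of "s *\<^sub>R v"] \<rho> nv by (simp add: mult.assoc)
      show "norm w / \<rho> > 0" using w \<rho> by simp
    qed auto
    then show ?thesis using w \<rho> by (simp add: v_def)
  qed
  fix w
  show "(LINT y|lborel. h y * of_real (exp (y \<bullet> w))) = 0"
  proof (cases "w = 0")
    case True
    \<comment> \<open>The origin is reached along the ray through any fixed non-zero vector.\<close>
    obtain v :: 'a where v: "v \<in> Basis" using SOME_Basis by blast
    define E where "E z = (LINT y|lborel. h y * exp (- \<i> * z * of_real (y \<bullet> v)))" for z
    have "E holomorphic_on UNIV" unfolding E_def by (rule holomorphic_fourier_laplace[OF h])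
    then have "isCont E 0"
      using holomorphic_on_imp_continuous_on continuous_on_eq_continuous_at by blast
    moreover have "((\<lambda>b. \<i> * complex_of_real b) \<longlongrightarrow> \<i> * of_real 0) (at_right 0)" by (intro tendsto_intros)
    ultimately have "((\<lambda>b. E (\<i> * of_real b)) \<longlongrightarrow> E 0) (at_right 0)"
      using isCont_tendsto_compose[of 0 E] by simp
    moreover have "E (\<i> * of_real b) = 0" if "b > 0" for b
    proof -
      have "b *\<^sub>R v \<noteq> 0" using v that nonzero_Basis by auto
      from nonzero[OF this] show ?thesis by (simp only: E_def exp_imaginary_argument inner_scaleR_right)
    qed
    then have "eventually (\<lambda>b. E (\<i> * of_real b) = 0) (at_right 0)" by (auto simp: eventually_at_filter)
    then have "((\<lambda>b. E (\<i> * of_real b)) \<longlongrightarrow> 0) (at_right 0)" by (simp add: tendsto_eventually)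
    ultimately have "E 0 = 0" using tendsto_unique[of "at_right (0::real)"] by fastforce
    then show ?thesis using True by (simp add: E_def)
  qed (use nonzero in simp)
qed

section \<open>The free Schroedinger evolution\<close>

lemma gaussian_fourier_real:
  fixes a z :: real
  assumes a: "a > 0"
  shows "integrable lborel (\<lambda>s. complex_of_real (exp (- (a * s\<^sup>2))) * exp (\<i> * of_real (s * z)))"
    and "(LINT s|lborel. complex_of_real (exp (- (a * s\<^sup>2))) * exp (\<i> * of_real (s * z)))
           = of_real (sqrt (pi / a) * exp (- (z\<^sup>2 / (4 * a))))"
proof -
  \<comment> \<open>The substitution \<open>x = c s\<close> turns the standard normal density into \<open>exp (- a s\<^sup>2)\<close>.\<close>
  define c where "c = sqrt (2 * a)"
  have c: "c > 0" "c\<^sup>2 = 2 * a" using a by (auto simp: c_def)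
  let ?g = "\<lambda>x. std_normal_density x *\<^sub>R exp (\<i> * of_real (z / c * x))"
  have eq: "?g (0 + c * s) = of_real (1 / sqrt (2 * pi)) * (complex_of_real (exp (- (a * s\<^sup>2))) * exp (\<i> * of_real (s * z)))" for s
  proof -
    have "- (c * s)\<^sup>2 / 2 = - (a * s\<^sup>2)" "z / c * (c * s) = s * z" using c by (auto simp: power_mult_distrib)
    then show ?thesis by (simp only: std_normal_density_def add_0_left scaleR_conv_of_real of_real_mult mult.assoc)
  qed
  have intg: "integrable lborel ?g"
  proof (rule Bochner_Integration.integrable_bound)
    show "integrable lborel std_normal_density"
      using prob_space_normal_density[of 1 0] by simp
  qed (auto intro!: AE_I2)
  have "integrable lborel (\<lambda>s. ?g (0 + c * s))"
    by (rule lborel_integrable_real_affine[OF intg]) (use c in auto)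
  then have "integrable lborel (\<lambda>s. of_real (1 / sqrt (2 * pi)) * (complex_of_real (exp (- (a * s\<^sup>2))) * exp (\<i> * of_real (s * z))))"
    unfolding eq .
  then have "integrable lborel (\<lambda>s. of_real (sqrt (2 * pi)) * (of_real (1 / sqrt (2 * pi)) * (complex_of_real (exp (- (a * s\<^sup>2))) * exp (\<i> * of_real (s * z)))))"
    by (rule integrable_mult_right)
  moreover have *: "of_real (sqrt (2 * pi)) * (of_real (1 / sqrt (2 * pi)) * w) = w" for w :: complex
    by (simp flip: mult.assoc of_real_mult)
  ultimately show "integrable lborel (\<lambda>s. complex_of_real (exp (- (a * s\<^sup>2))) * exp (\<i> * of_real (s * z)))"
    by simp
  have "char std_normal_distribution (z / c) = (LINT x|lborel. ?g x)"
    unfolding char_def by (subst integral_density) auto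
  also have "\<dots> = \<bar>c\<bar> *\<^sub>R (LINT s|lborel. ?g (0 + c * s))"
    by (rule lborel_integral_real_affine) (use c in auto)
  also have "\<dots> = of_real (c / sqrt (2 * pi)) * (LINT s|lborel. complex_of_real (exp (- (a * s\<^sup>2))) * exp (\<i> * of_real (s * z)))"
    unfolding eq using c by (simp add: scaleR_conv_of_real)
  finally have "(LINT s|lborel. complex_of_real (exp (- (a * s\<^sup>2))) * exp (\<i> * of_real (s * z)))
     = of_real (sqrt (2 * pi) / c) * char std_normal_distribution (z / c)"
    using c by (simp add: field_simps)
  also have "char std_normal_distribution (z / c) = of_real (exp (- (z\<^sup>2 / (4 * a))))"
    using c by (simp add: char_std_normal_distribution power_divide)
  also have "sqrt (2 * pi) / c = sqrt (pi / a)" using a by (simp add: c_def real_sqrt_divide real_sqrt_mult)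
  finally show "(LINT s|lborel. complex_of_real (exp (- (a * s\<^sup>2))) * exp (\<i> * of_real (s * z)))
           = of_real (sqrt (pi / a) * exp (- (z\<^sup>2 / (4 * a))))" by simp
qed

lemma lborel_integral_prod_Basis:
  fixes g :: "'a::euclidean_space \<Rightarrow> real \<Rightarrow> complex"
  assumes int: "\<And>b. b \<in> Basis \<Longrightarrow> integrable lborel (g b)"
  shows "integrable lborel (\<lambda>x::'a. \<Prod>b\<in>Basis. g b (x \<bullet> b))"
    and "(LINT x|(lborel::'a measure). (\<Prod>b\<in>Basis. g b (x \<bullet> b))) = (\<Prod>b\<in>Basis. LINT s|lborel. g b s)"
proof -
  interpret product_sigma_finite "\<lambda>_::'a. lborel :: real measure" ..
  have meas: "(\<lambda>f. \<Sum>b\<in>Basis. f b *\<^sub>R b) \<in> measurable (\<Pi>\<^sub>M b\<in>Basis. lborel) (borel :: 'a measure)"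
    by measurable
  have [measurable]: "g b \<in> borel_measurable borel" if "b \<in> Basis" for b
    using borel_measurable_integrable[OF int[OF that]] by simp
  have measg: "(\<lambda>x::'a. \<Prod>b\<in>Basis. g b (x \<bullet> b)) \<in> borel_measurable borel"
  proof (rule borel_measurable_prod)
    fix b :: 'a assume b: "b \<in> Basis"
    have "(\<lambda>x::'a. x \<bullet> b) \<in> borel_measurable borel" by measurable
    then show "(\<lambda>x. g b (x \<bullet> b)) \<in> borel_measurable borel"
      by (rule measurable_compose) (use b in measurable)
  qed
  have eq: "(\<Prod>b\<in>Basis. g b ((\<Sum>b'\<in>Basis. f b' *\<^sub>R b') \<bullet> b)) = (\<Prod>b\<in>Basis. g b (f b))" for f :: "'a \<Rightarrow> real"
    by (intro prod.cong refl) simp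
  show "integrable lborel (\<lambda>x::'a. \<Prod>b\<in>Basis. g b (x \<bullet> b))"
    by (subst lborel_eq, subst integrable_distr_eq[OF meas measg], unfold eq)
       (intro product_integrable_prod int finite_Basis)
  show "(LINT x|(lborel::'a measure). (\<Prod>b\<in>Basis. g b (x \<bullet> b))) = (\<Prod>b\<in>Basis. LINT s|lborel. g b s)"
    by (subst lborel_eq, subst integral_distr[OF meas measg], unfold eq)
       (intro product_integral_prod int finite_Basis)
qed

lemma gaussian_fourier:
  fixes z :: "'a::euclidean_space" and a :: real
  assumes a: "a > 0"
  shows "integrable lborel (\<lambda>x::'a. complex_of_real (exp (- (a * (norm x)\<^sup>2))) * exp (\<i> * of_real (x \<bullet> z)))"
    and "(LINT x|(lborel::'a measure). complex_of_real (exp (- (a * (norm x)\<^sup>2))) * exp (\<i> * of_real (x \<bullet> z)))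
           = of_real (sqrt (pi / a) ^ DIM('a) * exp (- ((norm z)\<^sup>2 / (4 * a))))"
proof -
  define g where "g b s = complex_of_real (exp (- (a * s\<^sup>2))) * exp (\<i> * of_real (s * (z \<bullet> b)))" for b :: 'a and s
  have nrm: "(norm y)\<^sup>2 = (\<Sum>b\<in>Basis. (y \<bullet> b)\<^sup>2)" for y :: 'a
    unfolding power2_norm_eq_inner by (subst euclidean_inner) (simp add: power2_eq_square)
  have eq: "complex_of_real (exp (- (a * (norm x)\<^sup>2))) * exp (\<i> * of_real (x \<bullet> z)) = (\<Prod>b\<in>Basis. g b (x \<bullet> b))" for x
    by (simp add: g_def nrm euclidean_inner[of x z] prod.distrib exp_sum sum_distrib_left flip: sum_negf)
  have int: "integrable lborel (g b)" for b
    unfolding g_def by (rule gaussian_fourier_real[OF a])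
  show "integrable lborel (\<lambda>x::'a. complex_of_real (exp (- (a * (norm x)\<^sup>2))) * exp (\<i> * of_real (x \<bullet> z)))"
    unfolding eq by (rule lborel_integral_prod_Basis[OF int])
  have "(LINT x|(lborel::'a measure). (\<Prod>b\<in>Basis. g b (x \<bullet> b))) = (\<Prod>b\<in>Basis. LINT s|lborel. g b s)"
    by (rule lborel_integral_prod_Basis[OF int])
  also have "\<dots> = (\<Prod>b\<in>Basis. of_real (sqrt (pi / a) * exp (- ((z \<bullet> b)\<^sup>2 / (4 * a)))))"
    unfolding g_def by (simp only: gaussian_fourier_real[OF a])
  also have "\<dots> = of_real (sqrt (pi / a) ^ DIM('a) * exp (- ((norm z)\<^sup>2 / (4 * a))))"
    by (simp add: prod.distrib nrm sum_divide_distrib exp_sum flip: sum_negf)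
  finally show "(LINT x|(lborel::'a measure). complex_of_real (exp (- (a * (norm x)\<^sup>2))) * exp (\<i> * of_real (x \<bullet> z)))
           = of_real (sqrt (pi / a) ^ DIM('a) * exp (- ((norm z)\<^sup>2 / (4 * a))))"
    unfolding eq .
qed

lemma continuous_fourier:
  fixes h :: "'a::euclidean_space \<Rightarrow> complex"
  assumes h: "compactly_supported h"
  shows "continuous_on S (fourier h)"
proof -
  obtain c d where cd: "\<And>y. y \<notin> cbox c d \<Longrightarrow> h y = 0" using compactly_supported_cbox[OF h] by metis
  have cont: "continuous_on S h" for S
    using h by (auto simp: compactly_supported_def intro: continuous_on_subset)
  have "fourier h \<xi> = integral (cbox c d) (\<lambda>x. h x * exp (- \<i> * of_real (x \<bullet> \<xi>)))" for \<xi>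
    unfolding fourier_def
    by (rule lborel_integral_eq_integral_cbox) (use cd in \<open>auto intro!: continuous_intros cont\<close>)
  moreover have "continuous_on UNIV (\<lambda>\<xi>. integral (cbox c d) (\<lambda>x. h x * exp (- \<i> * of_real (x \<bullet> \<xi>))))"
    by (rule integral_continuous_on_param)
       (auto simp: case_prod_beta intro!: continuous_intros continuous_on_compose2[OF cont[of UNIV]])
  ultimately show ?thesis by (metis (no_types, lifting) continuous_on_cong continuous_on_subset subset_UNIV)
qed

text \<open>
  For a positive real parameter the factor \<open>exp (- a |\<xi>|\<^sup>2)\<close> makes everything absolutely integrable, and
  the formula is Fubini's theorem together with the Fourier transform of a Gaussian.
\<close>

lemma gaussian_regularized_evolution_real:
  fixes h :: "'a::euclidean_space \<Rightarrow> complex" and a :: real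
  assumes h: "compactly_supported h" and a: "a > 0"
  shows "(LINT \<xi>|lborel. exp (- (of_real a * of_real ((norm \<xi>)\<^sup>2))) * fourier h \<xi> * exp (\<i> * of_real (\<xi> \<bullet> x)))
    = of_real (sqrt (pi / a)) ^ DIM('a) * (LINT y|lborel. h y * exp (- (of_real ((norm (x - y))\<^sup>2) / (4 * of_real a))))"
proof -
  define \<gamma> where "\<gamma> \<xi> = complex_of_real (exp (- (a * (norm \<xi>)\<^sup>2)))" for \<xi> :: 'a
  have \<gamma>: "\<gamma> \<xi> = exp (- (of_real a * of_real ((norm \<xi>)\<^sup>2)))" for \<xi>
    by (simp add: \<gamma>_def exp_of_real[symmetric])
  define k where "k \<xi> y = \<gamma> \<xi> * h y * exp (\<i> * of_real (\<xi> \<bullet> (x - y)))" for \<xi> y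
  have cont: "continuous_on UNIV h" using h by (simp add: compactly_supported_def)
  have [measurable]: "h \<in> borel_measurable borel" using cont by (rule borel_measurable_continuous_onI)
  have \<gamma>int: "integrable lborel \<gamma>" using gaussian_fourier(1)[OF a, of 0] by (simp add: \<gamma>_def[abs_def])
  have hint: "integrable lborel h" by (rule integrable_compactly_supported[OF h])
  have nk: "norm (k \<xi> y) = norm (\<gamma> \<xi>) * norm (h y)" for \<xi> y by (simp add: k_def norm_mult)
  have kint: "integrable (lborel \<Otimes>\<^sub>M lborel) (case_prod k)"
  proof (rule lborel_pair.Fubini_integrable)
    have "continuous_on UNIV (case_prod k)"
      unfolding k_def \<gamma> case_prod_beta
      by (intro continuous_intros continuous_on_compose2[OF cont]) auto
    then show "case_prod k \<in> borel_measurable (lborel \<Otimes>\<^sub>M lborel)"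
      by (simp add: borel_measurable_continuous_onI lborel_prod)
    show "integrable lborel (\<lambda>\<xi>. LINT y|lborel. norm (case (\<xi>, y) of (\<xi>, y) \<Rightarrow> k \<xi> y))"
      using \<gamma>int by (simp add: nk)
    show "AE \<xi> in lborel. integrable lborel (\<lambda>y. case (\<xi>, y) of (\<xi>, y) \<Rightarrow> k \<xi> y)"
    proof (intro AE_I2)
      fix \<xi>
      have "compactly_supported (\<lambda>y. h y * (\<gamma> \<xi> * exp (\<i> * of_real (\<xi> \<bullet> (x - y)))))"
        by (intro compactly_supported_mult h continuous_intros)
      then show "integrable lborel (\<lambda>y. case (\<xi>, y) of (\<xi>, y) \<Rightarrow> k \<xi> y)"
        using integrable_compactly_supported by (simp add: k_def mult_ac)
    qed
  qed
  have inner1: "(LINT y|lborel. k \<xi> y) = exp (- (of_real a * of_real ((norm \<xi>)\<^sup>2))) * fourier h \<xi> * exp (\<i> * of_real (\<xi> \<bullet> x))" for \<xi>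
  proof -
    have "k \<xi> y = (\<gamma> \<xi> * exp (\<i> * of_real (\<xi> \<bullet> x))) * (h y * exp (- \<i> * of_real (y \<bullet> \<xi>)))" for y
      by (simp add: k_def inner_diff_right right_diff_distrib exp_diff exp_minus field_simps inner_commute)
    then have "(LINT y|lborel. k \<xi> y) = (\<gamma> \<xi> * exp (\<i> * of_real (\<xi> \<bullet> x))) * fourier h \<xi>"
      unfolding fourier_def by (simp only: integral_mult_right_zero)
    then show ?thesis by (simp add: \<gamma>)
  qed
  have inner2: "(LINT \<xi>|lborel. k \<xi> y) = of_real (sqrt (pi / a)) ^ DIM('a) * (h y * exp (- (of_real ((norm (x - y))\<^sup>2) / (4 * of_real a))))" for y
  proof -
    have "(LINT \<xi>|lborel. k \<xi> y) = (LINT \<xi>|lborel. h y * (complex_of_real (exp (- (a * (norm \<xi>)\<^sup>2))) * exp (\<i> * of_real (\<xi> \<bullet> (x - y)))))"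
      by (simp add: k_def \<gamma>_def mult_ac)
    also have "\<dots> = h y * of_real (sqrt (pi / a) ^ DIM('a) * exp (- ((norm (x - y))\<^sup>2 / (4 * a))))"
      by (simp only: integral_mult_right_zero gaussian_fourier(2)[OF a])
    finally show ?thesis by (simp add: exp_of_real[symmetric] mult_ac)
  qed
  have "(LINT \<xi>|lborel. LINT y|lborel. k \<xi> y) = (LINT y|lborel. LINT \<xi>|lborel. k \<xi> y)"
    using lborel_pair.Fubini_integral[OF kint] by simp
  then show ?thesis unfolding inner1 inner2 by (simp only: integral_mult_right_zero)
qed


text \<open>
  Integrals over growing cubes are holomorphic, and they converge uniformly because the error is at most
  the integral of \<open>|g|\<close> outside the cube, whatever the parameter in the right half plane.
\<close>

lemma holomorphic_gaussian_regularization: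
  fixes g :: "'a::euclidean_space \<Rightarrow> complex"
  assumes cont: "continuous_on UNIV g" and int: "integrable lborel g"
  shows "(\<lambda>a. LINT \<xi>|lborel. exp (- (a * of_real ((norm \<xi>)\<^sup>2))) * g \<xi>) holomorphic_on {a. Re a > 0}"
proof -
  define f where "f a \<xi> = exp (- (a * of_real ((norm \<xi>)\<^sup>2))) * g \<xi>" for a \<xi>
  define Q where "Q n = cbox (- (real n *\<^sub>R One)) (real n *\<^sub>R One :: 'a)" for n
  have cont': "continuous_on S g" for S by (rule continuous_on_subset[OF cont]) auto
  have contf: "continuous_on S (f a)" for S a
    unfolding f_def by (intro continuous_intros cont')
  have f_le: "norm (f a \<xi>) \<le> norm (g \<xi>)" if "Re a \<ge> 0" for a \<xi>
    using that by (simp add: f_def norm_mult mult_left_le_one_le)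
  have fint: "integrable lborel (f a)" if "Re a \<ge> 0" for a
    by (rule Bochner_Integration.integrable_bound[OF int])
       (use f_le[OF that] contf in \<open>auto intro!: borel_measurable_continuous_onI\<close>)
  define \<delta> where "\<delta> n = (LINT \<xi>|lborel. indicator (- Q n) \<xi> * norm (g \<xi>))" for n
  have [measurable]: "g \<in> borel_measurable borel" using cont by (rule borel_measurable_continuous_onI)
  have [measurable]: "Q n \<in> sets borel" for n by (simp add: Q_def)
  have \<delta>int: "integrable lborel (\<lambda>\<xi>. indicator (- Q n) \<xi> * norm (g \<xi>))" for n
    by (rule Bochner_Integration.integrable_bound[OF int]) (auto simp: indicator_def)
  have "\<delta> \<longlonglongrightarrow> (LINT \<xi>|(lborel::'a measure). 0)"
    unfolding \<delta>_def
  proof (rule integral_dominated_convergence[where w = "\<lambda>\<xi>. norm (g \<xi>)"])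
    show "AE \<xi> in lborel. (\<lambda>n. indicator (- Q n) \<xi> * norm (g \<xi>)) \<longlonglongrightarrow> 0"
    proof (intro AE_I2 tendsto_eventually)
      fix \<xi> :: 'a
      obtain N :: nat where N: "norm \<xi> \<le> N" using real_arch_simple by blast
      have "\<xi> \<in> Q n" if "n \<ge> N" for n
      proof -
        have "\<bar>\<xi> \<bullet> i\<bar> \<le> real n" if "i \<in> Basis" for i
          using Basis_le_norm[OF that, of \<xi>] N \<open>n \<ge> N\<close> by simp
        then have "- real n \<le> \<xi> \<bullet> i \<and> \<xi> \<bullet> i \<le> real n" if "i \<in> Basis" for i
          using that by (fastforce simp: abs_le_iff)
        then show ?thesis by (auto simp: Q_def mem_box)
      qed
      then show "eventually (\<lambda>n. indicator (- Q n) \<xi> * norm (g \<xi>) = 0) sequentially"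
        by (auto simp: eventually_sequentially intro!: exI[of _ N])
    qed
  qed (use int in \<open>auto simp: indicator_def\<close>)
  then have \<delta>_lim: "\<delta> \<longlonglongrightarrow> 0" by simp
  have near: "norm (integral (Q n) (f a) - (LINT \<xi>|lborel. f a \<xi>)) \<le> \<delta> n" if "Re a \<ge> 0" for a n
  proof -
    have ind: "integrable lborel (\<lambda>\<xi>. indicator (Q n) \<xi> *\<^sub>R f a \<xi>)"
      unfolding Q_def by (intro borel_integrable_compact contf) auto
    then have "set_integrable lborel (Q n) (f a)" by (simp add: set_integrable_def)
    then have "(LINT \<xi> : Q n | lborel. f a \<xi>) = integral (Q n) (f a)"
      by (rule set_borel_integral_eq_integral)
    then have "integral (Q n) (f a) - (LINT \<xi>|lborel. f a \<xi>) = (LINT \<xi>|lborel. indicator (Q n) \<xi> *\<^sub>R f a \<xi> - f a \<xi>)"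
      using ind fint[OF that] by (simp add: set_lebesgue_integral_def)
    also have "norm \<dots> \<le> (LINT \<xi>|lborel. indicator (- Q n) \<xi> * norm (g \<xi>))"
      by (rule Bochner_Integration.integral_norm_bound_integral)
         (use ind fint[OF that] \<delta>int f_le[OF that] in \<open>auto simp: indicator_def\<close>)
    finally show ?thesis by (simp add: \<delta>_def)
  qed
  have "(\<lambda>a. LINT \<xi>|lborel. f a \<xi>) holomorphic_on {a. Re a > 0}"
  proof (rule holomorphic_uniform_sequence)
    show op: "open {a. Re a > 0}" by (rule open_halfspace_Re_gt)
    show "(\<lambda>a. integral (Q n) (f a)) holomorphic_on {a. Re a > 0}" for n
      unfolding Q_def
    proof (rule leibniz_rule_holomorphic)
      show "((\<lambda>a. f a \<xi>) has_field_derivative - of_real ((norm \<xi>)\<^sup>2) * f a \<xi>) (at a within {a. Re a > 0})" for a \<xi>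
        unfolding f_def by (auto intro!: derivative_eq_intros)
      show "f a integrable_on cbox (- (real n *\<^sub>R One)) (real n *\<^sub>R One)" for a
        by (intro integrable_continuous contf)
      show "continuous_on ({a. Re a > 0} \<times> cbox (- (real n *\<^sub>R One)) (real n *\<^sub>R One))
          (\<lambda>(a, \<xi>). - of_real ((norm \<xi>)\<^sup>2) * f a \<xi>)"
        unfolding f_def case_prod_beta
        by (intro continuous_intros continuous_on_compose2[OF cont]) auto
    qed (rule convex_halfspace_Re_gt)
    fix a assume "a \<in> {a. Re a > 0}"
    then obtain d where d: "d > 0" "cball a d \<subseteq> {a. Re a > 0}"
      using op open_contains_cball by metis
    have "uniform_limit (cball a d) (\<lambda>n a. integral (Q n) (f a)) (\<lambda>a. LINT \<xi>|lborel. f a \<xi>) sequentially"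
    proof (rule uniform_limitI)
      fix e :: real assume "e > 0"
      then have "eventually (\<lambda>n. \<delta> n < e) sequentially" using order_tendstoD(2)[OF \<delta>_lim] by simp
      then show "eventually (\<lambda>n. \<forall>a\<in>cball a d. dist (integral (Q n) (f a)) (LINT \<xi>|lborel. f a \<xi>) < e) sequentially"
      proof eventually_elim
        case (elim n)
        show ?case
        proof
          fix a' assume "a' \<in> cball a d"
          then have "Re a' \<ge> 0" using d by (auto simp: less_imp_le)
          from near[OF this, of n] elim
          show "dist (integral (Q n) (f a')) (LINT \<xi>|lborel. f a' \<xi>) < e" by (simp add: dist_norm)
        qed
      qed
    qed
    with d show "\<exists>d>0. cball a d \<subseteq> {a. Re a > 0} \<and>
        uniform_limit (cball a d) (\<lambda>n a. integral (Q n) (f a)) (\<lambda>a. LINT \<xi>|lborel. f a \<xi>) sequentially"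
      by blast
  qed
  then show ?thesis by (simp add: f_def)
qed

lemma holomorphic_heat_kernel_integral:
  fixes h :: "'a::euclidean_space \<Rightarrow> complex"
  assumes h: "compactly_supported h"
  shows "(\<lambda>s. LINT y|lborel. h y * exp (- (s * of_real ((norm (x - y))\<^sup>2)))) holomorphic_on UNIV"
proof -
  obtain c d where cd: "\<And>y. y \<notin> cbox c d \<Longrightarrow> h y = 0" using compactly_supported_cbox[OF h] by metis
  have cont: "continuous_on S h" for S
    using h by (auto simp: compactly_supported_def intro: continuous_on_subset)
  have "(\<lambda>s. integral (cbox c d) (\<lambda>y. h y * exp (- (s * of_real ((norm (x - y))\<^sup>2))))) holomorphic_on UNIV"
  proof (rule leibniz_rule_holomorphic)
    show "((\<lambda>s. h y * exp (- (s * of_real ((norm (x - y))\<^sup>2)))) has_field_derivative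
       h y * (exp (- (s * of_real ((norm (x - y))\<^sup>2))) * (- of_real ((norm (x - y))\<^sup>2)))) (at s within UNIV)" for s y
      by (auto intro!: derivative_eq_intros)
    show "(\<lambda>y. h y * exp (- (s * of_real ((norm (x - y))\<^sup>2)))) integrable_on cbox c d" for s
      by (intro integrable_continuous continuous_intros cont)
    show "continuous_on (UNIV \<times> cbox c d)
       (\<lambda>(s, y). h y * (exp (- (s * of_real ((norm (x - y))\<^sup>2))) * (- of_real ((norm (x - y))\<^sup>2))))"
      unfolding case_prod_beta
      by (intro continuous_intros continuous_on_compose2[OF cont[of UNIV]]) auto
  qed auto
  moreover have "integral (cbox c d) (\<lambda>y. h y * exp (- (s * of_real ((norm (x - y))\<^sup>2)))) =
      (LINT y|lborel. h y * exp (- (s * of_real ((norm (x - y))\<^sup>2))))" for s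
    by (rule lborel_integral_eq_integral_cbox[symmetric]) (use cd in \<open>auto intro!: continuous_intros cont\<close>)
  ultimately show ?thesis by simp
qed

text \<open>
  Both sides are holomorphic in the right half plane and agree on the positive real axis.
\<close>

lemma gaussian_regularized_evolution:
  fixes h :: "'a::euclidean_space \<Rightarrow> complex" and a :: complex
  assumes h: "compactly_supported h" and int: "integrable lborel (fourier h)" and a: "Re a > 0"
  shows "(LINT \<xi>|lborel. exp (- (a * of_real ((norm \<xi>)\<^sup>2))) * (fourier h \<xi> * exp (\<i> * of_real (\<xi> \<bullet> x))))
    = csqrt (of_real pi / a) ^ DIM('a) * (LINT y|lborel. h y * exp (- (1 / (4 * a) * of_real ((norm (x - y))\<^sup>2))))"
proof -
  let ?S = "{a. Re a > 0}"
  define g where "g \<xi> = fourier h \<xi> * exp (\<i> * of_real (\<xi> \<bullet> x))" for \<xi>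
  have contg: "continuous_on UNIV g" unfolding g_def by (intro continuous_intros continuous_fourier h)
  have intg: "integrable lborel g"
    by (rule Bochner_Integration.integrable_bound[OF int])
       (use contg in \<open>auto simp: g_def norm_mult intro!: borel_measurable_continuous_onI\<close>)
  define A where "A a = (LINT \<xi>|lborel. exp (- (a * of_real ((norm \<xi>)\<^sup>2))) * g \<xi>)" for a
  define K where "K s = (LINT y|lborel. h y * exp (- (s * of_real ((norm (x - y))\<^sup>2))))" for s
  define B where "B a = csqrt (of_real pi / a) ^ DIM('a) * K (1 / (4 * a))" for a
  have nz: "a \<noteq> 0" "of_real pi / a \<notin> \<real>\<^sub>\<le>\<^sub>0" if "Re a > 0" for a
  proof -
    show "a \<noteq> 0" using that by auto
    have "Re (of_real pi / a) > 0"
      using that \<open>a \<noteq> 0\<close> by (auto simp: Re_divide sum_power2_gt_zero_iff complex_eq_iff intro!: divide_pos_pos)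
    then show "of_real pi / a \<notin> \<real>\<^sub>\<le>\<^sub>0" by (auto simp: complex_nonpos_Reals_iff)
  qed
  have "K holomorphic_on UNIV" unfolding K_def by (rule holomorphic_heat_kernel_integral[OF h])
  then have "(K \<circ> (\<lambda>a. 1 / (4 * a))) holomorphic_on ?S"
    by (intro holomorphic_on_compose_gen[where t = UNIV])
       (use nz in \<open>auto intro!: holomorphic_intros\<close>)
  then have "B holomorphic_on ?S"
    unfolding B_def o_def by (intro holomorphic_intros) (use nz in auto)
  moreover have "A holomorphic_on ?S"
    unfolding A_def by (rule holomorphic_gaussian_regularization[OF contg intg])
  ultimately have hol: "(\<lambda>a. A a - B a) holomorphic_on ?S" by (intro holomorphic_intros)
  have "A a - B a = 0"
  proof (rule analytic_continuation[OF hol, where U = "of_real ` {0<..}" and \<xi> = 1])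
    show "connected ?S" by (intro convex_connected convex_halfspace_Re_gt)
    show "(1::complex) islimpt of_real ` {0<..}"
      unfolding islimpt_approachable
    proof (intro allI impI)
      fix e :: real assume "e > 0"
      then show "\<exists>x'\<in>of_real ` {0<..}. x' \<noteq> (1::complex) \<and> dist x' 1 < e"
        by (intro bexI[OF _ imageI[of "1 + e / 2"]]) (auto simp: dist_norm)
    qed
    show "A z - B z = 0" if "z \<in> of_real ` {0<..}" for z
    proof -
      from that obtain r :: real where r: "z = of_real r" "r > 0" by auto
      have "csqrt (of_real (pi / r)) = of_real (sqrt (pi / r))"
        by (rule of_real_sqrt[symmetric]) (use r in simp)
      then have "csqrt (of_real pi / of_real r) = of_real (sqrt (pi / r))" by simp
      then show ?thesis
        using gaussian_regularized_evolution_real[OF h r(2), of x] r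
        by (simp add: A_def B_def K_def g_def mult_ac)
    qed
  qed (use a in \<open>auto simp: open_halfspace_Re_gt\<close>)
  then show ?thesis by (simp add: A_def B_def K_def g_def)
qed

text \<open>
  Up to the factor \<open>(2\<pi>)\<^sup>n\<close> this is \<open>e\<^bsup>it\<Delta>\<^esup>h\<close> on Euclidean space.
\<close>

definition free_evolution :: "real \<Rightarrow> ('a::euclidean_space \<Rightarrow> complex) \<Rightarrow> 'a \<Rightarrow> complex" where
  "free_evolution t h x = (LINT \<xi>|lborel.
     exp (- \<i> * of_real (t * (norm \<xi>)\<^sup>2)) * fourier h \<xi> * exp (\<i> * of_real (\<xi> \<bullet> x)))"

text \<open>
  The parameter of the regularised formula tends to \<open>\<i>t\<close> from the right half plane. On the left
  dominated convergence applies since \<open>fourier h\<close> is integrable; the right side is continuous there.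
\<close>

lemma free_evolution_kernel:
  fixes h :: "'a::euclidean_space \<Rightarrow> complex" and t :: real
  assumes h: "compactly_supported h" and int: "integrable lborel (fourier h)" and t: "t \<noteq> 0"
  shows "free_evolution t h x = csqrt (of_real pi / (\<i> * of_real t)) ^ DIM('a) *
    (LINT y|lborel. h y * exp (- (1 / (4 * (\<i> * of_real t)) * of_real ((norm (x - y))\<^sup>2))))"
proof -
  define g where "g \<xi> = fourier h \<xi> * exp (\<i> * of_real (\<xi> \<bullet> x))" for \<xi>
  have contg: "continuous_on UNIV g" unfolding g_def by (intro continuous_intros continuous_fourier h)
  have [measurable]: "g \<in> borel_measurable borel" using contg by (rule borel_measurable_continuous_onI)
  define A where "A a = (LINT \<xi>|lborel. exp (- (a * of_real ((norm \<xi>)\<^sup>2))) * g \<xi>)" for a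
  define K where "K s = (LINT y|lborel. h y * exp (- (s * of_real ((norm (x - y))\<^sup>2))))" for s
  define B where "B a = csqrt (of_real pi / a) ^ DIM('a) * K (1 / (4 * a))" for a
  define a where "a n = complex_of_real (1 / real (Suc n)) + \<i> * of_real t" for n
  have "(\<lambda>n. complex_of_real (1 / real (Suc n))) \<longlonglongrightarrow> of_real 0"
    by (intro tendsto_of_real LIMSEQ_Suc lim_1_over_n)
  then have "a \<longlonglongrightarrow> of_real 0 + \<i> * of_real t" unfolding a_def by (rule tendsto_add[OF _ tendsto_const])
  then have a_lim: "a \<longlonglongrightarrow> \<i> * of_real t" by simp
  have AB: "A (a n) = B (a n)" for n
    unfolding A_def B_def K_def g_def by (rule gaussian_regularized_evolution[OF h int]) (simp add: a_def)
  have "(\<lambda>n. A (a n)) \<longlonglongrightarrow> A (\<i> * of_real t)"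
    unfolding A_def
  proof (rule integral_dominated_convergence[where w = "\<lambda>\<xi>. norm (fourier h \<xi>)"])
    show "AE \<xi> in lborel. (\<lambda>n. exp (- (a n * of_real ((norm \<xi>)\<^sup>2))) * g \<xi>) \<longlonglongrightarrow> exp (- (\<i> * of_real t * of_real ((norm \<xi>)\<^sup>2))) * g \<xi>"
      by (intro AE_I2 tendsto_intros a_lim)
    show "AE \<xi> in lborel. norm (exp (- (a n * of_real ((norm \<xi>)\<^sup>2))) * g \<xi>) \<le> norm (fourier h \<xi>)" for n
      by (intro AE_I2) (auto simp: norm_mult g_def a_def intro!: mult_left_le_one_le)
  qed (use int in auto)
  moreover have "isCont B (\<i> * of_real t)"
  proof -
    have "of_real pi / (\<i> * of_real t) = - (\<i> * of_real (pi / t))" using t by (simp add: field_simps)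
    then have "of_real pi / (\<i> * of_real t) \<notin> \<real>\<^sub>\<le>\<^sub>0"
      using t by (auto simp: complex_nonpos_Reals_iff)
    moreover have "isCont K s" for s
      using holomorphic_on_imp_continuous_on[OF holomorphic_heat_kernel_integral[OF h, of x]]
      unfolding K_def by (simp add: continuous_on_eq_continuous_at)
    moreover have quot: "isCont (\<lambda>a. c / (m * a)) z" if "m * z \<noteq> 0" for c m z :: complex
      by (rule isCont_divide[OF continuous_const isCont_mult[OF continuous_const continuous_ident] that])
    have "isCont (\<lambda>a. 1 / (4 * a)) (\<i> * of_real t)" "isCont (\<lambda>a. of_real pi / a) (\<i> * of_real t)"
      using quot[of 4 "\<i> * of_real t" 1] quot[of 1 "\<i> * of_real t" "of_real pi"] t by simp_all
    ultimately have "isCont (\<lambda>a. csqrt (of_real pi / a)) (\<i> * of_real t)"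
      "isCont (\<lambda>a. K (1 / (4 * a))) (\<i> * of_real t)"
      using isCont_o2[where g = csqrt] isCont_o2[where g = K] continuous_at_csqrt by blast+
    then show ?thesis unfolding B_def by (intro isCont_mult isCont_power)
  qed
  then have "(\<lambda>n. B (a n)) \<longlonglongrightarrow> B (\<i> * of_real t)"
    using a_lim by (rule isCont_tendsto_compose)
  ultimately have "A (\<i> * of_real t) = B (\<i> * of_real t)"
    unfolding AB by (rule LIMSEQ_unique)
  then show ?thesis by (simp add: A_def B_def K_def g_def free_evolution_def mult.assoc)
qed

text \<open>
  Expanding \<open>|x - y|\<^sup>2\<close> in the kernel, the term in \<open>|x|\<^sup>2\<close> is a phase outside the integral, the term in
  \<open>|y|\<^sup>2\<close> is a phase that can be absorbed into \<open>h\<close>, and the mixed term is the character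
  \<open>exp (- \<i> (y \<bullet> \<xi>))\<close> with \<open>x = 2t \<xi>\<close>.
\<close>

lemma free_evolution_decay_imp_zero:
  fixes h :: "'a::euclidean_space \<Rightarrow> complex" and t A :: real and \<theta> :: "real \<Rightarrow> real"
  assumes h: "compactly_supported h" and int: "integrable lborel (fourier h)" and t: "t \<noteq> 0"
    and decay: "\<And>x. norm (free_evolution t h x) \<le> A * exp (- \<theta> (norm x))"
    and \<theta>: "\<And>r. r \<ge> 0 \<Longrightarrow> \<theta> r \<ge> 0" "\<And>R. R \<ge> 0 \<Longrightarrow> \<theta> absolutely_integrable_on {0..R}"
      "(\<integral>\<^sup>+r\<in>{0..}. ennreal (\<theta> r / (1 + r\<^sup>2)) \<partial>lebesgue) = \<infinity>"
  shows "h y = 0"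
proof -
  define \<kappa> where "\<kappa> = 1 / (4 * (\<i> * of_real t))"
  define k where "k = csqrt (of_real pi / (\<i> * of_real t)) ^ DIM('a)"
  have k: "norm k > 0" using t by (simp add: k_def)
  have \<kappa>: "\<kappa> = - \<i> * of_real (1 / (4 * t))" using t by (simp add: \<kappa>_def field_simps)
  define g where "g y = h y * exp (- (\<kappa> * of_real ((norm y)\<^sup>2)))" for y
  have g: "compactly_supported g"
    unfolding g_def by (intro compactly_supported_mult h continuous_intros)
  have "g y = 0"
  proof (rule fourier_decay_imp_zero[OF g, where \<rho> = "1 / (2 * \<bar>t\<bar>)" and A = "A / norm k"])
    fix \<xi> :: 'a
    define x where "x = (2 * t) *\<^sub>R \<xi>"
    have eq: "h y * exp (- (\<kappa> * of_real ((norm (x - y))\<^sup>2)))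
        = exp (- (\<kappa> * of_real ((norm x)\<^sup>2))) * (g y * exp (- \<i> * of_real (y \<bullet> \<xi>)))" for y
    proof -
      have n2: "(norm (x - y))\<^sup>2 = (norm x)\<^sup>2 + (norm y)\<^sup>2 - 4 * t * (y \<bullet> \<xi>)"
        by (simp add: x_def power2_norm_eq_inner inner_diff_left inner_diff_right inner_commute algebra_simps,
            simp add: power2_eq_square)
      have "\<kappa> * of_real (4 * t * (y \<bullet> \<xi>)) = - \<i> * of_real (y \<bullet> \<xi>)"
        using t by (simp add: \<kappa>)
      then have "- (\<kappa> * of_real ((norm (x - y))\<^sup>2)) =
          - (\<kappa> * of_real ((norm x)\<^sup>2)) + - (\<kappa> * of_real ((norm y)\<^sup>2)) + - \<i> * of_real (y \<bullet> \<xi>)"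
        unfolding n2 by (simp only: of_real_diff of_real_add ring_distribs) (simp add: algebra_simps)
      then show ?thesis by (simp only: exp_add g_def mult_ac)
    qed
    have "free_evolution t h x = k * (LINT y|lborel. h y * exp (- (\<kappa> * of_real ((norm (x - y))\<^sup>2))))"
      unfolding k_def \<kappa>_def by (rule free_evolution_kernel[OF h int t])
    also have "\<dots> = k * (exp (- (\<kappa> * of_real ((norm x)\<^sup>2))) * (LINT y|lborel. g y * exp (- \<i> * of_real (y \<bullet> \<xi>))))"
      unfolding eq by (simp only: integral_mult_right_zero)
    finally have "norm (free_evolution t h x) = norm k * norm (LINT y|lborel. g y * exp (- \<i> * of_real (y \<bullet> \<xi>)))"
      by (simp add: norm_mult \<kappa>)
    moreover have "norm x = norm \<xi> / (1 / (2 * \<bar>t\<bar>))" by (simp add: x_def abs_mult)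
    ultimately show "norm (LINT y|lborel. g y * exp (- \<i> * of_real (y \<bullet> \<xi>)))
        \<le> A / norm k * exp (- \<theta> (norm \<xi> / (1 / (2 * \<bar>t\<bar>))))"
      using decay[of x] k by (simp add: field_simps)
  qed (use t \<theta> in auto)
  then show ?thesis by (simp add: g_def)
qed

lemma compactly_supported_zero: "compactly_supported (\<lambda>_. 0)"
  by (simp add: compactly_supported_def)

lemma compactly_supported_sum:
  assumes "finite I" "\<And>p. p \<in> I \<Longrightarrow> compactly_supported (h p)"
  shows "compactly_supported (\<lambda>y. \<Sum>p\<in>I. c p * h p y)"
  using assms
proof induction
  case empty
  then show ?case by (simp add: compactly_supported_zero)
next
  case (insert p I)
  obtain r where r: "\<And>y. norm y > r \<Longrightarrow> (\<Sum>p\<in>I. c p * h p y) = 0"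
    using insert by (auto simp: compactly_supported_def)
  obtain r' where r': "\<And>y. norm y > r' \<Longrightarrow> h p y = 0"
    using insert.prems[of p] by (auto simp: compactly_supported_def)
  have "continuous_on UNIV (\<lambda>y. c p * h p y + (\<Sum>p\<in>I. c p * h p y))"
    using insert by (intro continuous_intros) (auto simp: compactly_supported_def)
  moreover have "c p * h p y + (\<Sum>p\<in>I. c p * h p y) = 0" if "norm y > max r r'" for y
    using r[of y] r'[of y] that by simp
  ultimately show ?case using insert by (auto simp: compactly_supported_def intro!: exI[of _ "max r r'"])
qed

lemma fourier_sum:
  assumes h: "\<And>p. p \<in> I \<Longrightarrow> compactly_supported (h p)"
  shows "fourier (\<lambda>y. \<Sum>p\<in>I. c p * h p y) \<xi> = (\<Sum>p\<in>I. c p * fourier (h p) \<xi>)"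
proof -
  have int: "integrable lborel (\<lambda>x. h p x * exp (- \<i> * of_real (inner x \<xi>)))" if "p \<in> I" for p
    by (intro integrable_compactly_supported compactly_supported_mult h that continuous_intros)
  have "fourier (\<lambda>y. \<Sum>p\<in>I. c p * h p y) \<xi> =
      (LINT x|lborel. (\<Sum>p\<in>I. c p * (h p x * exp (- \<i> * of_real (inner x \<xi>)))))"
    by (simp add: fourier_def sum_distrib_right mult.assoc)
  also have "\<dots> = (\<Sum>p\<in>I. LINT x|lborel. c p * (h p x * exp (- \<i> * of_real (inner x \<xi>))))"
    by (intro Bochner_Integration.integral_sum integrable_mult_right int)
  finally show ?thesis by (simp add: fourier_def)
qed

text \<open>
  The two integrands have the same modulus.
\<close>

lemma integrable_evolution_iff:
  fixes h :: "'a::euclidean_space \<Rightarrow> complex"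
  assumes "compactly_supported h"
  shows "integrable lborel (\<lambda>\<xi>. exp (- \<i> * of_real (t * (norm \<xi>)\<^sup>2)) * fourier h \<xi> * exp (\<i> * of_real (\<xi> \<bullet> x)))
    \<longleftrightarrow> integrable lborel (fourier h)" (is "integrable lborel ?g \<longleftrightarrow> _")
proof -
  have 1: "continuous_on UNIV (fourier h)" by (rule continuous_fourier[OF assms])
  then have 2: "continuous_on UNIV ?g" by (intro continuous_intros)
  have [measurable]: "fourier h \<in> borel_measurable borel" "?g \<in> borel_measurable borel"
    using 1 2 by (auto intro: borel_measurable_continuous_onI)
  have "norm (?g \<xi>) = norm (fourier h \<xi>)" for \<xi> by (simp add: norm_mult)
  then show ?thesis
    by (auto elim!: Bochner_Integration.integrable_bound)
qed

lemma free_evolution_zero: "free_evolution t (\<lambda>_. 0) x = 0"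
  by (simp add: free_evolution_def fourier_def)

lemma free_evolution_sum:
  fixes h :: "'i \<Rightarrow> 'a::euclidean_space \<Rightarrow> complex"
  assumes h: "\<And>p. p \<in> I \<Longrightarrow> compactly_supported (h p)"
    and int: "\<And>p. p \<in> I \<Longrightarrow> integrable lborel (fourier (h p))"
  shows "free_evolution t (\<lambda>y. \<Sum>p\<in>I. c p * h p y) x = (\<Sum>p\<in>I. c p * free_evolution t (h p) x)"
proof -
  have "free_evolution t (\<lambda>y. \<Sum>p\<in>I. c p * h p y) x = (LINT \<xi>|lborel. (\<Sum>p\<in>I. c p *
      (exp (- \<i> * of_real (t * (norm \<xi>)\<^sup>2)) * fourier (h p) \<xi> * exp (\<i> * of_real (\<xi> \<bullet> x)))))"
    unfolding free_evolution_def
    by (rule Bochner_Integration.integral_cong)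
       (auto simp: fourier_sum[OF h] sum_distrib_left sum_distrib_right mult_ac)
  also have "\<dots> = (\<Sum>p\<in>I. LINT \<xi>|lborel. c p *
      (exp (- \<i> * of_real (t * (norm \<xi>)\<^sup>2)) * fourier (h p) \<xi> * exp (\<i> * of_real (\<xi> \<bullet> x))))"
    using integrable_evolution_iff[OF h] int
    by (intro Bochner_Integration.integral_sum integrable_mult_right) auto
  finally show ?thesis by (simp add: free_evolution_def)
qed

lemma continuous_free_evolution:
  fixes h :: "'a::euclidean_space \<Rightarrow> complex"
  assumes h: "compactly_supported h" and int: "integrable lborel (fourier h)"
  shows "continuous_on UNIV (free_evolution t h)"
proof -
  have 1: "continuous_on UNIV (fourier h)" by (rule continuous_fourier[OF h])
  have "(\<lambda>n. free_evolution t h (X n)) \<longlonglongrightarrow> free_evolution t h x" if X: "X \<longlonglongrightarrow> x" for X x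
    unfolding free_evolution_def
  proof (rule integral_dominated_convergence[where w = "\<lambda>\<xi>. norm (fourier h \<xi>)"])
    show "AE \<xi> in lborel. (\<lambda>n. exp (- \<i> * of_real (t * (norm \<xi>)\<^sup>2)) * fourier h \<xi> * exp (\<i> * of_real (\<xi> \<bullet> X n)))
        \<longlonglongrightarrow> exp (- \<i> * of_real (t * (norm \<xi>)\<^sup>2)) * fourier h \<xi> * exp (\<i> * of_real (\<xi> \<bullet> x))"
      by (intro AE_I2 tendsto_intros X)
    have "(\<lambda>\<xi>. exp (- \<i> * of_real (t * (norm \<xi>)\<^sup>2)) * fourier h \<xi> * exp (\<i> * of_real (\<xi> \<bullet> y))) \<in> borel_measurable lborel" for y
      using 1 by (simp, intro borel_measurable_continuous_onI continuous_intros)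
    then show "(\<lambda>\<xi>. exp (- \<i> * of_real (t * (norm \<xi>)\<^sup>2)) * fourier h \<xi> * exp (\<i> * of_real (\<xi> \<bullet> x))) \<in> borel_measurable lborel"
      "(\<lambda>\<xi>. exp (- \<i> * of_real (t * (norm \<xi>)\<^sup>2)) * fourier h \<xi> * exp (\<i> * of_real (\<xi> \<bullet> X n))) \<in> borel_measurable lborel" for n
      by blast+
  qed (use int in \<open>auto simp: norm_mult\<close>)
  then show ?thesis
    by (auto simp: continuous_on_eq_continuous_at continuous_at_sequentially o_def)
qed

definition regular_part :: "('a::euclidean_space \<Rightarrow> complex) \<Rightarrow> 'a \<Rightarrow> complex" where
  "regular_part h = (if integrable lborel (fourier h) then h else (\<lambda>_. 0))"

text \<open>
  The oscillatory factors have modulus one, so integrability of the integrand that defines the free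
  evolution is the same question for all \<open>t\<close> and \<open>x\<close>. If \<open>fourier h\<close> is not integrable, the integral is
  zero by convention at all times, just as for the zero function.
\<close>

lemma regular_part:
  fixes h :: "'a::euclidean_space \<Rightarrow> complex"
  assumes h: "compactly_supported h"
  shows "compactly_supported (regular_part h)" "integrable lborel (fourier (regular_part h))"
    "free_evolution t (regular_part h) x = free_evolution t h x"
proof -
  have zero: "fourier (\<lambda>_::'a. 0) = (\<lambda>_. 0)" by (simp add: fourier_def fun_eq_iff)
  show "compactly_supported (regular_part h)" "integrable lborel (fourier (regular_part h))"
    using h by (auto simp: regular_part_def compactly_supported_zero zero)
  show "free_evolution t (regular_part h) x = free_evolution t h x"
  proof (cases "integrable lborel (fourier h)")
    case False
    then have "free_evolution t h x = 0"
      unfolding free_evolution_def using integrable_evolution_iff[OF h]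
      by (intro not_integrable_integral_eq) blast
    then show ?thesis using False by (simp add: regular_part_def free_evolution_zero)
  qed (simp add: regular_part_def)
qed


section \<open>Matrix entries of unitary representations\<close>

lemma space_haar: "normalized_haar \<mu> \<Longrightarrow> space \<mu> = SO"
  unfolding normalized_haar_def using sets_eq_imp_space_eq[of \<mu> "restrict_space borel SO"]
  by (simp add: space_restrict_space)

lemma borel_measurable_haar:
  fixes F :: "real^'n^'n \<Rightarrow> 'b::topological_space"
  assumes "normalized_haar \<mu>" "continuous_on SO F"
  shows "F \<in> borel_measurable \<mu>"
proof -
  have "F \<in> borel_measurable (restrict_space borel SO)"
    by (rule borel_measurable_continuous_on_restrict[OF assms(2)])
  then show ?thesis
    using assms(1) by (simp add: normalized_haar_def cong: measurable_cong_sets)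
qed

lemma SO_closed_mult: "a \<in> SO \<Longrightarrow> k \<in> SO \<Longrightarrow> a ** k \<in> SO"
  by (simp add: SO_def orthogonal_matrix_mul det_mul)

lemma SO_one: "Finite_Cartesian_Product.mat 1 \<in> SO"
  by (simp add: SO_def orthogonal_matrix_id)

lemma measurable_haar_translate:
  assumes "normalized_haar \<mu>" "a \<in> SO"
  shows "(\<lambda>k. a ** k) \<in> measurable \<mu> \<mu>"
proof -
  have "continuous_on SO (\<lambda>k. a ** k)"
    unfolding matrix_matrix_mult_def by (intro continuous_intros continuous_on_vec_lambda)
  then have "(\<lambda>k. a ** k) \<in> measurable \<mu> (restrict_space borel SO)"
    using borel_measurable_haar[OF assms(1), of "\<lambda>k. a ** k"] SO_closed_mult[OF assms(2)]
    by (intro measurable_restrict_space2)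
       (auto simp: space_haar[OF assms(1)] intro!: continuous_intros)
  then show ?thesis
    using assms(1) by (simp add: normalized_haar_def cong: measurable_cong_sets)
qed

lemma haar_integral_translate:
  fixes F :: "real^'n^'n \<Rightarrow> complex"
  assumes "normalized_haar \<mu>" "a \<in> SO" "continuous_on SO F"
  shows "(LINT k|\<mu>. F k) = (LINT k|\<mu>. F (a ** k))"
proof -
  have "(LINT k|\<mu>. F k) = (LINT k|distr \<mu> \<mu> (\<lambda>k. a ** k). F k)"
    using assms by (simp add: normalized_haar_def)
  also have "\<dots> = (LINT k|\<mu>. F (a ** k))"
    by (rule integral_distr[OF measurable_haar_translate borel_measurable_haar]) (use assms in auto)
  finally show ?thesis .
qed

lemma mat_adjoint_mult_index:
  fixes A B :: "complex Matrix.mat"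
  assumes "A \<in> carrier_mat n n" "B \<in> carrier_mat n m" "i < n" "j < m"
  shows "(mat_adjoint A * B) $$ (i, j) = (\<Sum>r<n. cnj (A $$ (r, i)) * B $$ (r, j))"
  using assms
  by (auto simp: mat_adjoint_def scalar_prod_def lessThan_atLeast0 intro!: sum.cong)

lemma mult_mat_index:
  fixes A B :: "complex Matrix.mat"
  assumes "A \<in> carrier_mat n l" "B \<in> carrier_mat l m" "i < n" "j < m"
  shows "(A * B) $$ (i, j) = (\<Sum>r<l. A $$ (i, r) * B $$ (r, j))"
  using assms by (auto simp: scalar_prod_def lessThan_atLeast0 intro!: sum.cong)

context
  fixes \<pi> :: "'n::finite rep"
  assumes rep: "unitary_rep \<pi>"
begin

lemma unitary_rep_carrier: "k \<in> SO \<Longrightarrow> \<pi> k \<in> carrier_mat (degree_rep \<pi>) (degree_rep \<pi>)"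
  using rep by (simp add: unitary_rep_def)

lemma unitary_rep_mult: "k \<in> SO \<Longrightarrow> l \<in> SO \<Longrightarrow> \<pi> (k ** l) = \<pi> k * \<pi> l"
  using rep by (simp add: unitary_rep_def)

lemma unitary_rep_adjoint: "k \<in> SO \<Longrightarrow> mat_adjoint (\<pi> k) * \<pi> k = 1\<^sub>m (degree_rep \<pi>)"
  using rep by (simp add: unitary_rep_def)

lemma continuous_on_rep:
  "i < degree_rep \<pi> \<Longrightarrow> j < degree_rep \<pi> \<Longrightarrow> continuous_on SO (\<lambda>k. \<pi> k $$ (i, j))"
  using rep by (simp add: unitary_rep_def)

text \<open>
  The columns of a unitary matrix have length one.
\<close>

lemma rep_coeff_le_one:
  assumes k: "k \<in> SO" and ij: "i < degree_rep \<pi>" "j < degree_rep \<pi>"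
  shows "cmod (\<pi> k $$ (i, j)) \<le> 1"
proof -
  let ?d = "degree_rep \<pi>"
  have "(\<Sum>r<?d. cnj (\<pi> k $$ (r, j)) * \<pi> k $$ (r, j)) = (mat_adjoint (\<pi> k) * \<pi> k) $$ (j, j)"
    by (rule mat_adjoint_mult_index[symmetric]) (use unitary_rep_carrier[OF k] ij in auto)
  also have "\<dots> = 1" using unitary_rep_adjoint[OF k] ij by simp
  finally have "complex_of_real (\<Sum>r<?d. (cmod (\<pi> k $$ (r, j)))\<^sup>2) = of_real 1"
    by (simp add: mult.commute flip: complex_norm_square)
  then have *: "(\<Sum>r<?d. (cmod (\<pi> k $$ (r, j)))\<^sup>2) = 1" by (simp only: of_real_eq_iff)
  have "(cmod (\<pi> k $$ (i, j)))\<^sup>2 \<le> 1"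
    unfolding *[symmetric] by (rule member_le_sum) (use ij in auto)
  then show ?thesis by (simp add: abs_square_le_1)
qed

end

lemma haar_integrable_bounded:
  fixes F :: "real^'n^'n \<Rightarrow> complex"
  assumes "normalized_haar \<mu>" "continuous_on SO F" "\<And>k. k \<in> SO \<Longrightarrow> cmod (F k) \<le> M"
  shows "integrable \<mu> F"
proof -
  interpret prob_space \<mu> using assms(1) by (simp add: normalized_haar_def)
  show ?thesis
    by (rule integrable_const_bound[where B = M])
       (use assms borel_measurable_haar[OF assms(1,2)] in \<open>auto simp: space_haar intro!: AE_I2\<close>)
qed

lemma integrable_coeff_product:
  assumes "normalized_haar \<mu>" "unitary_rep \<pi>" "unitary_rep \<sigma>"
    "i < degree_rep \<pi>" "j < degree_rep \<pi>" "k < degree_rep \<sigma>" "l < degree_rep \<sigma>"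
  shows "integrable \<mu> (\<lambda>g. \<pi> g $$ (i, j) * cnj (\<sigma> g $$ (k, l)))"
proof (rule haar_integrable_bounded[OF assms(1)])
  show "continuous_on SO (\<lambda>g. \<pi> g $$ (i, j) * cnj (\<sigma> g $$ (k, l)))"
    using assms by (intro continuous_intros continuous_on_rep) auto
  show "cmod (\<pi> g $$ (i, j) * cnj (\<sigma> g $$ (k, l))) \<le> 1" if "g \<in> SO" for g
    using rep_coeff_le_one[OF assms(2) that assms(4,5)] rep_coeff_le_one[OF assms(3) that assms(6,7)]
    by (simp add: norm_mult mult_le_one)
qed

text \<open>
  \<open>A\<close> is the average of \<open>\<pi>(g) M \<sigma>(g)\<^sup>*\<close> over the group, where \<open>M\<close> is the matrix unit at \<open>(j, l)\<close>.
  Translating the integration variable by \<open>a\<close> moves \<open>\<sigma> a\<close> on the right to \<open>\<pi> a\<close> on the left.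
\<close>

lemma haar_average_intertwines:
  fixes \<pi> \<sigma> :: "'n::finite rep"
  assumes \<mu>: "normalized_haar \<mu>" and \<pi>: "unitary_rep \<pi>" and \<sigma>: "unitary_rep \<sigma>"
    and j: "j < degree_rep \<pi>" and l: "l < degree_rep \<sigma>" and a: "a \<in> SO"
  defines "A \<equiv> Matrix.mat (degree_rep \<pi>) (degree_rep \<sigma>)
                 (\<lambda>(i, k). LINT g|\<mu>. \<pi> g $$ (i, j) * cnj (\<sigma> g $$ (k, l)))"
  shows "\<pi> a * A = A * \<sigma> a"
proof (rule eq_matI)
  let ?n = "degree_rep \<pi>" and ?m = "degree_rep \<sigma>"
  have A: "A \<in> carrier_mat ?n ?m" by (simp add: A_def)
  have Ai: "A $$ (i, k) = (LINT g|\<mu>. \<pi> g $$ (i, j) * cnj (\<sigma> g $$ (k, l)))" if "i < ?n" "k < ?m" for i k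
    using that by (simp add: A_def)
  note ca = unitary_rep_carrier[OF \<pi> a] unitary_rep_carrier[OF \<sigma> a]
  show "dim_row (\<pi> a * A) = dim_row (A * \<sigma> a)" "dim_col (\<pi> a * A) = dim_col (A * \<sigma> a)"
    using ca A by auto
  fix i k assume "i < dim_row (A * \<sigma> a)" "k < dim_col (A * \<sigma> a)"
  then have ik: "i < ?n" "k < ?m" using ca A by auto
  \<comment> \<open>\<open>F g\<close> is the integrand of the \<open>(i, k)\<close> entry of \<open>A * \<sigma> a\<close>, with \<open>\<sigma> a\<close> moved into the conjugated factor.\<close>
  define F where "F g = \<pi> g $$ (i, j) * cnj (\<Sum>r<?m. cnj (\<sigma> a $$ (r, k)) * \<sigma> g $$ (r, l))" for g
  have contF: "continuous_on SO F"
    unfolding F_def using ik j l by (intro continuous_intros continuous_on_rep \<pi> \<sigma>) auto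
  have F_shift: "F (a ** g) = (\<Sum>r<?n. \<pi> a $$ (i, r) * (\<pi> g $$ (r, j) * cnj (\<sigma> g $$ (k, l))))" if g: "g \<in> SO" for g
  proof -
    note cg = unitary_rep_carrier[OF \<pi> g] unitary_rep_carrier[OF \<sigma> g]
    have ag: "a ** g \<in> SO" by (rule SO_closed_mult[OF a g])
    have "(\<Sum>r<?m. cnj (\<sigma> a $$ (r, k)) * \<sigma> (a ** g) $$ (r, l)) = (mat_adjoint (\<sigma> a) * \<sigma> (a ** g)) $$ (k, l)"
      by (rule mat_adjoint_mult_index[symmetric]) (use ca unitary_rep_carrier[OF \<sigma> ag] ik l in auto)
    also have "mat_adjoint (\<sigma> a) * \<sigma> (a ** g) = mat_adjoint (\<sigma> a) * \<sigma> a * \<sigma> g"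
      unfolding unitary_rep_mult[OF \<sigma> a g]
      by (rule assoc_mult_mat[symmetric]) (use ca cg in \<open>auto simp: mat_adjoint_def\<close>)
    also have "\<dots> = \<sigma> g" using unitary_rep_adjoint[OF \<sigma> a] cg by simp
    finally have 1: "(\<Sum>r<?m. cnj (\<sigma> a $$ (r, k)) * \<sigma> (a ** g) $$ (r, l)) = \<sigma> g $$ (k, l)" .
    have 2: "\<pi> (a ** g) $$ (i, j) = (\<Sum>r<?n. \<pi> a $$ (i, r) * \<pi> g $$ (r, j))"
      unfolding unitary_rep_mult[OF \<pi> a g] by (rule mult_mat_index) (use ca cg ik j in auto)
    show ?thesis unfolding F_def 1 2 by (simp add: sum_distrib_right mult.assoc)
  qed
  have "(A * \<sigma> a) $$ (i, k) = (\<Sum>r<?m. A $$ (i, r) * \<sigma> a $$ (r, k))"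
    by (rule mult_mat_index[OF A ca(2) ik])
  also have "\<dots> = (\<Sum>r<?m. LINT g|\<mu>. \<pi> g $$ (i, j) * cnj (\<sigma> g $$ (r, l)) * \<sigma> a $$ (r, k))"
    using ik by (intro sum.cong refl) (simp add: Ai)
  also have "\<dots> = (LINT g|\<mu>. (\<Sum>r<?m. \<pi> g $$ (i, j) * cnj (\<sigma> g $$ (r, l)) * \<sigma> a $$ (r, k)))"
    using integrable_coeff_product[OF \<mu> \<pi> \<sigma>] ik j l
    by (intro Bochner_Integration.integral_sum[symmetric] integrable_mult_left) auto
  also have "\<dots> = (LINT g|\<mu>. F g)"
    by (simp add: F_def sum_distrib_left mult_ac)
  also have "\<dots> = (LINT g|\<mu>. F (a ** g))" by (rule haar_integral_translate[OF \<mu> a contF])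
  also have "\<dots> = (LINT g|\<mu>. (\<Sum>r<?n. \<pi> a $$ (i, r) * (\<pi> g $$ (r, j) * cnj (\<sigma> g $$ (k, l)))))"
    by (rule Bochner_Integration.integral_cong) (use F_shift space_haar[OF \<mu>] in auto)
  also have "\<dots> = (\<Sum>r<?n. LINT g|\<mu>. \<pi> a $$ (i, r) * (\<pi> g $$ (r, j) * cnj (\<sigma> g $$ (k, l))))"
    using integrable_coeff_product[OF \<mu> \<pi> \<sigma>] ik j l
    by (intro Bochner_Integration.integral_sum integrable_mult_right) auto
  also have "\<dots> = (\<Sum>r<?n. \<pi> a $$ (i, r) * A $$ (r, k))"
    using ik by (intro sum.cong refl) (simp add: Ai)
  also have "\<dots> = (\<pi> a * A) $$ (i, k)"
    by (rule mult_mat_index[symmetric, OF ca(1) A ik])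
  finally show "(\<pi> a * A) $$ (i, k) = (A * \<sigma> a) $$ (i, k)" by simp
qed

lemma subspace_class_ringI:
  fixes W :: "complex Matrix.vec set"
  assumes "W \<subseteq> carrier_vec n" "0\<^sub>v n \<in> W"
    "\<And>v w. v \<in> W \<Longrightarrow> w \<in> W \<Longrightarrow> v + w \<in> W" "\<And>c v. v \<in> W \<Longrightarrow> c \<cdot>\<^sub>v v \<in> W"
  shows "VectorSpace.subspace class_ring W (module_vec TYPE(complex) n)"
  using assms
  by (auto simp: VectorSpace.subspace_def submodule_def vec_vs vec_module module_vec_simps)

lemma mult_mat_unit_vec_index:
  fixes A :: "complex Matrix.mat"
  assumes "A \<in> carrier_mat n m" "i < n" "j < m"
  shows "(A *\<^sub>v unit_vec m j) $ i = A $$ (i, j)"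
  using assms by simp

text \<open>
  A right inverse \<open>B\<close> exists by surjectivity; injectivity makes it a left inverse. Comparing the traces of
  \<open>A * B\<close> and \<open>B * A\<close> shows that the dimensions agree.
\<close>

lemma injective_surjective_mat_invertible:
  fixes A :: "complex Matrix.mat"
  assumes A: "A \<in> carrier_mat n m"
    and inj: "\<And>w. w \<in> carrier_vec m \<Longrightarrow> A *\<^sub>v w = 0\<^sub>v n \<Longrightarrow> w = 0\<^sub>v m"
    and surj: "\<And>v. v \<in> carrier_vec n \<Longrightarrow> \<exists>w\<in>carrier_vec m. A *\<^sub>v w = v"
  shows "n = m" and "invertible_mat A"
proof -
  have "\<forall>i. \<exists>w. i < n \<longrightarrow> w \<in> carrier_vec m \<and> A *\<^sub>v w = unit_vec n i"
    using surj unit_vec_carrier by blast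
  then obtain b where b: "\<And>i. i < n \<Longrightarrow> b i \<in> carrier_vec m" "\<And>i. i < n \<Longrightarrow> A *\<^sub>v b i = unit_vec n i"
    by metis
  define B where "B = Matrix.mat m n (\<lambda>(i, j). b j $ i)"
  have B: "B \<in> carrier_mat m n" by (simp add: B_def)
  have colB: "col B j = b j" if "j < n" for j using b(1)[OF that] that by (auto simp: B_def intro!: eq_vecI)
  have AB: "A * B = 1\<^sub>m n"
  proof (rule eq_matI)
    fix i j assume ij: "i < dim_row (1\<^sub>m n)" "j < dim_col (1\<^sub>m n :: complex Matrix.mat)"
    then have "(A * B) $$ (i, j) = (A *\<^sub>v b j) $ i"
      using A B colB by simp
    then show "(A * B) $$ (i, j) = 1\<^sub>m n $$ (i, j)" using b(2) ij by simp
  qed (use A B in auto)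
  have BA: "B * A = 1\<^sub>m m"
  proof (rule eq_matI)
    fix i j assume ij: "i < dim_row (1\<^sub>m m)" "j < dim_col (1\<^sub>m m :: complex Matrix.mat)"
    let ?w = "(B * A) *\<^sub>v unit_vec m j - unit_vec m j"
    have BAc: "B * A \<in> carrier_mat m m" using A B by simp
    then have w: "?w \<in> carrier_vec m" by simp
    have "A *\<^sub>v ((B * A) *\<^sub>v unit_vec m j) = (A * (B * A)) *\<^sub>v unit_vec m j"
      by (rule assoc_mult_mat_vec[symmetric]) (use A BAc in auto)
    also have "A * (B * A) = A" using assoc_mult_mat[OF A B A] AB A by simp
    finally have "A *\<^sub>v ?w = 0\<^sub>v n"
      using A BAc by (subst mult_minus_distrib_mat_vec) auto
    then have "?w = 0\<^sub>v m" by (rule inj[OF w])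
    then have "((B * A) *\<^sub>v unit_vec m j) $ i = (unit_vec m j :: complex Matrix.vec) $ i"
      using ij BAc by (metis (no_types, lifting) index_minus_vec(1) index_unit_vec(3) index_zero_vec(1) index_one_mat(2) right_minus_eq)
    moreover have "((B * A) *\<^sub>v unit_vec m j) $ i = (B * A) $$ (i, j)"
      using ij by (intro mult_mat_unit_vec_index[OF BAc]) auto
    ultimately show "(B * A) $$ (i, j) = 1\<^sub>m m $$ (i, j)" using ij by simp
  qed (use A B in auto)
  have "(\<Sum>i<n. (A * B) $$ (i, i)) = (\<Sum>i<n. \<Sum>r<m. A $$ (i, r) * B $$ (r, i))"
    by (intro sum.cong refl mult_mat_index[OF A B]) auto
  also have "\<dots> = (\<Sum>r<m. \<Sum>i<n. B $$ (r, i) * A $$ (i, r))"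
    by (subst sum.swap) (simp add: mult.commute)
  also have "\<dots> = (\<Sum>r<m. (B * A) $$ (r, r))"
    by (intro sum.cong refl mult_mat_index[OF B A, symmetric]) auto
  finally have "of_nat n = (of_nat m :: complex)" by (simp add: AB BA)
  then show nm: "n = m" by simp
  show "invertible_mat A"
    unfolding invertible_mat_def inverts_mat_def using A B AB BA nm by auto
qed

text \<open>
  Schur's lemma: the kernel and the range of an intertwiner are invariant subspaces. By irreducibility a
  non-zero intertwiner is injective and surjective, hence an equivalence.
\<close>

lemma intertwiner_inequivalent_zero:
  fixes \<pi> \<sigma> :: "'n::finite rep"
  assumes \<pi>: "irreducible_rep \<pi>" and \<sigma>: "irreducible_rep \<sigma>" and neq: "\<not> equivalent_rep \<sigma> \<pi>"
    and A: "A \<in> carrier_mat (degree_rep \<pi>) (degree_rep \<sigma>)"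
    and inter: "\<And>a. a \<in> SO \<Longrightarrow> \<pi> a * A = A * \<sigma> a"
    and w: "w \<in> carrier_vec (degree_rep \<sigma>)"
  shows "A *\<^sub>v w = 0\<^sub>v (degree_rep \<pi>)"
proof (rule ccontr)
  assume nz: "A *\<^sub>v w \<noteq> 0\<^sub>v (degree_rep \<pi>)"
  let ?n = "degree_rep \<pi>" and ?m = "degree_rep \<sigma>"
  have u: "unitary_rep \<pi>" "unitary_rep \<sigma>" using \<pi> \<sigma> by (auto simp: irreducible_rep_def)
  have act: "\<pi> a *\<^sub>v (A *\<^sub>v v) = A *\<^sub>v (\<sigma> a *\<^sub>v v)" if "a \<in> SO" "v \<in> carrier_vec ?m" for a v
  proof -
    have "\<pi> a *\<^sub>v (A *\<^sub>v v) = (\<pi> a * A) *\<^sub>v v"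
      by (rule assoc_mult_mat_vec[symmetric]) (use unitary_rep_carrier[OF u(1) that(1)] A that in auto)
    also have "\<dots> = A *\<^sub>v (\<sigma> a *\<^sub>v v)"
      unfolding inter[OF that(1)]
      by (rule assoc_mult_mat_vec) (use unitary_rep_carrier[OF u(2) that(1)] A that in auto)
    finally show ?thesis .
  qed
  define K where "K = {v \<in> carrier_vec ?m. A *\<^sub>v v = 0\<^sub>v ?n}"
  have "VectorSpace.subspace class_ring K (module_vec TYPE(complex) ?m)"
  proof (rule subspace_class_ringI)
    show "c \<cdot>\<^sub>v v \<in> K" if "v \<in> K" for c v
      using that A by (auto simp: K_def mult_mat_vec)
    show "v + v' \<in> K" if "v \<in> K" "v' \<in> K" for v v'
      using that A by (auto simp: K_def mult_add_distrib_mat_vec)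
  qed (use A in \<open>auto simp: K_def\<close>)
  moreover have "\<forall>a\<in>SO. \<forall>v\<in>K. \<sigma> a *\<^sub>v v \<in> K"
  proof (intro ballI)
    fix a :: "'n sqmat" and v assume a: "a \<in> SO" and v: "v \<in> K"
    have "\<pi> a *\<^sub>v 0\<^sub>v ?n = 0\<^sub>v ?n" using unitary_rep_carrier[OF u(1) a] by auto
    then show "\<sigma> a *\<^sub>v v \<in> K"
      using act[OF a, of v] v unitary_rep_carrier[OF u(2) a] by (auto simp: K_def)
  qed
  ultimately have "K = {0\<^sub>v ?m} \<or> K = carrier_vec ?m" using \<sigma> unfolding irreducible_rep_def by blast
  then have K0: "K = {0\<^sub>v ?m}" using nz w by (auto simp: K_def)
  define R where "R = (\<lambda>v. A *\<^sub>v v) ` carrier_vec ?m"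
  have "VectorSpace.subspace class_ring R (module_vec TYPE(complex) ?n)"
  proof (rule subspace_class_ringI)
    show "c \<cdot>\<^sub>v v \<in> R" if "v \<in> R" for c v
    proof -
      from that obtain x where x: "x \<in> carrier_vec ?m" "v = A *\<^sub>v x" unfolding R_def by blast
      then have "c \<cdot>\<^sub>v v = A *\<^sub>v (c \<cdot>\<^sub>v x)" using mult_mat_vec[OF A] by simp
      moreover have "c \<cdot>\<^sub>v x \<in> carrier_vec ?m" using x by simp
      ultimately show ?thesis unfolding R_def by blast
    qed
    show "v + v' \<in> R" if "v \<in> R" "v' \<in> R" for v v'
    proof -
      from that(1) obtain x where x: "x \<in> carrier_vec ?m" "v = A *\<^sub>v x" unfolding R_def by blast
      from that(2) obtain x' where x': "x' \<in> carrier_vec ?m" "v' = A *\<^sub>v x'" unfolding R_def by blast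
      have "v + v' = A *\<^sub>v (x + x')"
        unfolding x(2) x'(2) by (rule mult_add_distrib_mat_vec[OF A x(1) x'(1), symmetric])
      moreover have "x + x' \<in> carrier_vec ?m" using x x' by simp
      ultimately show ?thesis unfolding R_def by blast
    qed
    have "0\<^sub>v ?n = A *\<^sub>v 0\<^sub>v ?m" using A by auto
    then show "0\<^sub>v ?n \<in> R" using zero_carrier_vec[of ?m] unfolding R_def by (rule image_eqI)
    show "R \<subseteq> carrier_vec ?n" unfolding R_def by (intro image_subsetI mult_mat_vec_carrier[OF A])
  qed
  moreover have "\<forall>a\<in>SO. \<forall>v\<in>R. \<pi> a *\<^sub>v v \<in> R"
  proof (intro ballI)
    fix a :: "'n sqmat" and v assume a: "a \<in> SO" and "v \<in> R"
    then obtain x where x: "x \<in> carrier_vec ?m" "v = A *\<^sub>v x" unfolding R_def by blast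
    have "\<sigma> a *\<^sub>v x \<in> carrier_vec ?m" by (rule mult_mat_vec_carrier[OF unitary_rep_carrier[OF u(2) a] x(1)])
    then show "\<pi> a *\<^sub>v v \<in> R" unfolding x(2) act[OF a x(1)] R_def by (rule imageI)
  qed
  ultimately have "R = {0\<^sub>v ?n} \<or> R = carrier_vec ?n" using \<pi> unfolding irreducible_rep_def by blast
  moreover have "A *\<^sub>v w \<in> R" unfolding R_def using w by (rule imageI)
  ultimately have R: "R = carrier_vec ?n" using nz by blast
  have inj: "v = 0\<^sub>v ?m" if "v \<in> carrier_vec ?m" "A *\<^sub>v v = 0\<^sub>v ?n" for v
    using that K0 by (auto simp: K_def)
  have surj: "\<exists>v\<in>carrier_vec ?m. A *\<^sub>v v = v'" if "v' \<in> carrier_vec ?n" for v'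
    using that unfolding R[symmetric] R_def by blast
  have nm: "?n = ?m" and "invertible_mat A"
    using injective_surjective_mat_invertible[OF A inj surj] by auto
  then have "equivalent_rep \<sigma> \<pi>"
    unfolding equivalent_rep_def using A inter by (auto intro!: bexI[of _ A])
  with neq show False by simp
qed

text \<open>
  The integral is an entry of an averaged intertwiner, which is zero by Schur's lemma.
\<close>

lemma coeff_orthogonal_inequivalent:
  fixes \<pi> \<sigma> :: "'n::finite rep"
  assumes \<mu>: "normalized_haar \<mu>" and \<pi>: "irreducible_rep \<pi>" and \<sigma>: "irreducible_rep \<sigma>"
    and neq: "\<not> equivalent_rep \<sigma> \<pi>"
    and ij: "i < degree_rep \<pi>" "j < degree_rep \<pi>" and kl: "k < degree_rep \<sigma>" "l < degree_rep \<sigma>"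
  shows "(LINT g|\<mu>. \<pi> g $$ (i, j) * cnj (\<sigma> g $$ (k, l))) = 0"
proof -
  define A where "A = Matrix.mat (degree_rep \<pi>) (degree_rep \<sigma>)
                 (\<lambda>(i, k). LINT g|\<mu>. \<pi> g $$ (i, j) * cnj (\<sigma> g $$ (k, l)))"
  have u: "unitary_rep \<pi>" "unitary_rep \<sigma>" using \<pi> \<sigma> by (auto simp: irreducible_rep_def)
  have A: "A \<in> carrier_mat (degree_rep \<pi>) (degree_rep \<sigma>)" by (simp add: A_def)
  have "A *\<^sub>v unit_vec (degree_rep \<sigma>) k = 0\<^sub>v (degree_rep \<pi>)"
    by (rule intertwiner_inequivalent_zero[OF \<pi> \<sigma> neq A])
       (use haar_average_intertwines[OF \<mu> u ij(2) kl(2)] in \<open>auto simp: A_def\<close>)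
  then have "(A *\<^sub>v unit_vec (degree_rep \<sigma>) k) $ i = 0" using ij by simp
  moreover have "(A *\<^sub>v unit_vec (degree_rep \<sigma>) k) $ i = A $$ (i, k)"
    by (rule mult_mat_unit_vec_index[OF A ij(1) kl(1)])
  ultimately show ?thesis using ij kl by (simp add: A_def)
qed

text \<open>
  A member of the dual is equivalent to itself, so it is the unique representative of its class.
\<close>

lemma unitary_dual_inequivalent:
  assumes P: "unitary_dual P" and "\<pi> \<in> P" "\<sigma> \<in> P" "\<pi> \<noteq> \<sigma>"
  shows "\<not> equivalent_rep \<sigma> \<pi>"
proof
  assume "equivalent_rep \<sigma> \<pi>"
  have irr: "irreducible_rep \<sigma>" using P assms(3) by (simp add: unitary_dual_def)
  have "equivalent_rep \<sigma> \<sigma>"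
    unfolding equivalent_rep_def
  proof (intro conjI bexI[of _ "1\<^sub>m (degree_rep \<sigma>)"] refl ballI)
    show "invertible_mat (1\<^sub>m (degree_rep \<sigma>) :: complex Matrix.mat)"
      unfolding invertible_mat_def inverts_mat_def
      by (auto intro!: exI[of _ "1\<^sub>m (degree_rep \<sigma>)"])
    fix k :: "real^'a^'a" assume "k \<in> SO"
    then have "\<sigma> k \<in> carrier_mat (degree_rep \<sigma>) (degree_rep \<sigma>)"
      using irr unitary_rep_carrier by (auto simp: irreducible_rep_def)
    then show "1\<^sub>m (degree_rep \<sigma>) * \<sigma> k = \<sigma> k * 1\<^sub>m (degree_rep \<sigma>)" by simp
  qed auto
  moreover have "\<exists>!\<rho>. \<rho> \<in> P \<and> equivalent_rep \<sigma> \<rho>" using P irr by (simp add: unitary_dual_def)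
  ultimately show False using assms \<open>equivalent_rep \<sigma> \<pi>\<close> by blast
qed

section \<open>Functions on the motion group\<close>

lemma continuous_AE_zero_imp_zero:
  fixes F :: "'a::euclidean_space \<Rightarrow> complex"
  assumes cont: "continuous_on UNIV F" and ae: "AE x in lborel. F x = 0"
  shows "F x = 0"
proof (rule ccontr)
  assume nz: "F x \<noteq> 0"
  let ?S = "{x. F x \<noteq> 0}"
  have op: "open ?S" by (rule open_Collect_neq[OF cont continuous_on_const])
  have "?S \<in> null_sets lborel"
    using ae op by (subst (asm) AE_iff_null) auto
  then have "?S \<in> null_sets lebesgue" using op by (simp add: null_sets_completion_iff)
  then show False using open_not_negligible[OF op] nz by (auto simp: negligible_iff_null_sets)
qed

text \<open>
  Haar measure charges every non-empty open set: countably many translates of such a set cover the group, and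
  all of them have the same measure.
\<close>

lemma haar_AE_zero_imp_zero:
  fixes F :: "real^'n^'n \<Rightarrow> complex"
  assumes \<mu>: "normalized_haar \<mu>" and cont: "continuous_on SO F"
    and ae: "AE g in \<mu>. F g = 0" and k0: "k0 \<in> SO"
  shows "F k0 = 0"
proof (rule ccontr)
  assume nz: "F k0 \<noteq> 0"
  interpret prob_space \<mu> using \<mu> by (simp add: normalized_haar_def)
  have "openin (top_of_set SO) (SO \<inter> F -` (- {0}))"
    by (rule continuous_openin_preimage_gen[OF cont]) auto
  then obtain T where T: "open T" "SO \<inter> F -` (- {0}) = SO \<inter> T" by (auto simp: openin_open)
  define W where "W a = (\<lambda>k. a ** k) -` T" for a :: "real^'n^'n"
  have opW: "open (W a)" for a
  proof -
    have "continuous_on UNIV (\<lambda>k. a ** k)"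
      unfolding matrix_matrix_mult_def by (intro continuous_intros continuous_on_vec_lambda)
    then show ?thesis unfolding W_def by (rule open_vimage[OF T(1)])
  qed
  have cover: "SO \<subseteq> \<Union> (W ` SO)"
  proof
    fix k :: "real^'n^'n" assume k: "k \<in> SO"
    let ?k' = "Finite_Cartesian_Product.transpose k"
    have "?k' \<in> SO" using k by (simp add: SO_def)
    then have "k0 ** ?k' \<in> SO" by (rule SO_closed_mult[OF k0])
    moreover have "(k0 ** ?k') ** k = k0"
      using k by (simp add: SO_def orthogonal_matrix flip: matrix_mul_assoc)
    moreover have "k0 \<in> T" using T(2) k0 nz by auto
    ultimately have "k0 ** ?k' \<in> SO" "k \<in> W (k0 ** ?k')" by (simp_all add: W_def)
    then show "k \<in> \<Union> (W ` SO)" by blast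
  qed
  obtain \<F> where \<F>: "\<F> \<subseteq> W ` SO" "countable \<F>" "\<Union>\<F> = \<Union> (W ` SO)"
    using Lindelof[of "W ` SO"] opW by blast
  obtain I where I: "I \<subseteq> SO" "countable I" "\<F> = W ` I"
    using \<F>(1,2) by (metis countable_subset_image)
  have "AE k in \<mu>. F (a ** k) = 0" if "a \<in> I" for a
  proof -
    have a: "a \<in> SO" using that I by auto
    have "distr \<mu> \<mu> (\<lambda>k. a ** k) = \<mu>" using \<mu> a unfolding normalized_haar_def by blast
    then have "AE k in distr \<mu> \<mu> (\<lambda>k. a ** k). F k = 0" using ae by (simp only:)
    moreover have "{k \<in> space \<mu>. F k = 0} \<in> sets \<mu>"
      using borel_measurable_haar[OF \<mu> cont] by measurable
    ultimately show ?thesis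
      using AE_distr_iff[OF measurable_haar_translate[OF \<mu> a]] by simp
  qed
  then have "AE k in \<mu>. \<forall>a\<in>I. F (a ** k) = 0"
    using I(2) by (simp add: AE_ball_countable)
  then have "AE k in \<mu>. False"
  proof (rule AE_mp[OF _ AE_I2], intro impI)
    fix k assume "k \<in> space \<mu>" and all: "\<forall>a\<in>I. F (a ** k) = 0"
    then have k: "k \<in> SO" by (simp add: space_haar[OF \<mu>])
    have "k \<in> \<Union> (W ` I)"
      unfolding I(3)[symmetric] \<F>(3) by (rule subsetD[OF cover k])
    then obtain a where a: "a \<in> I" "a ** k \<in> T" by (auto simp: W_def)
    have "a ** k \<in> SO" using a k I SO_closed_mult by blast
    then show False using a T(2) all by blast
  qed
  then show False by (simp add: AE_False)
qed

lemma smooth_motion_continuous: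
  assumes "smooth_motion v"
  shows "continuous_on motion_group v"
proof -
  from assms obtain U F where U: "open U" "motion_group \<subseteq> U" "\<forall>m. Ck_on m U F" "\<forall>g\<in>motion_group. F g = v g"
    by (auto simp: smooth_motion_def)
  have "Ck_on 0 U F" using U by blast
  then have "continuous_on motion_group F" using U(2) by (auto intro: continuous_on_subset)
  then show ?thesis using U(4) by (simp cong: continuous_on_cong)
qed

text \<open>
  Cutting the ambient smooth extension off outside its open domain gives a Borel function that agrees with
  \<open>v\<close> on the group.
\<close>

lemma smooth_motion_measurable:
  fixes v :: "'n::finite motion \<Rightarrow> complex"
  assumes \<mu>: "normalized_haar \<mu>" and v: "smooth_motion v"
  shows "v \<in> borel_measurable (motion_haar \<mu>)"
proof -
  from v obtain U F where U: "open U" "motion_group \<subseteq> U" "\<forall>m. Ck_on m U F" "\<forall>g\<in>motion_group. F g = v g"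
    by (auto simp: smooth_motion_def)
  have "Ck_on 0 U F" using U by blast
  then have F: "(\<lambda>g. indicator U g *\<^sub>R F g) \<in> borel_measurable borel"
    using U(1) by (intro borel_measurable_continuous_on_indicator) auto
  have [measurable]: "(\<lambda>k. k) \<in> measurable \<mu> borel"
    by (rule borel_measurable_haar[OF \<mu>]) (rule continuous_on_id)
  have "(\<lambda>g. (fst g, snd g)) \<in> measurable (motion_haar \<mu>) (borel \<Otimes>\<^sub>M borel)"
    unfolding motion_haar_def by measurable
  then have id: "(\<lambda>g. g) \<in> measurable (motion_haar \<mu>) borel" by (simp add: borel_prod)
  have "(\<lambda>g. indicator U g *\<^sub>R F g) \<in> borel_measurable (motion_haar \<mu>)"
    using measurable_compose[OF id F] by simp
  moreover have "indicator U g *\<^sub>R F g = v g" if "g \<in> space (motion_haar \<mu>)" for g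
  proof -
    have "g \<in> motion_group"
      using that by (auto simp: motion_haar_def space_pair_measure space_haar[OF \<mu>] motion_group_def)
    then show ?thesis using U by auto
  qed
  ultimately show ?thesis by (simp cong: measurable_cong)
qed

lemma continuous_on_motion_slice1:
  "continuous_on motion_group v \<Longrightarrow> continuous_on SO (\<lambda>k. v (x, k))"
  by (rule continuous_on_compose2[of motion_group v]) (auto simp: motion_group_def intro!: continuous_intros)

lemma continuous_on_motion_slice2:
  "continuous_on motion_group v \<Longrightarrow> k \<in> SO \<Longrightarrow> continuous_on UNIV (\<lambda>x. v (x, k))"
  by (rule continuous_on_compose2[of motion_group v]) (auto simp: motion_group_def intro!: continuous_intros)

lemma coeff_fun_le:
  fixes \<pi> :: "'n::finite rep"
  assumes \<mu>: "normalized_haar \<mu>" and \<pi>: "unitary_rep \<pi>" and ij: "i < degree_rep \<pi>" "j < degree_rep \<pi>"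
    and v: "continuous_on motion_group v" and le: "\<And>k. k \<in> SO \<Longrightarrow> cmod (v (x, k)) \<le> B"
  shows "cmod (coeff_fun \<mu> \<pi> i j v x) \<le> B"
proof -
  interpret prob_space \<mu> using \<mu> by (simp add: normalized_haar_def)
  have le': "cmod (v (x, k) * cnj (\<pi> k $$ (i, j))) \<le> B" if "k \<in> SO" for k
  proof -
    have "cmod (v (x, k)) * cmod (\<pi> k $$ (i, j)) \<le> B * 1"
      using le[OF that] rep_coeff_le_one[OF \<pi> that ij]
      by (intro mult_mono) (auto intro: order_trans[OF norm_ge_zero])
    then show ?thesis by (simp add: norm_mult)
  qed
  have "cmod (coeff_fun \<mu> \<pi> i j v x) \<le> (LINT k|\<mu>. B)"
    unfolding coeff_fun_def
  proof (rule Bochner_Integration.integral_norm_bound_integral)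
    show "integrable \<mu> (\<lambda>k. v (x, k) * cnj (\<pi> k $$ (i, j)))"
      by (rule haar_integrable_bounded[OF \<mu> _ le'])
         (intro continuous_intros continuous_on_motion_slice1 v continuous_on_rep \<pi> ij)
  qed (use le' in \<open>auto simp: space_haar[OF \<mu>]\<close>)
  then show ?thesis by (simp add: prob_space)
qed

lemma continuous_coeff_fun:
  fixes \<pi> :: "'n::finite rep"
  assumes \<mu>: "normalized_haar \<mu>" and \<pi>: "unitary_rep \<pi>" and ij: "i < degree_rep \<pi>" "j < degree_rep \<pi>"
    and v: "continuous_on motion_group v" and le: "\<And>g. g \<in> motion_group \<Longrightarrow> cmod (v g) \<le> B"
  shows "continuous_on UNIV (coeff_fun \<mu> \<pi> i j v)"
proof -
  interpret prob_space \<mu> using \<mu> by (simp add: normalized_haar_def)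
  have "(\<lambda>n. coeff_fun \<mu> \<pi> i j v (X n)) \<longlonglongrightarrow> coeff_fun \<mu> \<pi> i j v x" if X: "X \<longlonglongrightarrow> x" for X x
    unfolding coeff_fun_def
  proof (rule integral_dominated_convergence[where w = "\<lambda>_. B"])
    have meas: "(\<lambda>k. v (y, k) * cnj (\<pi> k $$ (i, j))) \<in> borel_measurable \<mu>" for y
      by (intro borel_measurable_haar[OF \<mu>] continuous_intros continuous_on_motion_slice1 v continuous_on_rep \<pi> ij)
    show "(\<lambda>k. v (x, k) * cnj (\<pi> k $$ (i, j))) \<in> borel_measurable \<mu>"
      "(\<lambda>k. v (X n, k) * cnj (\<pi> k $$ (i, j))) \<in> borel_measurable \<mu>" for n by (rule meas)+
    show "AE k in \<mu>. (\<lambda>n. v (X n, k) * cnj (\<pi> k $$ (i, j))) \<longlonglongrightarrow> v (x, k) * cnj (\<pi> k $$ (i, j))"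
    proof (rule AE_I2)
      fix k assume "k \<in> space \<mu>"
      then have "continuous_on UNIV (\<lambda>x. v (x, k))"
        using v by (intro continuous_on_motion_slice2) (simp_all add: space_haar[OF \<mu>])
      then have "(\<lambda>n. v (X n, k)) \<longlonglongrightarrow> v (x, k)"
        using X by (auto simp: continuous_on_eq_continuous_at intro: isCont_tendsto_compose)
      then show "(\<lambda>n. v (X n, k) * cnj (\<pi> k $$ (i, j))) \<longlonglongrightarrow> v (x, k) * cnj (\<pi> k $$ (i, j))"
        by (intro tendsto_intros)
    qed
    show "AE k in \<mu>. cmod (v (X n, k) * cnj (\<pi> k $$ (i, j))) \<le> B" for n
    proof (rule AE_I2)
      fix k assume "k \<in> space \<mu>"
      then have k: "k \<in> SO" by (simp add: space_haar[OF \<mu>])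
      have "cmod (v (X n, k)) \<le> B" using le k by (simp add: motion_group_def)
      then have "cmod (v (X n, k)) * cmod (\<pi> k $$ (i, j)) \<le> B * 1"
        using rep_coeff_le_one[OF \<pi> k ij]
        by (intro mult_mono) (auto intro: order_trans[OF norm_ge_zero])
      then show "cmod (v (X n, k) * cnj (\<pi> k $$ (i, j))) \<le> B" by (simp add: norm_mult)
    qed
  qed simp
  then show ?thesis
    by (auto simp: continuous_on_eq_continuous_at continuous_at_sequentially o_def)
qed

lemma compactly_supported_coeff_fun:
  fixes \<pi> :: "'n::finite rep"
  assumes \<mu>: "normalized_haar \<mu>" and \<pi>: "unitary_rep \<pi>" and ij: "i < degree_rep \<pi>" "j < degree_rep \<pi>"
    and f: "test_function f"
  shows "compactly_supported (coeff_fun \<mu> \<pi> i j f)"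
proof -
  have cont: "continuous_on motion_group f"
    using f by (intro smooth_motion_continuous) (simp add: test_function_def)
  from f obtain K where K: "compact K" "K \<subseteq> motion_group" "\<forall>g\<in>motion_group - K. f g = 0"
    by (auto simp: test_function_def)
  have "bounded (f ` K)"
    by (intro compact_imp_bounded compact_continuous_image continuous_on_subset[OF cont] K)
  then obtain M where M0: "\<And>g. g \<in> K \<Longrightarrow> cmod (f g) \<le> M" by (auto simp: bounded_iff)
  have M: "cmod (f g) \<le> max M 0" if "g \<in> motion_group" for g
    using M0[of g] K(3) that by (cases "g \<in> K") auto
  obtain r where r: "\<And>g. g \<in> K \<Longrightarrow> norm g \<le> r" using compact_imp_bounded[OF K(1)] by (auto simp: bounded_iff)
  have "coeff_fun \<mu> \<pi> i j f x = 0" if "norm x > r" for x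
  proof -
    have "f (x, k) = 0" if "k \<in> SO" for k
    proof -
      have "norm x \<le> norm (x, k)" by (simp add: norm_Pair real_le_rsqrt)
      then have "(x, k) \<notin> K" using r[of "(x, k)"] \<open>norm x > r\<close> by auto
      then show ?thesis using K(3) that by (auto simp: motion_group_def)
    qed
    then have "cmod (coeff_fun \<mu> \<pi> i j f x) \<le> 0" by (intro coeff_fun_le[OF \<mu> \<pi> ij cont]) auto
    then show ?thesis by simp
  qed
  moreover have "continuous_on UNIV (coeff_fun \<mu> \<pi> i j f)"
    by (rule continuous_coeff_fun[OF \<mu> \<pi> ij cont M])
  ultimately show ?thesis by (auto simp: compactly_supported_def)
qed


section \<open>The terms of the Schroedinger series\<close>

definition rep_phase :: "('n::finite) sqmat set \<Rightarrow> 'n rep \<Rightarrow> real \<Rightarrow> complex" where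
  "rep_phase E \<pi> t = of_real (1 / (2 * pi) ^ CARD('n)) * exp (- \<i> * of_real (t * eigenvalue_rep E \<pi>))"

lemma norm_rep_phase: "cmod (rep_phase E (\<pi> :: 'n::finite rep) t) = 1 / (2 * pi) ^ CARD('n)"
  by (simp add: rep_phase_def norm_mult norm_power norm_divide)

abbreviation coeff_indices :: "'n::finite rep \<Rightarrow> (nat \<times> nat) set" where
  "coeff_indices \<pi> \<equiv> {..<degree_rep \<pi>} \<times> {..<degree_rep \<pi>}"

text \<open>
  The eigenvalue contributes only a factor independent of \<open>x\<close>, so the series is built from free
  evolutions of the coefficient functions of \<open>f\<close>.
\<close>

lemma schroedinger_term_eq:
  "schroedinger_term \<mu> E f t \<pi> (x, k) = (\<Sum>p\<in>coeff_indices \<pi>.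
     rep_phase E \<pi> t * of_nat (degree_rep \<pi>) * free_evolution t (coeff_fun \<mu> \<pi> (fst p) (snd p) f) x * \<pi> k $$ p)"
proof -
  have "exp (- \<i> * of_real (t * ((norm \<xi>)\<^sup>2 + eigenvalue_rep E \<pi>))) * w * z =
      exp (- \<i> * of_real (t * eigenvalue_rep E \<pi>)) * (exp (- \<i> * of_real (t * (norm \<xi>)\<^sup>2)) * w * z)" for \<xi> :: "real^'a" and w z
    by (simp add: distrib_left right_diff_distrib exp_diff exp_minus field_simps flip: exp_add)
  then have "(LINT \<xi>|lborel. exp (- \<i> * of_real (t * ((norm \<xi>)\<^sup>2 + eigenvalue_rep E \<pi>))) *
      fourier (coeff_fun \<mu> \<pi> i j f) \<xi> * exp (\<i> * of_real (inner \<xi> x))) =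
      exp (- \<i> * of_real (t * eigenvalue_rep E \<pi>)) * free_evolution t (coeff_fun \<mu> \<pi> i j f) x" for i j
    unfolding free_evolution_def by (simp only: integral_mult_right_zero)
  then show ?thesis
    unfolding schroedinger_term_def
    by (simp add: sum.cartesian_product sum_distrib_left rep_phase_def case_prod_beta mult_ac)
qed

lemma integrable_schroedinger_coeff:
  fixes \<pi> \<sigma> :: "'n::finite rep"
  assumes \<mu>: "normalized_haar \<mu>" and u: "unitary_rep \<pi>" "unitary_rep \<sigma>"
    and kl: "k < degree_rep \<sigma>" "l < degree_rep \<sigma>"
  shows "integrable \<mu> (\<lambda>g. schroedinger_term \<mu> E f t \<pi> (x, g) * cnj (\<sigma> g $$ (k, l)))"
    and "coeff_fun \<mu> \<sigma> k l (schroedinger_term \<mu> E f t \<pi>) x = (\<Sum>p\<in>coeff_indices \<pi>.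
      rep_phase E \<pi> t * of_nat (degree_rep \<pi>) * free_evolution t (coeff_fun \<mu> \<pi> (fst p) (snd p) f) x *
      (LINT g|\<mu>. \<pi> g $$ p * cnj (\<sigma> g $$ (k, l))))"
proof -
  let ?c = "\<lambda>p. rep_phase E \<pi> t * of_nat (degree_rep \<pi>) * free_evolution t (coeff_fun \<mu> \<pi> (fst p) (snd p) f) x"
  have eq: "schroedinger_term \<mu> E f t \<pi> (x, g) * cnj (\<sigma> g $$ (k, l)) =
      (\<Sum>p\<in>coeff_indices \<pi>. ?c p * (\<pi> g $$ p * cnj (\<sigma> g $$ (k, l))))" for g
    by (simp add: schroedinger_term_eq sum_distrib_right mult.assoc)
  have int: "integrable \<mu> (\<lambda>g. ?c p * (\<pi> g $$ p * cnj (\<sigma> g $$ (k, l))))" if "p \<in> coeff_indices \<pi>" for p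
    using that integrable_coeff_product[OF \<mu> u _ _ kl] by (intro integrable_mult_right) auto
  show "integrable \<mu> (\<lambda>g. schroedinger_term \<mu> E f t \<pi> (x, g) * cnj (\<sigma> g $$ (k, l)))"
    unfolding eq by (rule Bochner_Integration.integrable_sum[OF int])
  have "coeff_fun \<mu> \<sigma> k l (schroedinger_term \<mu> E f t \<pi>) x =
      (LINT g|\<mu>. schroedinger_term \<mu> E f t \<pi> (x, g) * cnj (\<sigma> g $$ (k, l)))"
    by (rule coeff_fun_def)
  also have "\<dots> = (\<Sum>p\<in>coeff_indices \<pi>. LINT g|\<mu>. ?c p * (\<pi> g $$ p * cnj (\<sigma> g $$ (k, l))))"
    unfolding eq by (rule Bochner_Integration.integral_sum[OF int])
  finally show "coeff_fun \<mu> \<sigma> k l (schroedinger_term \<mu> E f t \<pi>) x = (\<Sum>p\<in>coeff_indices \<pi>.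
      ?c p * (LINT g|\<mu>. \<pi> g $$ p * cnj (\<sigma> g $$ (k, l))))"
    by (simp only: integral_mult_right_zero)
qed

lemma coeff_schroedinger_term_inequivalent:
  fixes \<pi> \<sigma> :: "'n::finite rep"
  assumes \<mu>: "normalized_haar \<mu>" and irr: "irreducible_rep \<pi>" "irreducible_rep \<sigma>"
    and neq: "\<not> equivalent_rep \<sigma> \<pi>" and kl: "k < degree_rep \<sigma>" "l < degree_rep \<sigma>"
  shows "coeff_fun \<mu> \<sigma> k l (schroedinger_term \<mu> E f t \<pi>) x = 0"
proof -
  have u: "unitary_rep \<pi>" "unitary_rep \<sigma>" using irr by (auto simp: irreducible_rep_def)
  have "(LINT g|\<mu>. \<pi> g $$ p * cnj (\<sigma> g $$ (k, l))) = 0" if "p \<in> coeff_indices \<pi>" for p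
    using that coeff_orthogonal_inequivalent[OF \<mu> irr neq _ _ kl] by (cases p) auto
  then show ?thesis
    by (simp add: integrable_schroedinger_coeff(2)[OF \<mu> u kl])
qed

text \<open>
  The pairing is a linear combination, with the inner products of the entries of \<open>\<pi>\<close> as weights, of free
  evolutions of coefficient functions of \<open>f\<close>. The weights do not depend on time, so the combination can
  be formed before the evolution.
\<close>

lemma coeff_schroedinger_term_free_evolution:
  fixes \<pi> :: "'n::finite rep"
  assumes \<mu>: "normalized_haar \<mu>" and u: "unitary_rep \<pi>" and kl: "k < degree_rep \<pi>" "l < degree_rep \<pi>"
    and f: "test_function f"
  obtains h where "compactly_supported h" "integrable lborel (fourier h)"
    "\<And>t x. coeff_fun \<mu> \<pi> k l (schroedinger_term \<mu> E f t \<pi>) x = rep_phase E \<pi> t * free_evolution t h x"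
proof -
  define F where "F p = regular_part (coeff_fun \<mu> \<pi> (fst p) (snd p) f)" for p
  define c where "c p = of_nat (degree_rep \<pi>) * (LINT g|\<mu>. \<pi> g $$ p * cnj (\<pi> g $$ (k, l)))" for p
  have cs: "compactly_supported (coeff_fun \<mu> \<pi> (fst p) (snd p) f)" if "p \<in> coeff_indices \<pi>" for p
    using that by (intro compactly_supported_coeff_fun[OF \<mu> u _ _ f]) auto
  have F: "compactly_supported (F p)" "integrable lborel (fourier (F p))"
    "free_evolution t (F p) x = free_evolution t (coeff_fun \<mu> \<pi> (fst p) (snd p) f) x"
    if "p \<in> coeff_indices \<pi>" for p t x
    using regular_part[OF cs[OF that]] by (simp_all add: F_def)
  define h where "h y = (\<Sum>p\<in>coeff_indices \<pi>. c p * F p y)" for y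
  have "compactly_supported h" unfolding h_def by (rule compactly_supported_sum) (use F in auto)
  moreover have "fourier h = (\<lambda>\<xi>. \<Sum>p\<in>coeff_indices \<pi>. c p * fourier (F p) \<xi>)"
    unfolding h_def using fourier_sum[OF F(1), of "coeff_indices \<pi>" "\<lambda>p. p" c] by auto
  then have "integrable lborel (fourier h)" using F(2) by auto
  moreover have "coeff_fun \<mu> \<pi> k l (schroedinger_term \<mu> E f t \<pi>) x = rep_phase E \<pi> t * free_evolution t h x" for t x
  proof -
    have "free_evolution t h x = (\<Sum>p\<in>coeff_indices \<pi>. c p * free_evolution t (F p) x)"
      unfolding h_def by (rule free_evolution_sum) (use F in auto)
    then show ?thesis
      by (simp add: integrable_schroedinger_coeff(2)[OF \<mu> u u kl] sum_distrib_left c_def F(3) mult_ac)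
  qed
  ultimately show ?thesis using that by blast
qed

lemma continuous_schroedinger_term_slice:
  assumes "unitary_rep \<pi>"
  shows "continuous_on SO (\<lambda>g. schroedinger_term \<mu> E f t \<pi> (x, g))"
  unfolding schroedinger_term_eq using assms
  by (intro continuous_intros) (auto intro: continuous_on_rep)

lemma schroedinger_term_bounded_slice:
  fixes \<pi> :: "'n::finite rep"
  assumes "unitary_rep \<pi>"
  obtains M where "\<And>g. g \<in> SO \<Longrightarrow> cmod (schroedinger_term \<mu> E f t \<pi> (x, g)) \<le> M"
proof -
  let ?c = "\<lambda>p. rep_phase E \<pi> t * of_nat (degree_rep \<pi>) * free_evolution t (coeff_fun \<mu> \<pi> (fst p) (snd p) f) x"
  have "cmod (schroedinger_term \<mu> E f t \<pi> (x, g)) \<le> (\<Sum>p\<in>coeff_indices \<pi>. cmod (?c p))" if g: "g \<in> SO" for g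
    unfolding schroedinger_term_eq
  proof (rule sum_norm_le)
    fix p assume "p \<in> coeff_indices \<pi>"
    then have "cmod (\<pi> g $$ p) \<le> 1" using rep_coeff_le_one[OF assms g] by (cases p) auto
    then have "cmod (?c p) * cmod (\<pi> g $$ p) \<le> cmod (?c p) * 1" by (intro mult_left_mono) auto
    then show "cmod (?c p * \<pi> g $$ p) \<le> cmod (?c p)" by (simp add: norm_mult)
  qed
  then show ?thesis using that by blast
qed

lemma schroedinger_term_measurable:
  fixes \<pi> :: "'n::finite rep"
  assumes \<mu>: "normalized_haar \<mu>" and u: "unitary_rep \<pi>" and f: "test_function f"
  shows "schroedinger_term \<mu> E f t \<pi> \<in> borel_measurable (motion_haar \<mu>)"
proof -
  have "(\<lambda>g. \<Sum>p\<in>coeff_indices \<pi>. rep_phase E \<pi> t * of_nat (degree_rep \<pi>) *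
      free_evolution t (coeff_fun \<mu> \<pi> (fst p) (snd p) f) (fst g) * \<pi> (snd g) $$ p)
      \<in> borel_measurable (motion_haar \<mu>)"
  proof (rule borel_measurable_sum)
    fix p assume p: "p \<in> coeff_indices \<pi>"
    let ?h = "coeff_fun \<mu> \<pi> (fst p) (snd p) f"
    have cs: "compactly_supported ?h"
      using p by (intro compactly_supported_coeff_fun[OF \<mu> u _ _ f]) auto
    have "continuous_on UNIV (free_evolution t (regular_part ?h))"
      by (rule continuous_free_evolution[OF regular_part(1,2)[OF cs]])
    then have "continuous_on UNIV (free_evolution t ?h)"
      using regular_part(3)[OF cs] by (simp cong: continuous_on_cong)
    then have [measurable]: "free_evolution t ?h \<in> borel_measurable borel"
      by (rule borel_measurable_continuous_onI)
    have [measurable]: "(\<lambda>g. \<pi> g $$ p) \<in> borel_measurable \<mu>"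
      using p by (cases p) (auto intro: borel_measurable_haar[OF \<mu>] continuous_on_rep[OF u])
    show "(\<lambda>g. rep_phase E \<pi> t * of_nat (degree_rep \<pi>) * free_evolution t ?h (fst g) * \<pi> (snd g) $$ p)
        \<in> borel_measurable (motion_haar \<mu>)"
      unfolding motion_haar_def by measurable
  qed
  also have "(\<lambda>g. \<Sum>p\<in>coeff_indices \<pi>. rep_phase E \<pi> t * of_nat (degree_rep \<pi>) *
      free_evolution t (coeff_fun \<mu> \<pi> (fst p) (snd p) f) (fst g) * \<pi> (snd g) $$ p) = schroedinger_term \<mu> E f t \<pi>"
    by (auto simp: fun_eq_iff schroedinger_term_eq)
  finally show ?thesis .
qed

text \<open>
  For fixed \<open>x\<close> the term is a linear combination of entries of \<open>\<pi>\<close>; being orthogonal to all of them, it is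
  orthogonal to itself.
\<close>

lemma schroedinger_term_AE_zero:
  fixes \<pi> :: "'n::finite rep"
  assumes \<mu>: "normalized_haar \<mu>" and u: "unitary_rep \<pi>"
    and zero: "\<And>k l. k < degree_rep \<pi> \<Longrightarrow> l < degree_rep \<pi> \<Longrightarrow>
      coeff_fun \<mu> \<pi> k l (schroedinger_term \<mu> E f t \<pi>) x = 0"
  shows "AE g in \<mu>. schroedinger_term \<mu> E f t \<pi> (x, g) = 0"
proof -
  define S where "S g = schroedinger_term \<mu> E f t \<pi> (x, g)" for g
  define c where "c p = rep_phase E \<pi> t * of_nat (degree_rep \<pi>) * free_evolution t (coeff_fun \<mu> \<pi> (fst p) (snd p) f) x" for p
  have S: "S g = (\<Sum>p\<in>coeff_indices \<pi>. c p * \<pi> g $$ p)" for g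
    unfolding S_def c_def schroedinger_term_eq ..
  have cont: "continuous_on SO S" unfolding S_def by (rule continuous_schroedinger_term_slice[OF u])
  obtain M where M: "\<And>g. g \<in> SO \<Longrightarrow> cmod (S g) \<le> M"
    unfolding S_def using schroedinger_term_bounded_slice[OF u] by blast
  have int: "integrable \<mu> (\<lambda>g. S g * cnj (S g))"
  proof (rule haar_integrable_bounded[OF \<mu>])
    show "continuous_on SO (\<lambda>g. S g * cnj (S g))" by (intro continuous_intros cont)
    show "cmod (S g * cnj (S g)) \<le> M * M" if "g \<in> SO" for g
      using M[OF that] by (auto simp: norm_mult intro!: mult_mono intro: order_trans[OF norm_ge_zero])
  qed
  have intsq: "integrable \<mu> (\<lambda>g. (cmod (S g))\<^sup>2)"
  proof -
    have "cmod (S g * cnj (S g)) = (cmod (S g))\<^sup>2" for g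
      by (simp only: norm_mult complex_mod_cnj power2_eq_square)
    then show ?thesis using integrable_norm[OF int] by (simp only:)
  qed
  have "(LINT g|\<mu>. S g * cnj (S g)) = (LINT g|\<mu>. (\<Sum>p\<in>coeff_indices \<pi>. cnj (c p) * (S g * cnj (\<pi> g $$ p))))"
    by (rule Bochner_Integration.integral_cong[OF refl], subst (2) S) (simp add: sum_distrib_left mult_ac)
  also have "\<dots> = (\<Sum>p\<in>coeff_indices \<pi>. LINT g|\<mu>. cnj (c p) * (S g * cnj (\<pi> g $$ p)))"
    using integrable_schroedinger_coeff(1)[OF \<mu> u u]
    by (intro Bochner_Integration.integral_sum integrable_mult_right) (auto simp: S_def)
  also have "\<dots> = 0"
  proof (rule sum.neutral, rule ballI)
    fix p assume "p \<in> coeff_indices \<pi>"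
    then have "(LINT g|\<mu>. S g * cnj (\<pi> g $$ p)) = 0"
      using zero[of "fst p" "snd p"] by (auto simp: coeff_fun_def S_def)
    then show "(LINT g|\<mu>. cnj (c p) * (S g * cnj (\<pi> g $$ p))) = 0" by simp
  qed
  also have "(LINT g|\<mu>. S g * cnj (S g)) = of_real (LINT g|\<mu>. (cmod (S g))\<^sup>2)"
    unfolding complex_norm_square[symmetric] of_real_power[symmetric] by (rule integral_of_real[OF intsq])
  finally have zero_int: "(LINT g|\<mu>. (cmod (S g))\<^sup>2) = 0" by simp
  have "AE g in \<mu>. (cmod (S g))\<^sup>2 = 0"
    using zero_int intsq by (subst integral_nonneg_eq_0_iff_AE[symmetric]) auto
  then show ?thesis by (simp add: S_def)
qed


section \<open>Limits of the series and uniqueness\<close>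

text \<open>
  The Cauchy--Schwarz inequality on the probability space \<open>SO(n)\<close>, for an entry of modulus at most one.
\<close>

lemma norm_coeff_square_le:
  fixes \<pi> :: "'n::finite rep" and D :: "'n sqmat \<Rightarrow> complex"
  assumes \<mu>: "normalized_haar \<mu>" and u: "unitary_rep \<pi>" and kl: "k < degree_rep \<pi>" "l < degree_rep \<pi>"
    and cont: "continuous_on SO D" and M: "\<And>g. g \<in> SO \<Longrightarrow> cmod (D g) \<le> M"
  shows "ennreal ((cmod (LINT g|\<mu>. D g * cnj (\<pi> g $$ (k, l))))\<^sup>2) \<le> (\<integral>\<^sup>+g. ennreal ((cmod (D g))\<^sup>2) \<partial>\<mu>)"
proof -
  interpret prob_space \<mu> using \<mu> by (simp add: normalized_haar_def)
  have le: "cmod (D g * cnj (\<pi> g $$ (k, l))) \<le> cmod (D g)" if "g \<in> SO" for g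
    using mult_left_mono[OF rep_coeff_le_one[OF u that kl], of "cmod (D g)"] by (simp add: norm_mult)
  have intD: "integrable \<mu> D" by (rule haar_integrable_bounded[OF \<mu> cont M])
  have M0: "M \<ge> 0" using M[OF SO_one] norm_ge_zero order_trans by blast
  have int2: "integrable \<mu> (\<lambda>g. (cmod (D g))\<^sup>2)"
  proof (rule integrable_const_bound[where B = "M\<^sup>2"])
    show "AE g in \<mu>. norm ((cmod (D g))\<^sup>2) \<le> M\<^sup>2"
      using M by (auto simp: space_haar[OF \<mu>] intro!: AE_I2 power_mono)
    show "(\<lambda>g. (cmod (D g))\<^sup>2) \<in> borel_measurable \<mu>"
      using borel_measurable_haar[OF \<mu> cont] by measurable
  qed
  define m where "m = (LINT g|\<mu>. cmod (D g))"
  have "integrable \<mu> (\<lambda>g. D g * cnj (\<pi> g $$ (k, l)))"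
  proof (rule haar_integrable_bounded[OF \<mu>])
    show "continuous_on SO (\<lambda>g. D g * cnj (\<pi> g $$ (k, l)))"
      by (intro continuous_intros cont continuous_on_rep u kl)
    show "cmod (D g * cnj (\<pi> g $$ (k, l))) \<le> M" if "g \<in> SO" for g
      using le[OF that] M[OF that] by simp
  qed
  then have "cmod (LINT g|\<mu>. D g * cnj (\<pi> g $$ (k, l))) \<le> m"
    unfolding m_def using intD le
    by (intro Bochner_Integration.integral_norm_bound_integral) (auto simp: space_haar[OF \<mu>])
  then have "(cmod (LINT g|\<mu>. D g * cnj (\<pi> g $$ (k, l))))\<^sup>2 \<le> m\<^sup>2" by (intro power_mono) auto
  also have "m\<^sup>2 \<le> (LINT g|\<mu>. (cmod (D g))\<^sup>2)"
    using variance_positive[of "\<lambda>g. cmod (D g)"] variance_eq[of "\<lambda>g. cmod (D g)"] intD int2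
    by (simp add: m_def)
  finally have "ennreal ((cmod (LINT g|\<mu>. D g * cnj (\<pi> g $$ (k, l))))\<^sup>2) \<le> ennreal (LINT g|\<mu>. (cmod (D g))\<^sup>2)"
    by (rule ennreal_leI)
  also have "\<dots> = (\<integral>\<^sup>+g. ennreal ((cmod (D g))\<^sup>2) \<partial>\<mu>)"
    by (rule nn_integral_eq_integral[symmetric, OF int2]) simp
  finally show ?thesis .
qed

lemma nn_integral_motion_haar:
  assumes \<mu>: "normalized_haar \<mu>" and "v \<in> borel_measurable (motion_haar \<mu>)"
  shows "(\<integral>\<^sup>+x. \<integral>\<^sup>+g. v (x, g) \<partial>\<mu> \<partial>lborel) = (\<integral>\<^sup>+g. v g \<partial>motion_haar \<mu>)"
proof -
  interpret prob_space \<mu> using \<mu> by (simp add: normalized_haar_def)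
  show ?thesis using assms(2) unfolding motion_haar_def by (rule nn_integral_fst)
qed

text \<open>
  The difference \<open>\<Delta>\<close> of the two sides is also the pairing of \<open>v\<close> minus any partial sum that contains the
  \<open>\<pi>\<close>-term, since the other terms are orthogonal to the entries of \<open>\<pi>\<close>. Its norm in \<open>L\<^sup>2(\<real>\<^sup>n)\<close> is thus
  at most the distance from \<open>v\<close> to the partial sums, which tends to zero. Continuity turns equality
  almost everywhere into equality at every point; the decay is later used along single lines, which
  may be null sets.
\<close>

lemma evolves_to_coeff:
  fixes v :: "'n::finite motion \<Rightarrow> complex"
  assumes \<mu>: "normalized_haar \<mu>" and P: "unitary_dual P" and f: "test_function f"
    and v: "smooth_motion v" and le: "\<And>g. g \<in> motion_group \<Longrightarrow> cmod (v g) \<le> C"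
    and ev: "evolves_to \<mu> E P f t v"
    and \<pi>: "\<pi> \<in> P" and kl: "k < degree_rep \<pi>" "l < degree_rep \<pi>"
  shows "coeff_fun \<mu> \<pi> k l v x = coeff_fun \<mu> \<pi> k l (schroedinger_term \<mu> E f t \<pi>) x"
proof -
  have irr: "irreducible_rep \<sigma>" if "\<sigma> \<in> P" for \<sigma> using P that by (simp add: unitary_dual_def)
  then have ur: "unitary_rep \<sigma>" if "\<sigma> \<in> P" for \<sigma> using that by (simp add: irreducible_rep_def)
  note u = ur[OF \<pi>]
  define S where "S = schroedinger_term \<mu> E f t"
  have contv: "continuous_on motion_group v" by (rule smooth_motion_continuous[OF v])
  define \<Delta> where "\<Delta> x = coeff_fun \<mu> \<pi> k l v x - coeff_fun \<mu> \<pi> k l (S \<pi>) x" for x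
  have cont\<Delta>: "continuous_on UNIV \<Delta>"
  proof -
    obtain h where h: "compactly_supported h" "integrable lborel (fourier h)"
      "\<And>t x. coeff_fun \<mu> \<pi> k l (schroedinger_term \<mu> E f t \<pi>) x = rep_phase E \<pi> t * free_evolution t h x"
      using coeff_schroedinger_term_free_evolution[OF \<mu> u kl f] by blast
    show ?thesis
      unfolding \<Delta>_def S_def h(3)
      by (intro continuous_intros continuous_coeff_fun[OF \<mu> u kl contv le] continuous_free_evolution h)
  qed
  have bound: "(\<integral>\<^sup>+x. ennreal ((cmod (\<Delta> x))\<^sup>2) \<partial>lborel) \<le> (\<integral>\<^sup>+g. ennreal ((cmod (v g - (\<Sum>\<sigma>\<in>F. S \<sigma> g)))\<^sup>2) \<partial>motion_haar \<mu>)"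
    if F: "finite F" "F \<subseteq> P" "\<pi> \<in> F" for F
  proof -
    have Sm: "S \<sigma> \<in> borel_measurable (motion_haar \<mu>)" if "\<sigma> \<in> F" for \<sigma>
      unfolding S_def using that F(2) by (intro schroedinger_term_measurable[OF \<mu> ur f]) auto
    have "(\<integral>\<^sup>+x. ennreal ((cmod (\<Delta> x))\<^sup>2) \<partial>lborel) \<le>
        (\<integral>\<^sup>+x. \<integral>\<^sup>+g. ennreal ((cmod (v (x, g) - (\<Sum>\<sigma>\<in>F. S \<sigma> (x, g))))\<^sup>2) \<partial>\<mu> \<partial>lborel)"
    proof (rule nn_integral_mono)
      fix x
      define D where "D g = v (x, g) - (\<Sum>\<sigma>\<in>F. S \<sigma> (x, g))" for g
      have contS: "continuous_on SO (\<lambda>g. S \<sigma> (x, g))" if "\<sigma> \<in> F" for \<sigma>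
        unfolding S_def using that F(2) by (intro continuous_schroedinger_term_slice ur) auto
      have contD: "continuous_on SO D"
        unfolding D_def by (intro continuous_intros continuous_on_motion_slice1 contv contS)
      have "\<forall>\<sigma>. \<exists>M. \<sigma> \<in> F \<longrightarrow> (\<forall>g\<in>SO. cmod (S \<sigma> (x, g)) \<le> M)"
        unfolding S_def using schroedinger_term_bounded_slice[OF ur] F(2) by (meson subsetD)
      then obtain M where M: "\<And>\<sigma> g. \<sigma> \<in> F \<Longrightarrow> g \<in> SO \<Longrightarrow> cmod (S \<sigma> (x, g)) \<le> M \<sigma>" by metis
      have leD: "cmod (D g) \<le> C + (\<Sum>\<sigma>\<in>F. M \<sigma>)" if "g \<in> SO" for g
      proof -
        have "cmod (v (x, g)) \<le> C" using le that by (simp add: motion_group_def)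
        moreover have "cmod (\<Sum>\<sigma>\<in>F. S \<sigma> (x, g)) \<le> (\<Sum>\<sigma>\<in>F. M \<sigma>)" by (rule sum_norm_le) (use M that in auto)
        ultimately show ?thesis unfolding D_def using norm_triangle_ineq4 by (smt (verit))
      qed
      have intS: "integrable \<mu> (\<lambda>g. S \<sigma> (x, g) * cnj (\<pi> g $$ (k, l)))" if "\<sigma> \<in> F" for \<sigma>
        unfolding S_def using that F(2) by (intro integrable_schroedinger_coeff(1)[OF \<mu> ur u kl]) auto
      have intv: "integrable \<mu> (\<lambda>g. v (x, g) * cnj (\<pi> g $$ (k, l)))"
      proof (rule haar_integrable_bounded[OF \<mu>])
        show "continuous_on SO (\<lambda>g. v (x, g) * cnj (\<pi> g $$ (k, l)))"
          by (intro continuous_intros continuous_on_motion_slice1 contv continuous_on_rep u kl)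
        show "cmod (v (x, g) * cnj (\<pi> g $$ (k, l))) \<le> C * 1" if "g \<in> SO" for g
          unfolding norm_mult complex_mod_cnj
          using le[of "(x, g)"] rep_coeff_le_one[OF u that kl] that
          by (intro mult_mono) (auto simp: motion_group_def intro: order_trans[OF norm_ge_zero])
      qed
      have orth: "coeff_fun \<mu> \<pi> k l (S \<sigma>) x = 0" if "\<sigma> \<in> F - {\<pi>}" for \<sigma>
      proof -
        have \<sigma>: "\<sigma> \<in> P" "\<sigma> \<noteq> \<pi>" using that F(2) by auto
        show ?thesis
          unfolding S_def using unitary_dual_inequivalent[OF P \<sigma>(1) \<pi> \<sigma>(2)]
          by (intro coeff_schroedinger_term_inequivalent[OF \<mu> irr irr _ kl] \<sigma> \<pi>)
      qed
      have "(LINT g|\<mu>. D g * cnj (\<pi> g $$ (k, l))) =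
          (LINT g|\<mu>. v (x, g) * cnj (\<pi> g $$ (k, l)) - (\<Sum>\<sigma>\<in>F. S \<sigma> (x, g) * cnj (\<pi> g $$ (k, l))))"
        by (simp add: D_def left_diff_distrib sum_distrib_right)
      also have "\<dots> = coeff_fun \<mu> \<pi> k l v x - (\<Sum>\<sigma>\<in>F. coeff_fun \<mu> \<pi> k l (S \<sigma>) x)"
        using intS intv by (simp add: coeff_fun_def)
      also have "(\<Sum>\<sigma>\<in>F. coeff_fun \<mu> \<pi> k l (S \<sigma>) x) = coeff_fun \<mu> \<pi> k l (S \<pi>) x"
        using F orth by (simp add: sum.remove[of F \<pi>])
      finally have "\<Delta> x = (LINT g|\<mu>. D g * cnj (\<pi> g $$ (k, l)))" by (simp add: \<Delta>_def)
      then show "ennreal ((cmod (\<Delta> x))\<^sup>2) \<le> (\<integral>\<^sup>+g. ennreal ((cmod (v (x, g) - (\<Sum>\<sigma>\<in>F. S \<sigma> (x, g))))\<^sup>2) \<partial>\<mu>)"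
        using norm_coeff_square_le[OF \<mu> u kl contD leD] by (simp add: D_def)
    qed
    also have "\<dots> = (\<integral>\<^sup>+g. ennreal ((cmod (v g - (\<Sum>\<sigma>\<in>F. S \<sigma> g)))\<^sup>2) \<partial>motion_haar \<mu>)"
    proof (rule nn_integral_motion_haar[OF \<mu>])
      have [measurable]: "v \<in> borel_measurable (motion_haar \<mu>)" by (rule smooth_motion_measurable[OF \<mu> v])
      have [measurable]: "(\<lambda>g. \<Sum>\<sigma>\<in>F. S \<sigma> g) \<in> borel_measurable (motion_haar \<mu>)"
        by (rule borel_measurable_sum) (rule Sm)
      show "(\<lambda>g. ennreal ((cmod (v g - (\<Sum>\<sigma>\<in>F. S \<sigma> g)))\<^sup>2)) \<in> borel_measurable (motion_haar \<mu>)"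
        by measurable
    qed
    finally show ?thesis .
  qed
  have "(\<integral>\<^sup>+x. ennreal ((cmod (\<Delta> x))\<^sup>2) \<partial>lborel) \<le> 0"
  proof (rule tendsto_lowerbound)
    show "((\<lambda>F. \<integral>\<^sup>+g. ennreal ((cmod (v g - (\<Sum>\<sigma>\<in>F. S \<sigma> g)))\<^sup>2) \<partial>motion_haar \<mu>) \<longlongrightarrow> 0) (finite_subsets_at_top P)"
      using ev by (simp add: evolves_to_def S_def)
    show "\<forall>\<^sub>F F in finite_subsets_at_top P. (\<integral>\<^sup>+x. ennreal ((cmod (\<Delta> x))\<^sup>2) \<partial>lborel) \<le>
        (\<integral>\<^sup>+g. ennreal ((cmod (v g - (\<Sum>\<sigma>\<in>F. S \<sigma> g)))\<^sup>2) \<partial>motion_haar \<mu>)"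
      unfolding eventually_finite_subsets_at_top using bound \<pi> by (intro exI[of _ "{\<pi>}"]) auto
  qed simp
  then have "(\<integral>\<^sup>+x. ennreal ((cmod (\<Delta> x))\<^sup>2) \<partial>lborel) = 0" by simp
  moreover have [measurable]: "\<Delta> \<in> borel_measurable borel" by (rule borel_measurable_continuous_onI[OF cont\<Delta>])
  ultimately have "AE x in lborel. ennreal ((cmod (\<Delta> x))\<^sup>2) = 0"
    by (subst (asm) nn_integral_0_iff_AE) auto
  then have "AE x in lborel. \<Delta> x = 0" by (simp add: ennreal_eq_0_iff)
  then have "\<Delta> x = 0" by (rule continuous_AE_zero_imp_zero[OF cont\<Delta>])
  then show ?thesis by (simp add: \<Delta>_def S_def)
qed

text \<open>
  All partial sums vanish almost everywhere, so the distance from \<open>v\<close> to them is the norm of \<open>v\<close>, for every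
  partial sum.
\<close>

lemma evolves_to_zero:
  fixes v :: "'n::finite motion \<Rightarrow> complex"
  assumes \<mu>: "normalized_haar \<mu>" and P: "unitary_dual P" and f: "test_function f"
    and v: "smooth_motion v" and ev: "evolves_to \<mu> E P f t v"
    and zero: "\<And>\<pi> x. \<pi> \<in> P \<Longrightarrow> AE g in \<mu>. schroedinger_term \<mu> E f t \<pi> (x, g) = 0"
    and g: "g \<in> motion_group"
  shows "v g = 0"
proof -
  have ur: "unitary_rep \<sigma>" if "\<sigma> \<in> P" for \<sigma> using P that by (simp add: unitary_dual_def irreducible_rep_def)
  define S where "S = schroedinger_term \<mu> E f t"
  have contv: "continuous_on motion_group v" by (rule smooth_motion_continuous[OF v])
  have mv [measurable]: "v \<in> borel_measurable (motion_haar \<mu>)" by (rule smooth_motion_measurable[OF \<mu> v])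
  have const: "(\<integral>\<^sup>+g. ennreal ((cmod (v g - (\<Sum>\<sigma>\<in>F. S \<sigma> g)))\<^sup>2) \<partial>motion_haar \<mu>) = (\<integral>\<^sup>+x. \<integral>\<^sup>+g. ennreal ((cmod (v (x, g)))\<^sup>2) \<partial>\<mu> \<partial>lborel)"
    if F: "finite F" "F \<subseteq> P" for F
  proof -
    have Sm: "S \<sigma> \<in> borel_measurable (motion_haar \<mu>)" if "\<sigma> \<in> F" for \<sigma>
      unfolding S_def using that F(2) by (intro schroedinger_term_measurable[OF \<mu> ur f]) auto
    have [measurable]: "(\<lambda>g. \<Sum>\<sigma>\<in>F. S \<sigma> g) \<in> borel_measurable (motion_haar \<mu>)"
      by (rule borel_measurable_sum) (rule Sm)
    have "(\<integral>\<^sup>+g. ennreal ((cmod (v g - (\<Sum>\<sigma>\<in>F. S \<sigma> g)))\<^sup>2) \<partial>motion_haar \<mu>) =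
       (\<integral>\<^sup>+x. \<integral>\<^sup>+g. ennreal ((cmod (v (x, g) - (\<Sum>\<sigma>\<in>F. S \<sigma> (x, g))))\<^sup>2) \<partial>\<mu> \<partial>lborel)"
      by (rule nn_integral_motion_haar[OF \<mu>, symmetric]) measurable
    also have "\<dots> = (\<integral>\<^sup>+x. \<integral>\<^sup>+g. ennreal ((cmod (v (x, g)))\<^sup>2) \<partial>\<mu> \<partial>lborel)"
    proof (rule nn_integral_cong, rule nn_integral_cong_AE)
      fix x
      have "AE g in \<mu>. \<forall>\<sigma>\<in>F. S \<sigma> (x, g) = 0"
        using F zero by (intro AE_finite_allI) (auto simp: S_def)
      then show "AE g in \<mu>. ennreal ((cmod (v (x, g) - (\<Sum>\<sigma>\<in>F. S \<sigma> (x, g))))\<^sup>2) = ennreal ((cmod (v (x, g)))\<^sup>2)"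
        by eventually_elim simp
    qed
    finally show ?thesis .
  qed
  have lim0: "((\<lambda>F. \<integral>\<^sup>+g. ennreal ((cmod (v g - (\<Sum>\<sigma>\<in>F. S \<sigma> g)))\<^sup>2) \<partial>motion_haar \<mu>) \<longlongrightarrow> 0) (finite_subsets_at_top P)"
    using ev by (simp add: evolves_to_def S_def)
  have "\<forall>\<^sub>F F in finite_subsets_at_top P. (\<integral>\<^sup>+g. ennreal ((cmod (v g - (\<Sum>\<sigma>\<in>F. S \<sigma> g)))\<^sup>2) \<partial>motion_haar \<mu>)
      = (\<integral>\<^sup>+x. \<integral>\<^sup>+g. ennreal ((cmod (v (x, g)))\<^sup>2) \<partial>\<mu> \<partial>lborel)"
    unfolding eventually_finite_subsets_at_top using const by (intro exI[of _ "{}"]) auto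
  then have limc: "((\<lambda>F. \<integral>\<^sup>+g. ennreal ((cmod (v g - (\<Sum>\<sigma>\<in>F. S \<sigma> g)))\<^sup>2) \<partial>motion_haar \<mu>) \<longlongrightarrow>
      (\<integral>\<^sup>+x. \<integral>\<^sup>+g. ennreal ((cmod (v (x, g)))\<^sup>2) \<partial>\<mu> \<partial>lborel)) (finite_subsets_at_top P)"
    by (rule tendsto_eventually)
  have "(\<integral>\<^sup>+x. \<integral>\<^sup>+g. ennreal ((cmod (v (x, g)))\<^sup>2) \<partial>\<mu> \<partial>lborel) = 0"
    by (rule tendsto_unique[OF finite_subsets_at_top_neq_bot limc lim0])
  moreover have "(\<lambda>x. \<integral>\<^sup>+g. ennreal ((cmod (v (x, g)))\<^sup>2) \<partial>\<mu>) \<in> borel_measurable lborel"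
  proof -
    interpret prob_space \<mu> using \<mu> by (simp add: normalized_haar_def)
    show ?thesis using mv unfolding motion_haar_def by measurable
  qed
  ultimately have ae0: "AE x in lborel. (\<integral>\<^sup>+g. ennreal ((cmod (v (x, g)))\<^sup>2) \<partial>\<mu>) = 0"
    by (subst (asm) nn_integral_0_iff_AE) auto
  have slice_zero: "\<forall>k\<in>SO. v (x, k) = 0" if "(\<integral>\<^sup>+g. ennreal ((cmod (v (x, g)))\<^sup>2) \<partial>\<mu>) = 0" for x
  proof -
    have cont: "continuous_on SO (\<lambda>k. v (x, k))" by (rule continuous_on_motion_slice1[OF contv])
    have "AE g in \<mu>. ennreal ((cmod (v (x, g)))\<^sup>2) = 0"
      using that borel_measurable_haar[OF \<mu> cont] by (subst (asm) nn_integral_0_iff_AE) auto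
    then have "AE g in \<mu>. v (x, g) = 0" by (simp add: ennreal_eq_0_iff)
    then show ?thesis using haar_AE_zero_imp_zero[OF \<mu> cont] by blast
  qed
  have ae: "AE x in lborel. \<forall>k\<in>SO. v (x, k) = 0"
    using ae0 by (rule eventually_mono) (rule slice_zero)
  obtain x k where xk: "g = (x, k)" "k \<in> SO" using g by (auto simp: motion_group_def)
  have "AE x in lborel. v (x, k) = 0" using ae by eventually_elim (use xk in auto)
  then have "v (x, k) = 0"
    by (rule continuous_AE_zero_imp_zero[OF continuous_on_motion_slice2[OF contv xk(2)]])
  then show ?thesis using xk by simp
qed

theorem theorem4p3:
  fixes \<mu> :: "(real^'n^'n) measure"
    and B :: "real^'n^'n \<Rightarrow> real^'n^'n \<Rightarrow> real"
    and E :: "(real^'n^'n) set"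
    and P :: "(real^'n^'n \<Rightarrow> complex Matrix.mat) set"
    and f :: "(real^'n) \<times> (real^'n^'n) \<Rightarrow> complex"
    and u :: "(real^'n) \<times> (real^'n^'n) \<Rightarrow> real \<Rightarrow> complex"
    and \<theta> :: "real \<Rightarrow> real" and t0 C :: real
  assumes "CARD('n) \<ge> 2"
    and "normalized_haar \<mu>"
    and "ad_invariant_inner B" and "so_orthonormal_basis B E"
    and "unitary_dual P"
    and "test_function f"
    and "schroedinger_solution \<mu> E P f u"
    and "\<And>r. r \<ge> 0 \<Longrightarrow> \<theta> r \<ge> 0"
    and "\<And>R. R \<ge> 0 \<Longrightarrow> \<theta> absolutely_integrable_on {0..R}"
    and "t0 \<noteq> 0" and "C > 0"
    and "\<And>x k. (x, k) \<in> motion_group \<Longrightarrow> cmod (u (x, k) t0) \<le> C * exp (- \<theta> (norm x))"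
    and "(\<integral>\<^sup>+r\<in>{0..}. ennreal (\<theta> r / (1 + r\<^sup>2)) \<partial>lebesgue) = \<infinity>"
  shows "\<forall>g\<in>motion_group. \<forall>t. u g t = 0"
proof (intro ballI allI)
  fix g t assume g: "g \<in> (motion_group :: 'n motion set)"
  note \<mu> = \<open>normalized_haar \<mu>\<close> and P = \<open>unitary_dual P\<close> and f = \<open>test_function f\<close>
  note decay = assms(12) and \<theta>_nonneg = assms(8)
  have sm: "smooth_motion (\<lambda>g. u g t)" and ev: "evolves_to \<mu> E P f t (\<lambda>g. u g t)" for t
    using \<open>schroedinger_solution \<mu> E P f u\<close> by (auto simp: schroedinger_solution_def)
  have u_le: "cmod (u g t0) \<le> C" if g: "g \<in> motion_group" for g
  proof -
    have "cmod (u g t0) \<le> C * exp (- \<theta> (norm (fst g)))" using decay[of "fst g" "snd g"] g by simp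
    also have "\<dots> \<le> C * 1" using \<theta>_nonneg[of "norm (fst g)"] \<open>C > 0\<close> by (intro mult_left_mono) auto
    finally show ?thesis by simp
  qed
  have term_zero: "AE g in \<mu>. schroedinger_term \<mu> E f t \<pi> (x, g) = 0" if \<pi>: "\<pi> \<in> P" for \<pi> x
  proof (rule schroedinger_term_AE_zero[OF \<mu>])
    show ur: "unitary_rep \<pi>" using P \<pi> by (simp add: unitary_dual_def irreducible_rep_def)
    fix k l assume kl: "k < degree_rep \<pi>" "l < degree_rep \<pi>"
    obtain h where h: "compactly_supported h" "integrable lborel (fourier h)"
      "\<And>t x. coeff_fun \<mu> \<pi> k l (schroedinger_term \<mu> E f t \<pi>) x = rep_phase E \<pi> t * free_evolution t h x"
      using coeff_schroedinger_term_free_evolution[OF \<mu> ur kl f] by blast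
    have "h y = 0" for y
    proof (rule free_evolution_decay_imp_zero[OF h(1,2) \<open>t0 \<noteq> 0\<close>])
      fix x
      have "cmod (rep_phase E \<pi> t0 * free_evolution t0 h x) = cmod (coeff_fun \<mu> \<pi> k l (\<lambda>g. u g t0) x)"
        using evolves_to_coeff[OF \<mu> P f sm u_le ev \<pi> kl, where x = x] h(3) by simp
      also have "\<dots> \<le> C * exp (- \<theta> (norm x))"
        by (rule coeff_fun_le[OF \<mu> ur kl smooth_motion_continuous[OF sm]])
           (use decay in \<open>auto simp: motion_group_def\<close>)
      finally show "cmod (free_evolution t0 h x) \<le> (C * (2 * pi) ^ CARD('n)) * exp (- \<theta> (norm x))"
        by (simp add: norm_mult norm_rep_phase field_simps)
    qed (use assms(8,9,13) in auto)
    then have "h = (\<lambda>_. 0)" by auto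
    then show "coeff_fun \<mu> \<pi> k l (schroedinger_term \<mu> E f t \<pi>) x = 0"
      by (simp add: h(3) free_evolution_zero)
  qed
  show "u g t = 0" by (rule evolves_to_zero[OF \<mu> P f sm ev term_zero g])
qed

end
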